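(* Let $X$ and $Y$ be two graphs and let $X[Y]$ be their lexicographic product. Then $\mathrm{Qut}(X[Y]) = \mathrm{Qut}(Y) \wr_* \mathrm{Qut}(X)$ if and only if the following two conditions hold: (i) if $Y$ is not connected, then $X$ has no twins; (ii) if $\overline{Y}$ is not connected, then $\overline{X}$ has no twins.
   Context: All graphs are finite and simple, with nonempty vertex set, not necessarily connected. $\overline{X}$ denotes the complement of $X$ (vertex set $V(X)$, edges $xy$ with $x\neq y$ and $xy\notin E(X)$). Two distinct vertices $x,y$ of $X$ are twins in $X$ if $N_X(x)=N_X(y)$, where $N_X(x)$ is the set of neighbours of $x$ (so adjacent vertices are never twins). Lexicographic product: $X[Y]$ has vertex set $V(X)\times V(Y)$ and edge set $\{(x,y)(x',y') : xx'\in E(X)\}\cup\{(x,y)(x,y') : yy'\in E(Y)\}$. A magic unitary is a matrix $u=[u_{ij}]$ with entries in a unital $C^*$-algebra such that $u_{ij}^2=u_{ij}^*=u_{ij}$ for all $i,j$ and every row and every column sums to $1$. A quantum permutation group acting on a finite set $I$ is a pair $\mathbb{G}=(C(\mathbb{G}),u)$, where $C(\mathbb{G})$ is a unital $C^*$-algebra generated by the entries of a magic unitary $u=[u_{ij}]_{i,j\in I}$ (the fundamental representation), such that $\Delta(u_{ij})=\sum_k u_{ik}\otimes u_{kj}$ defines a unital $*$-homomorphism $\Delta: C(\mathbb{G})\to C(\mathbb{G})\otimes C(\mathbb{G})$ making $(C(\mathbb{G}),\Delta)$ a compact quantum group. Two quantum permutation groups $(C(\mathbb{G}),u)$ and $(C(\mathbb{H}),v)$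 acting on the same set are equal if $u_{ij}\mapsto v_{ij}$ defines a $*$-isomorphism $C(\mathbb{G})\to C(\mathbb{H})$. Quantum automorphism group: $\mathrm{Qut}(X)=(C(\mathrm{Qut}(X)),u)$, where $C(\mathrm{Qut}(X))$ is the universal unital $C^*$-algebra generated by elements $[u_{ij}]_{i,j\in V(X)}$ subject to: $u$ is a magic unitary, and $u_{ij}u_{k\ell}=0$ if $ik\in E(X)$ and $j\ell\notin E(X)$ or vice versa (equivalently $A_Xu=uA_X$, with $A_X$ the adjacency matrix). Free wreath product: for quantum permutation groups $\mathbb{G}=(C(\mathbb{G}),[u_{ij}]_{i,j\in[m]})$ and $\mathbb{H}=(C(\mathbb{H}),[v_{ab}]_{a,b\in[n]})$, let $C(\mathbb{G}^{*n})$ be the free product, amalgamated over $\mathbb{C}$ (coproduct of unital $C^*$-algebras), of $n$ copies of $C(\mathbb{G})$, and let $u^{(a)}=[u^{(a)}_{ij}]$ be the fundamental representation of the $a$-th copy. Then $\mathbb{G}\wr_*\mathbb{H}$ is the quantum permutation group acting on $[n]\times[m]$ with $C(\mathbb{G}\wr_*\mathbb{H})=(C(\mathbb{G}^{*n})*_{\mathbb{C}}C(\mathbb{H}))/\langle u^{(a)}_{ij}v_{ab}=v_{ab}u^{(a)}_{ij} \mid i,j\in[m],\ a,b\in[n]\rangle$ and fundamental representation $w_{(a,i)(b,j)}=u^{(a)}_{ij}v_{ab}$. Thus $\mathrm{Qut}(Y)\wr_*\mathrm{Qut}(X)$ acts on $V(X)\times V(Y)=V(X[Y])$. *)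

theory Defs
  imports
    Complex_Main
    "HOL-Library.Poly_Mapping"
    "HOL-Algebra.Ring"
    "Graph_Theory.Graph_Theory"
begin

section \<open>Graphs\<close>

text \<open>
  A finite simple graph is a \<open>pair_graph\<close> of the AFP entry Graph_Theory: a finite vertex set
  with a symmetric and loop-free set of arcs.  An edge \<open>xy\<close> is thus the two arcs \<open>(x, y)\<close> and
  \<open>(y, x)\<close>.
\<close>

definition graph_compl :: "'a pair_pre_digraph \<Rightarrow> 'a pair_pre_digraph" where
  "graph_compl X =
     \<lparr> pverts = pverts X,
       parcs = {(x, y). x \<in> pverts X \<and> y \<in> pverts X \<and> x \<noteq> y \<and> (x, y) \<notin> parcs X} \<rparr>"

definition nbrs :: "'a pair_pre_digraph \<Rightarrow> 'a \<Rightarrow> 'a set" where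
  "nbrs X x = {y. (x, y) \<in> parcs X}"

definition twins :: "'a pair_pre_digraph \<Rightarrow> 'a \<Rightarrow> 'a \<Rightarrow> bool" where
  "twins X x y \<longleftrightarrow> x \<in> pverts X \<and> y \<in> pverts X \<and> x \<noteq> y \<and> nbrs X x = nbrs X y"

definition graph_lex :: "'a pair_pre_digraph \<Rightarrow> 'b pair_pre_digraph \<Rightarrow> ('a \<times> 'b) pair_pre_digraph"
  where
  "graph_lex X Y =
     \<lparr> pverts = pverts X \<times> pverts Y,
       parcs =
         {((x, y), (x', y')) | x y x' y'.
            (x, x') \<in> parcs X \<and> y \<in> pverts Y \<and> y' \<in> pverts Y} \<union>
         {((x, y), (x, y')) | x y y'. x \<in> pverts X \<and> (y, y') \<in> parcs Y} \<rparr>"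


section \<open>C*-algebras\<close>

text \<open>
  Complex unital *-algebras, and the same with a norm, as records extending the rings of
  HOL-Algebra.  The records carry no axioms.
\<close>

record 'a star_algebra = "'a ring" +
  scal :: "complex \<Rightarrow> 'a \<Rightarrow> 'a"
  star :: "'a \<Rightarrow> 'a"

record 'a cstar_algebra = "'a star_algebra" +
  nrm :: "'a \<Rightarrow> real"

definition star_hom ::
  "('a, 'm) star_algebra_scheme \<Rightarrow> ('b, 'n) star_algebra_scheme \<Rightarrow> ('a \<Rightarrow> 'b) set" where
  "star_hom A B =
     {h \<in> ring_hom A B.
        (\<forall>c. \<forall>x \<in> carrier A. h (scal A c x) = scal B c (h x)) \<and>
        (\<forall>x \<in> carrier A. h (star A x) = star B (h x))}"

definition star_iso ::
  "('a, 'm) star_algebra_scheme \<Rightarrow> ('b, 'n) star_algebra_scheme \<Rightarrow> ('a \<Rightarrow> 'b) set" where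
  "star_iso A B = {h \<in> star_hom A B. bij_betw h (carrier A) (carrier B)}"

definition cstar_seminorm :: "('a, 'm) star_algebra_scheme \<Rightarrow> ('a \<Rightarrow> real) \<Rightarrow> bool" where
  "cstar_seminorm A q \<longleftrightarrow>
     (\<forall>x \<in> carrier A. 0 \<le> q x) \<and>
     (\<forall>c. \<forall>x \<in> carrier A. q (scal A c x) = cmod c * q x) \<and>
     (\<forall>x \<in> carrier A. \<forall>y \<in> carrier A. q (x \<oplus>\<^bsub>A\<^esub> y) \<le> q x + q y) \<and>
     (\<forall>x \<in> carrier A. \<forall>y \<in> carrier A. q (x \<otimes>\<^bsub>A\<^esub> y) \<le> q x * q y) \<and>
     (\<forall>x \<in> carrier A. q (star A x \<otimes>\<^bsub>A\<^esub> x) = (q x)\<^sup>2)"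

text \<open>
  The C*-algebra obtained from a *-algebra \<open>A\<close> and a set \<open>Q\<close> of C*-seminorms on \<open>A\<close> that is
  closed under pointwise suprema and pointwise bounded: divide by the null space of the largest
  seminorm \<open>sup_seminorm Q\<close> and complete.  The elements are classes of Cauchy sequences modulo null
  sequences.
\<close>

definition sup_seminorm :: "('a \<Rightarrow> real) set \<Rightarrow> 'a \<Rightarrow> real" where
  "sup_seminorm Q x = (SUP q \<in> Q. q x)"

definition cauchy_seqs :: "('a, 'm) star_algebra_scheme \<Rightarrow> ('a \<Rightarrow> real) \<Rightarrow> (nat \<Rightarrow> 'a) set" where
  "cauchy_seqs A p =
     {s. (\<forall>n. s n \<in> carrier A) \<and>
         (\<forall>e > 0. \<exists>N. \<forall>m \<ge> N. \<forall>n \<ge> N. p (s m \<ominus>\<^bsub>A\<^esub> s n) < e)}"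

definition null_rel :: "('a, 'm) star_algebra_scheme \<Rightarrow> ('a \<Rightarrow> real) \<Rightarrow> (nat \<Rightarrow> 'a) rel" where
  "null_rel A p =
     {(s, t). s \<in> cauchy_seqs A p \<and> t \<in> cauchy_seqs A p \<and>
              (\<lambda>n. p (s n \<ominus>\<^bsub>A\<^esub> t n)) \<longlonglongrightarrow> 0}"

definition cstar_completion ::
  "('a, 'm) star_algebra_scheme \<Rightarrow> ('a \<Rightarrow> real) set \<Rightarrow> (nat \<Rightarrow> 'a) set cstar_algebra" where
  "cstar_completion A Q =
     (let p = sup_seminorm Q; E = null_rel A p in
      \<lparr> carrier = cauchy_seqs A p // E,
        monoid.mult = (\<lambda>S T. \<Union>s \<in> S. \<Union>t \<in> T. E `` {\<lambda>n. s n \<otimes>\<^bsub>A\<^esub> t n}),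
        one = E `` {\<lambda>n. \<one>\<^bsub>A\<^esub>},
        zero = E `` {\<lambda>n. \<zero>\<^bsub>A\<^esub>},
        add = (\<lambda>S T. \<Union>s \<in> S. \<Union>t \<in> T. E `` {\<lambda>n. s n \<oplus>\<^bsub>A\<^esub> t n}),
        scal = (\<lambda>c S. \<Union>s \<in> S. E `` {\<lambda>n. scal A c (s n)}),
        star = (\<lambda>S. \<Union>s \<in> S. E `` {\<lambda>n. star A (s n)}),
        nrm = (\<lambda>S. THE r. \<exists>s \<in> S. (\<lambda>n. p (s n)) \<longlonglongrightarrow> r) \<rparr>)"

definition completion_map ::
  "('a, 'm) star_algebra_scheme \<Rightarrow> ('a \<Rightarrow> real) set \<Rightarrow> 'a \<Rightarrow> (nat \<Rightarrow> 'a) set" where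
  "completion_map A Q x = null_rel A (sup_seminorm Q) `` {\<lambda>n. x}"


subsection \<open>The free *-algebra on a set\<close>

text \<open>
  The letter \<open>(g, False)\<close> stands for the generator \<open>g\<close>, the letter \<open>(g, True)\<close> for its adjoint.
  With concatenation as addition of words, \<open>'g word \<Rightarrow>\<^sub>0 complex\<close> is the monoid algebra of the
  free monoid on these letters.
\<close>

datatype 'g word = Word (letters: "('g \<times> bool) list")

instantiation word :: (type) monoid_add
begin

definition zero_word :: "'a word" where
  "0 = Word []"

definition plus_word :: "'a word \<Rightarrow> 'a word \<Rightarrow> 'a word" where
  "v + w = Word (letters v @ letters w)"

instance
  by standard (simp_all add: zero_word_def plus_word_def)

end

definition word_star :: "'g word \<Rightarrow> 'g word" where
  "word_star w = Word (rev (map (\<lambda>(g, b). (g, \<not> b)) (letters w)))"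

lemma word_star_word_star [simp]: "word_star (word_star w) = w"
  by (cases w) (simp add: word_star_def rev_map comp_def case_prod_beta)

type_synonym 'g free_poly = "'g word \<Rightarrow>\<^sub>0 complex"

definition free_gen :: "'g \<Rightarrow> 'g free_poly" where
  "free_gen g = Poly_Mapping.single (Word [(g, False)]) 1"

definition free_scal :: "complex \<Rightarrow> 'g free_poly \<Rightarrow> 'g free_poly" where
  "free_scal c f = Poly_Mapping.single 0 c * f"

lift_definition free_star :: "'g free_poly \<Rightarrow> 'g free_poly" is
  "\<lambda>f w. cnj (f (word_star w))"
proof -
  fix f :: "'g word \<Rightarrow> complex"
  assume "finite {w. f w \<noteq> 0}"
  moreover have "{w. cnj (f (word_star w)) \<noteq> 0} \<subseteq> word_star ` {w. f w \<noteq> 0}"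
    by (auto intro!: image_eqI[where x = "word_star _"])
  ultimately show "finite {w. cnj (f (word_star w)) \<noteq> 0}"
    by (meson finite_imageI finite_subset)
qed

definition free_star_algebra :: "'g set \<Rightarrow> 'g free_poly star_algebra" where
  "free_star_algebra G =
     \<lparr> carrier = {f. \<forall>w \<in> Poly_Mapping.keys f. fst ` set (letters w) \<subseteq> G},
       monoid.mult = (*),
       one = 1,
       zero = 0,
       add = (+),
       scal = free_scal,
       star = free_star \<rparr>"


subsection \<open>Universal C*-algebras, coproducts and quotients\<close>

text \<open>
  The universal unital C*-algebra generated by \<open>G\<close> subject to \<open>r = 0\<close> for \<open>r \<in> R\<close>.
\<close>

definition universal_seminorms :: "'g set \<Rightarrow> 'g free_poly set \<Rightarrow> ('g free_poly \<Rightarrow> real) set" where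
  "universal_seminorms G R =
     {q. cstar_seminorm (free_star_algebra G) q \<and> (\<forall>r \<in> R. q r = 0)}"

definition cstar_universal ::
  "'g set \<Rightarrow> 'g free_poly set \<Rightarrow> (nat \<Rightarrow> 'g free_poly) set cstar_algebra" where
  "cstar_universal G R = cstar_completion (free_star_algebra G) (universal_seminorms G R)"

definition universal_gen ::
  "'g set \<Rightarrow> 'g free_poly set \<Rightarrow> 'g \<Rightarrow> (nat \<Rightarrow> 'g free_poly) set" where
  "universal_gen G R g =
     completion_map (free_star_algebra G) (universal_seminorms G R) (free_gen g)"

text \<open>
  \<open>\<iota>\<close> becomes a unital *-homomorphism on \<open>A\<close> once the null space of \<open>q\<close> is divided out.  The last
  clause is no further restriction when \<open>A\<close> is a C*-algebra and \<open>q\<close> a C*-seminorm, since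
  *-homomorphisms between C*-algebras are contractive; it makes boundedness of the suprema below
  explicit.
\<close>

definition hom_seminorm ::
  "('a, 'm) cstar_algebra_scheme \<Rightarrow> ('a \<Rightarrow> 'g free_poly) \<Rightarrow> ('g free_poly \<Rightarrow> real) \<Rightarrow> bool" where
  "hom_seminorm A \<iota> q \<longleftrightarrow>
     (\<forall>x \<in> carrier A. \<forall>y \<in> carrier A. q (\<iota> (x \<oplus>\<^bsub>A\<^esub> y) - (\<iota> x + \<iota> y)) = 0) \<and>
     (\<forall>x \<in> carrier A. \<forall>y \<in> carrier A. q (\<iota> (x \<otimes>\<^bsub>A\<^esub> y) - \<iota> x * \<iota> y) = 0) \<and>
     (\<forall>c. \<forall>x \<in> carrier A. q (\<iota> (scal A c x) - free_scal c (\<iota> x)) = 0) \<and>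
     (\<forall>x \<in> carrier A. q (\<iota> (star A x) - free_star (\<iota> x)) = 0) \<and>
     q (\<iota> \<one>\<^bsub>A\<^esub> - 1) = 0 \<and>
     (\<forall>x \<in> carrier A. q (\<iota> x) \<le> nrm A x)"

text \<open>Coproduct, as unital C*-algebras, of copies of \<open>A\<close> indexed by \<open>J\<close>.\<close>

definition copower_seminorms ::
  "'j set \<Rightarrow> ('a, 'm) cstar_algebra_scheme \<Rightarrow> (('j \<times> 'a) free_poly \<Rightarrow> real) set" where
  "copower_seminorms J A =
     {q. cstar_seminorm (free_star_algebra (J \<times> carrier A)) q \<and>
         (\<forall>a \<in> J. hom_seminorm A (\<lambda>x. free_gen (a, x)) q)}"

definition cstar_copower ::
  "'j set \<Rightarrow> ('a, 'm) cstar_algebra_scheme \<Rightarrow> (nat \<Rightarrow> ('j \<times> 'a) free_poly) set cstar_algebra" where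
  "cstar_copower J A =
     cstar_completion (free_star_algebra (J \<times> carrier A)) (copower_seminorms J A)"

definition copower_in ::
  "'j set \<Rightarrow> ('a, 'm) cstar_algebra_scheme \<Rightarrow> 'j \<Rightarrow> 'a \<Rightarrow> (nat \<Rightarrow> ('j \<times> 'a) free_poly) set" where
  "copower_in J A a x =
     completion_map (free_star_algebra (J \<times> carrier A)) (copower_seminorms J A) (free_gen (a, x))"

text \<open>Coproduct of two unital C*-algebras.\<close>

definition coprod_seminorms ::
  "('a, 'm) cstar_algebra_scheme \<Rightarrow> ('b, 'n) cstar_algebra_scheme \<Rightarrow> (('a + 'b) free_poly \<Rightarrow> real) set"
  where
  "coprod_seminorms A B =
     {q. cstar_seminorm (free_star_algebra (carrier A <+> carrier B)) q \<and>
         hom_seminorm A (\<lambda>x. free_gen (Inl x)) q \<and>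
         hom_seminorm B (\<lambda>y. free_gen (Inr y)) q}"

definition cstar_coprod ::
  "('a, 'm) cstar_algebra_scheme \<Rightarrow> ('b, 'n) cstar_algebra_scheme \<Rightarrow>
     (nat \<Rightarrow> ('a + 'b) free_poly) set cstar_algebra" where
  "cstar_coprod A B =
     cstar_completion (free_star_algebra (carrier A <+> carrier B)) (coprod_seminorms A B)"

definition coprod_in ::
  "('a, 'm) cstar_algebra_scheme \<Rightarrow> ('b, 'n) cstar_algebra_scheme \<Rightarrow> 'a + 'b \<Rightarrow>
     (nat \<Rightarrow> ('a + 'b) free_poly) set" where
  "coprod_in A B z =
     completion_map (free_star_algebra (carrier A <+> carrier B)) (coprod_seminorms A B) (free_gen z)"

text \<open>
  Quotient of a C*-algebra \<open>A\<close> by the closed two-sided ideal \<open>\<langle>S\<rangle>\<close>: the quotient norm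
  \<open>x \<mapsto> dist x \<langle>S\<rangle>\<close> is the largest C*-seminorm on \<open>A\<close> that vanishes on \<open>S\<close>, and every C*-seminorm
  on \<open>A\<close> is bounded by the norm.
\<close>

definition quotient_seminorms :: "('a, 'm) cstar_algebra_scheme \<Rightarrow> 'a set \<Rightarrow> ('a \<Rightarrow> real) set" where
  "quotient_seminorms A S =
     {q. cstar_seminorm A q \<and> (\<forall>x \<in> carrier A. q x \<le> nrm A x) \<and> (\<forall>s \<in> S. q s = 0)}"

definition cstar_quotient ::
  "('a, 'm) cstar_algebra_scheme \<Rightarrow> 'a set \<Rightarrow> (nat \<Rightarrow> 'a) set cstar_algebra" where
  "cstar_quotient A S = cstar_completion A (quotient_seminorms A S)"

definition quotient_map :: "('a, 'm) cstar_algebra_scheme \<Rightarrow> 'a set \<Rightarrow> 'a \<Rightarrow> (nat \<Rightarrow> 'a) set" where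
  "quotient_map A S = completion_map A (quotient_seminorms A S)"


section \<open>Quantum permutation groups\<close>

text \<open>
  The data of a quantum permutation group.  The comultiplication is determined by the fundamental
  representation and is not part of the data.
\<close>

record ('i, 'a) quantum_perm_group =
  points :: "'i set"
  cfun :: "'a cstar_algebra"
  fund :: "'i \<Rightarrow> 'i \<Rightarrow> 'a"

definition qperm_equal :: "('i, 'a) quantum_perm_group \<Rightarrow> ('i, 'b) quantum_perm_group \<Rightarrow> bool" where
  "qperm_equal \<G> \<H> \<longleftrightarrow>
     points \<G> = points \<H> \<and>
     (\<exists>h \<in> star_iso (cfun \<G>) (cfun \<H>).
        \<forall>i \<in> points \<G>. \<forall>j \<in> points \<G>. h (fund \<G> i j) = fund \<H> i j)"

definition magic_relations :: "'i set \<Rightarrow> ('i \<Rightarrow> 'i \<Rightarrow> 'g free_poly) \<Rightarrow> 'g free_poly set" where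
  "magic_relations I u =
     {u i j * u i j - u i j | i j. i \<in> I \<and> j \<in> I} \<union>
     {free_star (u i j) - u i j | i j. i \<in> I \<and> j \<in> I} \<union>
     {(\<Sum>j \<in> I. u i j) - 1 | i. i \<in> I} \<union>
     {(\<Sum>i \<in> I. u i j) - 1 | j. j \<in> I}"

definition qut_relations :: "'v pair_pre_digraph \<Rightarrow> ('v \<times> 'v) free_poly set" where
  "qut_relations X =
     magic_relations (pverts X) (\<lambda>i j. free_gen (i, j)) \<union>
     {free_gen (i, j) * free_gen (k, l) | i j k l.
        i \<in> pverts X \<and> j \<in> pverts X \<and> k \<in> pverts X \<and> l \<in> pverts X \<and>
        ((i, k) \<in> parcs X \<and> (j, l) \<notin> parcs X \<or> (i, k) \<notin> parcs X \<and> (j, l) \<in> parcs X)}"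

definition Qut ::
  "'v pair_pre_digraph \<Rightarrow> ('v, (nat \<Rightarrow> ('v \<times> 'v) free_poly) set) quantum_perm_group" where
  "Qut X =
     \<lparr> points = pverts X,
       cfun = cstar_universal (pverts X \<times> pverts X) (qut_relations X),
       fund = (\<lambda>i j. universal_gen (pverts X \<times> pverts X) (qut_relations X) (i, j)) \<rparr>"

text \<open>
  \<open>free_wreath \<G> \<H>\<close> is the free wreath product of \<open>\<G>\<close>, acting on \<open>I\<close>, by \<open>\<H>\<close>, acting on \<open>J\<close>.
  It acts on \<open>J \<times> I\<close>.
\<close>

definition free_wreath ::
  "('i, 'a) quantum_perm_group \<Rightarrow> ('j, 'b) quantum_perm_group \<Rightarrow>
   ('j \<times> 'i, (nat \<Rightarrow> (nat \<Rightarrow> ((nat \<Rightarrow> ('j \<times> 'a) free_poly) set + 'b) free_poly) set) set)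
     quantum_perm_group" where
  "free_wreath \<G> \<H> =
     (let I = points \<G>; J = points \<H>;
          P = cstar_copower J (cfun \<G>);
          D = cstar_coprod P (cfun \<H>);
          u = (\<lambda>a i j. coprod_in P (cfun \<H>) (Inl (copower_in J (cfun \<G>) a (fund \<G> i j))));
          v = (\<lambda>a b. coprod_in P (cfun \<H>) (Inr (fund \<H> a b)));
          S = {u a i j \<otimes>\<^bsub>D\<^esub> v a b \<ominus>\<^bsub>D\<^esub> v a b \<otimes>\<^bsub>D\<^esub> u a i j | i j a b.
                 i \<in> I \<and> j \<in> I \<and> a \<in> J \<and> b \<in> J}
      in \<lparr> points = J \<times> I,
           cfun = cstar_quotient D S,
           fund = (\<lambda>(a, i) (b, j). quotient_map D S (u a i j \<otimes>\<^bsub>D\<^esub> v a b)) \<rparr>)"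

end

theory Submission
  imports Defs
begin

text \<open>
  Let \<open>w\<close> be the fundamental representation of \<open>Qut(X[Y])\<close>.  If \<open>w\<close> respects the fibres
  \<open>{a} \<times> V(Y)\<close>, i.e. \<open>w\<^bsub>(a,i)(b,j)\<^esub> w\<^bsub>(a,i')(c,k)\<^esub> = 0\<close> for \<open>b \<noteq> c\<close>, then its sums over fibres and over
  transversals satisfy the relations of \<open>Qut(X)\<close> and \<open>Qut(Y)\<close>, commute as required, and have
  product \<open>w\<close>, which gives the isomorphism with the free wreath product.

  Suppose that the complement of \<open>Y\<close> is connected and that \<open>b\<close> and \<open>c\<close> are adjacent in \<open>X\<close>.
  Put \<open>W = w\<^bsub>(a,i')(c,k)\<^esub>\<close> and let \<open>Q\<^bsub>t\<^esub>\<close> be the sum of the column \<open>t\<close> of \<open>w\<close> over the fibre of \<open>a\<close>.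
  If \<open>t, r\<close> are nonadjacent in the fibre of \<open>b\<close>, then \<open>r\<close> distinguishes \<open>t\<close> from \<open>(c,k)\<close>, and a vertex
  that distinguishes two vertices of a fibre lies in that fibre; hence \<open>Q\<^bsub>t\<^esub> W = Q\<^bsub>t\<^esub> Q\<^bsub>r\<^esub> W\<close>, and by symmetry
  \<open>Q\<^bsub>t\<^esub> W = Q\<^bsub>r\<^esub> W\<close>.  By connectedness \<open>x = Q\<^bsub>t\<^esub> W\<close> does not depend on \<open>t\<close>, and summing \<open>Q\<^bsub>t\<^esub> x = x\<close>
  over the fibre of \<open>b\<close> writes \<open>|V(Y)| x\<close> as a sum of \<open>|V(Y)| - 1\<close> contractions applied to \<open>x\<close>, so
  \<open>x = 0\<close>.  If \<open>Y\<close> is disconnected, its complement is connected, and nonadjacent \<open>b, c\<close> are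
  separated by a third vertex of \<open>X\<close> because they are not twins, which reduces this case to the
  adjacent one.  The remaining cases follow by passing to complements.

  Conversely, if \<open>x, x'\<close> are twins of \<open>X\<close> and \<open>C\<close> is a component of a disconnected \<open>Y\<close>, exchanging
  \<open>{x} \<times> C\<close> and \<open>{x'} \<times> C\<close> is an automorphism of \<open>X[Y]\<close> that breaks fibres, and the
  character of \<open>C(Qut(X[Y]))\<close> that it defines violates a relation of the free wreath product.

  Beyond completeness and the C*-identity, the only analytic input is that projections with sum \<open>1\<close>
  are mutually orthogonal, which has an elementary proof.
\<close>

subsection \<open>C*-seminorms\<close>

text \<open>The entries of \<open>w\<close> do not commute, so it cannot be followed vertex by
  vertex where the points of a fibre go. The relations only say that certain products of two entries
  vanish. A longer product is controlled by inserting a row or column sum equal to \<open>1\<close>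
  between two factors and discarding the indices that one of the neighbouring factors excludes. What
  survives between \<open>w s t\<close> and \<open>W\<close> is a sum over the whole fibre of
  \<open>a\<close>; this is why the sums \<open>Q\<close> are used instead of single entries, and
  only for them does the relation between \<open>t\<close> and \<open>r\<close> become symmetric.
  The summand missing in the count \<open>|V(Y)| - 1\<close> is the row of \<open>(a,i')\<close>,
  whose entries over \<open>b\<close> are orthogonal to \<open>W\<close>.

  There is no Hilbert space behind these computations: vanishing is obtained from
  \<open>star z z = 0\<close> or from a norm estimate. Likewise, maps out of the universal algebras
  arise by pulling the norm of the target back to a seminorm that already belongs to the defining
  family. Equality of quantum permutation groups provides only a *-isomorphism; the converse
  therefore pulls an equation between finite sums of entries back along an injective
  homomorphism.\<close>

locale star_alg = ring A for A :: "('a, 'm) star_algebra_scheme" (structure) +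
  assumes scal_closed [simp, intro]: "x \<in> carrier A \<Longrightarrow> scal A c x \<in> carrier A"
    and star_closed [simp, intro]: "x \<in> carrier A \<Longrightarrow> star A x \<in> carrier A"
    and scal_add: "\<lbrakk>x \<in> carrier A; y \<in> carrier A\<rbrakk> \<Longrightarrow> scal A c (x \<oplus> y) = scal A c x \<oplus> scal A c y"
    and add_scal: "x \<in> carrier A \<Longrightarrow> scal A (c + d) x = scal A c x \<oplus> scal A d x"
    and scal_scal: "x \<in> carrier A \<Longrightarrow> scal A c (scal A d x) = scal A (c * d) x"
    and one_scal [simp]: "x \<in> carrier A \<Longrightarrow> scal A 1 x = x"
    and scal_mult_left: "\<lbrakk>x \<in> carrier A; y \<in> carrier A\<rbrakk> \<Longrightarrow> scal A c x \<otimes> y = scal A c (x \<otimes> y)"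
    and scal_mult_right: "\<lbrakk>x \<in> carrier A; y \<in> carrier A\<rbrakk> \<Longrightarrow> x \<otimes> scal A c y = scal A c (x \<otimes> y)"
    and star_add: "\<lbrakk>x \<in> carrier A; y \<in> carrier A\<rbrakk> \<Longrightarrow> star A (x \<oplus> y) = star A x \<oplus> star A y"
    and star_mult: "\<lbrakk>x \<in> carrier A; y \<in> carrier A\<rbrakk> \<Longrightarrow> star A (x \<otimes> y) = star A y \<otimes> star A x"
    and star_scal: "x \<in> carrier A \<Longrightarrow> star A (scal A c x) = scal A (cnj c) (star A x)"
    and star_star [simp]: "x \<in> carrier A \<Longrightarrow> star A (star A x) = x"
begin

lemma zero_scal [simp]: "x \<in> carrier A \<Longrightarrow> scal A 0 x = \<zero>"
  by (metis add.r_cancel_one' add_scal add_0 scal_closed)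

lemma scal_zero [simp]: "scal A c \<zero> = \<zero>"
  by (metis add.r_cancel_one' scal_add scal_closed l_zero zero_closed)

lemma scal_uminus_one: "x \<in> carrier A \<Longrightarrow> scal A (-1) x = \<ominus> x"
  by (metis add.right_inverse add_scal minus_equality one_scal scal_closed
      add.left_inverse zero_scal add.m_comm ab_left_minus)

lemma scal_a_inv: "x \<in> carrier A \<Longrightarrow> scal A c (\<ominus> x) = \<ominus> (scal A c x)"
  by (metis mult.commute scal_closed scal_scal scal_uminus_one)

lemma star_zero [simp]: "star A \<zero> = \<zero>"
  by (metis add.r_cancel_one' star_add star_closed l_zero zero_closed)

lemma star_a_inv: "x \<in> carrier A \<Longrightarrow> star A (\<ominus> x) = \<ominus> (star A x)"
  by (metis a_inv_closed add.inv_equality l_neg star_add star_closed star_zero)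

lemma star_one [simp]: "star A \<one> = \<one>"
  by (metis l_one one_closed star_closed star_mult star_star)

lemma star_minus: "\<lbrakk>x \<in> carrier A; y \<in> carrier A\<rbrakk> \<Longrightarrow> star A (x \<ominus> y) = star A x \<ominus> star A y"
  by (simp add: a_minus_def star_add star_a_inv)

lemma scal_minus: "\<lbrakk>x \<in> carrier A; y \<in> carrier A\<rbrakk> \<Longrightarrow> scal A c (x \<ominus> y) = scal A c x \<ominus> scal A c y"
  by (simp add: a_minus_def scal_add scal_a_inv)

lemma r_distr_minus:
  "\<lbrakk>x \<in> carrier A; y \<in> carrier A; z \<in> carrier A\<rbrakk> \<Longrightarrow> x \<otimes> (y \<ominus> z) = x \<otimes> y \<ominus> x \<otimes> z"
  by (simp add: a_minus_def r_distr r_minus)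

lemma l_distr_minus:
  "\<lbrakk>x \<in> carrier A; y \<in> carrier A; z \<in> carrier A\<rbrakk> \<Longrightarrow> (y \<ominus> z) \<otimes> x = y \<otimes> x \<ominus> z \<otimes> x"
  by (simp add: a_minus_def l_distr l_minus)

lemma minus_add_cancel: "\<lbrakk>x \<in> carrier A; y \<in> carrier A\<rbrakk> \<Longrightarrow> (x \<ominus> y) \<oplus> y = x"
  by (simp add: a_minus_def a_assoc l_neg)

lemma minus_eq_zero_iff: "\<lbrakk>x \<in> carrier A; y \<in> carrier A\<rbrakk> \<Longrightarrow> x \<ominus> y = \<zero> \<longleftrightarrow> x = y"
  by (metis a_minus_def minus_add_cancel l_zero r_neg)

lemma star_finsum:
  "f \<in> I \<rightarrow> carrier A \<Longrightarrow> star A (\<Oplus>i\<in>I. f i) = (\<Oplus>i\<in>I. star A (f i))"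
  by (induction I rule: infinite_finite_induct) (auto simp: star_add Pi_def)

lemma finsum_const_scal:
  assumes "x \<in> carrier A" "finite I"
  shows "(\<Oplus>i\<in>I. x) = scal A (of_nat (card I)) x"
  using assms(2,1) by (induction I rule: finite_induct) (auto simp: add_scal Pi_def)

end

locale star_seminorm = star_alg A for A :: "('a, 'm) star_algebra_scheme" (structure) +
  fixes p :: "'a \<Rightarrow> real"
  assumes seminorm: "cstar_seminorm A p"
begin

lemma p_nonneg [simp]: "x \<in> carrier A \<Longrightarrow> 0 \<le> p x"
  and p_scal: "x \<in> carrier A \<Longrightarrow> p (scal A c x) = cmod c * p x"
  and p_add: "\<lbrakk>x \<in> carrier A; y \<in> carrier A\<rbrakk> \<Longrightarrow> p (x \<oplus> y) \<le> p x + p y"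
  and p_mult: "\<lbrakk>x \<in> carrier A; y \<in> carrier A\<rbrakk> \<Longrightarrow> p (x \<otimes> y) \<le> p x * p y"
  and p_star_mult: "x \<in> carrier A \<Longrightarrow> p (star A x \<otimes> x) = (p x)\<^sup>2"
  using seminorm by (auto simp: cstar_seminorm_def)

lemma p_zero [simp]: "p \<zero> = 0"
  using p_scal[of \<zero> 0] by simp

lemma p_a_inv [simp]: "x \<in> carrier A \<Longrightarrow> p (\<ominus> x) = p x"
  using p_scal[of x "-1"] by (simp add: scal_uminus_one)

lemma p_minus_commute: "\<lbrakk>x \<in> carrier A; y \<in> carrier A\<rbrakk> \<Longrightarrow> p (x \<ominus> y) = p (y \<ominus> x)"
  by (metis a_minus_def add.inv_mult_group add.inv_inv a_inv_closed p_a_inv minus_closed)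

lemma p_minus: "\<lbrakk>x \<in> carrier A; y \<in> carrier A\<rbrakk> \<Longrightarrow> p (x \<ominus> y) \<le> p x + p y"
  using p_add[of x "\<ominus> y"] by (simp add: a_minus_def)

lemma p_triangle:
  assumes "x \<in> carrier A" "y \<in> carrier A" "z \<in> carrier A"
  shows "p (x \<ominus> z) \<le> p (x \<ominus> y) + p (y \<ominus> z)"
proof -
  have "x \<ominus> z = (x \<ominus> y) \<oplus> (y \<ominus> z)"
    using assms by (simp add: ring_simprules)
  then show ?thesis using p_add assms by simp
qed

lemma p_diff_le:
  assumes "x \<in> carrier A" "y \<in> carrier A"
  shows "\<bar>p x - p y\<bar> \<le> p (x \<ominus> y)"
proof -
  have "x = (x \<ominus> y) \<oplus> y" "y = (y \<ominus> x) \<oplus> x"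
    using assms by (simp_all add: minus_add_cancel)
  then have "p x \<le> p (x \<ominus> y) + p y" "p y \<le> p (y \<ominus> x) + p x"
    using p_add assms by (metis minus_closed)+
  then show ?thesis using p_minus_commute[OF assms] by linarith
qed

text \<open>The C*-identity gives \<open>p y \<le> p (star A y)\<close> after cancelling a factor
  \<open>p y\<close>; the same bound for \<open>star A y\<close> gives equality.\<close>

lemma p_star [simp]:
  assumes "x \<in> carrier A" shows "p (star A x) = p x"
proof -
  have *: "p y \<le> p (star A y)" if "y \<in> carrier A" for y
  proof (cases "p y = 0")
    case False
    have "p y * p y \<le> p (star A y) * p y"
      using p_star_mult[OF that] p_mult[of "star A y" y] that by (simp add: power2_eq_square)
    with False p_nonneg[OF that] show ?thesis by simp
  qed (use that in simp)
  show ?thesis using *[OF assms] *[of "star A x"] assms by simp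
qed

lemma p_projection_le_one:
  assumes "x \<in> carrier A" "x \<otimes> x = x" "star A x = x"
  shows "p x \<le> 1"
proof -
  have "p x = p x * p x" using p_star_mult[OF assms(1)] assms by (simp add: power2_eq_square)
  then show ?thesis by auto
qed

lemma p_finsum:
  "f \<in> I \<rightarrow> carrier A \<Longrightarrow> p (\<Oplus>i\<in>I. f i) \<le> (\<Sum>i\<in>I. p (f i))"
proof (induction I rule: infinite_finite_induct)
  case (insert x F)
  then have "p (\<Oplus>i\<in>insert x F. f i) \<le> p (f x) + p (\<Oplus>i\<in>F. f i)"
    by (simp add: p_add Pi_def)
  with insert show ?case by (simp add: Pi_def)
qed auto

text \<open>
  On a state space, the hypotheses say that \<open>1 \<plusminus> t\<close> lies in \<open>[-1, 1]\<close> for every spectral value \<open>t\<close>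
  of \<open>h\<close>.  The argument replaces spectral theory by the observation that the set of complex \<open>z\<close> with
  \<open>p (e + z h) \<le> 1\<close> contains \<open>1, -1, \<i>, -\<i>\<close> and is closed under multiplication by \<open>1 + \<i>\<close>.
\<close>

lemma extreme_point:
  assumes e: "e \<in> carrier A" "e \<otimes> e = e" "star A e = e"
    and h: "h \<in> carrier A" "star A h = h" "e \<otimes> h = h" "h \<otimes> e = h"
    and le: "p (e \<oplus> h) \<le> 1" "p (e \<ominus> h) \<le> 1"
  shows "p h = 0"
proof -
  \<comment> \<open>All computations stay in the span of \<open>e\<close>, \<open>h\<close> and
    \<open>h \<otimes> h\<close>, on which \<open>e\<close> acts as the unit. Recording coefficients
    turns them into arithmetic with complex numbers.\<close>
  define lin where "lin a b c = scal A a e \<oplus> scal A b h \<oplus> scal A c (h \<otimes> h)" for a b c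
  have lin_closed [simp]: "lin a b c \<in> carrier A" for a b c
    using e h by (simp add: lin_def)
  have lin_add: "lin a b c \<oplus> lin a' b' c' = lin (a + a') (b + b') (c + c')" for a b c a' b' c'
    using e h by (simp add: lin_def add_scal a_ac)
  have lin_scal: "scal A t (lin a b c) = lin (t * a) (t * b) (t * c)" for t a b c
    using e h by (simp add: lin_def scal_add scal_scal)
  have lin_mult: "lin 1 z 0 \<otimes> lin 1 w 0 = lin 1 (z + w) (z * w)" for z w
    using e h by (simp add: lin_def l_distr r_distr scal_mult_left scal_mult_right scal_scal
        add_scal scal_add a_ac mult.commute)
  have lin_star: "star A (lin 1 z 0) = lin 1 (cnj z) 0" for z
    using e h by (simp add: lin_def star_add star_scal)
  define P where "P z \<longleftrightarrow> p (lin 1 z 0) \<le> 1" for z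
  \<comment> \<open>The average of the squares of \<open>e + z h\<close> and \<open>e + w h\<close>.
    Its quadratic coefficient is what the later choices of \<open>z\<close> and \<open>w\<close> set
    to 1 or cancel.\<close>
  have avg: "p (lin 1 ((z + w)) ((z * z + w * w) / 2)) \<le> 1" if "P z" "P w" for z w
  proof -
    have "lin 1 (z + w) ((z * z + w * w) / 2)
        = scal A (1/2) (lin 1 z 0 \<otimes> lin 1 z 0 \<oplus> lin 1 w 0 \<otimes> lin 1 w 0)"
      by (simp add: lin_mult lin_add lin_scal add_divide_distrib)
    also have "p \<dots> \<le> 1/2 * (p (lin 1 z 0 \<otimes> lin 1 z 0) + p (lin 1 w 0 \<otimes> lin 1 w 0))"
      by (simp add: p_scal p_add)
    also have "\<dots> \<le> 1/2 * (p (lin 1 z 0) * p (lin 1 z 0) + p (lin 1 w 0) * p (lin 1 w 0))"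
      by (intro mult_left_mono add_mono p_mult) auto
    also have "\<dots> \<le> 1/2 * (1 * 1 + 1 * 1)"
      using that by (intro mult_left_mono add_mono mult_mono) (auto simp: P_def)
    finally show ?thesis by simp
  qed
  have P1: "P 1" "P (-1)"
    using le e h by (simp_all add: P_def lin_def scal_uminus_one a_minus_def)
  \<comment> \<open>For \<open>z = \<i>\<close> or \<open>z = -\<i>\<close>,
    \<open>cnj z + z = 0\<close> and \<open>cnj z * z = 1\<close>, so the C*-identity turns the
    squared norm into the norm of \<open>e + h h\<close>, which is the average belonging to 1 and
    -1.\<close>
  have Pi: "P z" if "z = \<i> \<or> z = -\<i>" for z
  proof -
    have "(p (lin 1 z 0))\<^sup>2 = p (lin 1 (cnj z) 0 \<otimes> lin 1 z 0)"
      by (simp add: p_star_mult[symmetric] lin_star)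
    also have "\<dots> = p (lin 1 0 1)"
      using that by (auto simp: lin_mult)
    also have "\<dots> \<le> 1" using avg[OF P1] by simp
    finally show ?thesis by (simp add: P_def power_le_one_iff)
  qed
  have rot: "P (z + w)" if "P z" "P w" "w * w = - (z * z)" for z w
    using avg[OF that(1,2)] that(3) by (simp add: P_def)
  \<comment> \<open>With \<open>w = \<i> * z\<close> the quadratic term cancels and
    \<open>z + w\<close> is \<open>(1 + \<i>) * z\<close>. The four quarter turns of the power are
    carried together because each of them is a sum of two neighbouring quarter turns of the previous
    power. As \<open>1 + \<i>\<close> has modulus \<open>sqrt 2\<close>, the multiples of
    \<open>h\<close> grow without bound while their norms stay below 2.\<close>
  have all: "P ((1 + \<i>) ^ n) \<and> P (\<i> * (1 + \<i>) ^ n) \<and> P (- ((1 + \<i>) ^ n)) \<and> P (- (\<i> * (1 + \<i>) ^ n))" for n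
  proof (induction n)
    case 0 show ?case using P1 Pi by simp
  next
    case (Suc n)
    let ?z = "(1 + \<i>) ^ n"
    have sq: "(\<i> * ?z) * (\<i> * ?z) = - (?z * ?z)" by (simp add: algebra_simps)
    show ?case
      using rot[of ?z "\<i> * ?z"] rot[of "\<i> * ?z" "- ?z"] rot[of "- ?z" "- (\<i> * ?z)"]
        rot[of "- (\<i> * ?z)" ?z] Suc sq
      by (simp add: algebra_simps)
  qed
  have norm_1i: "cmod (1 + \<i>) = sqrt 2" by (simp add: cmod_def)
  have "sqrt 2 ^ n * p h \<le> 2" for n
  proof -
    have "scal A ((1 + \<i>) ^ n) h = lin 1 ((1 + \<i>) ^ n) 0 \<ominus> e"
      using e h by (simp add: lin_def ring_simprules)
    then have "p (scal A ((1 + \<i>) ^ n) h) \<le> p (lin 1 ((1 + \<i>) ^ n) 0) + p e"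
      using p_minus e by simp
    also have "\<dots> \<le> 2"
      using all[of n] p_projection_le_one[OF e] by (simp add: P_def)
    finally show ?thesis
      using h by (simp add: p_scal norm_power norm_1i)
  qed
  show ?thesis
  proof (rule ccontr)
    assume "p h \<noteq> 0"
    then have "p h > 0" using p_nonneg[OF h(1)] by simp
    moreover obtain n where "2 / p h < sqrt 2 ^ n"
      using real_arch_pow[of "sqrt 2"] by auto
    ultimately have "2 < sqrt 2 ^ n * p h" by (simp add: field_simps)
    with \<open>sqrt 2 ^ n * p h \<le> 2\<close> show False by simp
  qed
qed

end

section \<open>Projections with sum one in a C*-algebra\<close>

locale cstar = star_seminorm A "nrm A" for A :: "('a, 'm) cstar_algebra_scheme" (structure) +
  assumes nrm_eq_zero: "\<lbrakk>x \<in> carrier A; nrm A x = 0\<rbrakk> \<Longrightarrow> x = \<zero>"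
    and complete: "s \<in> cauchy_seqs A (nrm A) \<Longrightarrow> \<exists>x\<in>carrier A. (\<lambda>n. nrm A (s n \<ominus> x)) \<longlonglongrightarrow> 0"
begin

lemma star_mult_eq_zero:
  assumes "x \<in> carrier A" "star A x \<otimes> x = \<zero>" shows "x = \<zero>"
  using p_star_mult[OF assms(1)] assms nrm_eq_zero by simp

definition proj :: "'a \<Rightarrow> bool" where
  "proj x \<longleftrightarrow> x \<in> carrier A \<and> x \<otimes> x = x \<and> star A x = x"

lemma projD: "proj x \<Longrightarrow> x \<in> carrier A" "proj x \<Longrightarrow> x \<otimes> x = x" "proj x \<Longrightarrow> star A x = x"
  by (auto simp: proj_def)

lemma proj_compl: "proj x \<Longrightarrow> proj (\<one> \<ominus> x)"
  by (auto simp: proj_def star_minus r_distr_minus l_distr_minus) (simp add: a_minus_def r_neg)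

text \<open>Compressing \<open>\<one>\<close> by \<open>e = q l\<close> shows that the compressions
  \<open>b j\<close> with \<open>j \<noteq> l\<close> add up to zero. Instead of an appeal to
  positivity, a small multiple \<open>h\<close> of \<open>b k\<close> is shown to keep both
  \<open>e \<oplus> h\<close> and \<open>e \<ominus> h\<close> in the unit ball, so that
  \<open>extreme_point\<close> applies. Finally \<open>b k\<close> has the form
  \<open>star x x\<close> with \<open>x = q k \<otimes> q l\<close>.\<close>

lemma proj_orthogonal:
  assumes fin: "finite K" and pr: "\<And>k. k \<in> K \<Longrightarrow> proj (q k)" and sum: "(\<Oplus>k\<in>K. q k) = \<one>"
    and kl: "k \<in> K" "l \<in> K" "k \<noteq> l"
  shows "q k \<otimes> q l = \<zero>"
proof -
  define e where "e = q l"
  define b where "b j = e \<otimes> q j \<otimes> e" for j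
  define J where "J = K - {k, l}"
  \<comment> \<open>The number of projections other than \<open>e\<close>. It is the divisor for
    which both \<open>N (e + h)\<close> and \<open>N (e - h)\<close> become sums of \<open>N\<close>
    elements of norm at most one.\<close>
  define N where "N = real (card J) + 1"
  have N: "N > 0" by (simp add: N_def)
  have qc: "j \<in> K \<Longrightarrow> q j \<in> carrier A" for j using pr projD by blast
  have e: "e \<in> carrier A" "e \<otimes> e = e" "star A e = e" using pr[OF kl(2)] by (auto simp: e_def proj_def)
  have bc: "b j \<in> carrier A" if "j \<in> K" for j using e qc that by (simp add: b_def)
  have eb: "e \<otimes> b j = b j" "b j \<otimes> e = b j" "star A (b j) = b j" if "j \<in> K" for j
    using e qc that projD(3)[OF pr[OF that]]
    by (simp_all add: b_def m_assoc[symmetric] star_mult) (simp_all add: m_assoc)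
  have "K = insert l (insert k J)" "finite J" "l \<notin> insert k J" "k \<notin> J"
    using kl fin by (auto simp: J_def)
  then have "\<one> = q l \<oplus> (q k \<oplus> (\<Oplus>j\<in>J. q j))"
    using sum qc kl by (subst sum[symmetric]) (auto simp: Pi_def)
  then have one: "\<one> = e \<oplus> (q k \<oplus> (\<Oplus>j\<in>J. q j))" by (simp add: e_def)
  have qJ: "q \<in> J \<rightarrow> carrier A" using qc by (auto simp: J_def)
  have "e \<otimes> \<one> \<otimes> e = e \<oplus> (b k \<oplus> e \<otimes> (\<Oplus>j\<in>J. q j) \<otimes> e)"
    unfolding one b_def using e qc[OF kl(1)] finsum_closed[OF qJ] by (simp add: l_distr r_distr)
  moreover have "e \<otimes> (\<Oplus>j\<in>J. q j) \<otimes> e = (\<Oplus>j\<in>J. b j)"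
    using e qJ \<open>finite J\<close> by (simp add: finsum_ldistr finsum_rdistr b_def Pi_def)
  moreover define B where "B = (\<Oplus>j\<in>J. b j)"
  moreover have Bc: "B \<in> carrier A" using bc by (auto simp: B_def J_def)
  ultimately have "e = e \<oplus> (b k \<oplus> B)" using e by simp
  then have "e \<oplus> (b k \<oplus> B) = e \<oplus> \<zero>" using e by simp
  then have bB: "b k \<oplus> B = \<zero>"
    using e bc[OF kl(1)] Bc by (simp only: add.Units_l_cancel add.m_closed zero_closed add.Units_eq)
  \<comment> \<open>The element is \<open>star A y \<otimes> y\<close> for a product
    \<open>y\<close> of two projections, so the C*-identity bounds it without an order on the
    algebra.\<close>
  have norm_eb: "nrm A (e \<ominus> b j) \<le> 1" if "j \<in> K" for j
  proof -
    define y where "y = (\<one> \<ominus> q j) \<otimes> e"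
    have pj: "proj (\<one> \<ominus> q j)" using proj_compl pr that by simp
    have yc: "y \<in> carrier A" using e projD(1)[OF pj] by (simp add: y_def)
    have "star A y \<otimes> y = e \<otimes> ((\<one> \<ominus> q j) \<otimes> (\<one> \<ominus> q j)) \<otimes> e"
      using e projD(1,3)[OF pj] by (simp add: y_def star_mult m_assoc)
    also have "\<dots> = e \<ominus> b j"
      using e qc[OF that] unfolding projD(2)[OF pj] by (simp add: b_def r_distr_minus l_distr_minus)
    finally have "nrm A (e \<ominus> b j) = (nrm A y)\<^sup>2" using p_star_mult[OF yc] by simp
    moreover have "nrm A (\<one> \<ominus> q j) \<le> 1" "nrm A e \<le> 1"
      using p_projection_le_one projD[OF pj] e by auto
    then have "nrm A (\<one> \<ominus> q j) * nrm A e \<le> 1 * 1"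
      using e projD(1)[OF pj] by (intro mult_mono) auto
    then have "nrm A y \<le> 1"
      unfolding y_def using p_mult[OF projD(1)[OF pj] e(1)] by simp
    ultimately show ?thesis using yc by (simp add: power_le_one)
  qed
  define h where "h = scal A (1 / of_real N) (b k)"
  have h: "h \<in> carrier A" "star A h = h" "e \<otimes> h = h" "h \<otimes> e = h"
    using e bc eb kl by (simp_all add: h_def star_scal scal_mult_left scal_mult_right)
  have Ne: "scal A (of_real (N - 1)) e = (\<Oplus>j\<in>J. e)"
    using e \<open>finite J\<close> by (simp add: finsum_const_scal N_def)
  have norm_e: "nrm A e \<le> 1" using p_projection_le_one e by simp
  \<comment> \<open>Since \<open>b k\<close> is minus the sum \<open>B\<close> of the other
    compressions, the left-hand side is the sum of \<open>e \<ominus> b j\<close> over the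
    \<open>N - 1\<close> indices in \<open>J\<close>.\<close>
  have 1: "nrm A (scal A (of_real (N - 1)) e \<oplus> b k) \<le> N - 1"
  proof -
    define M where "M = (\<Oplus>j\<in>J. e \<ominus> b j)"
    have Mc: "M \<in> carrier A" unfolding M_def using e bc by (intro finsum_closed) (auto simp: J_def)
    have "M \<oplus> B = (\<Oplus>j\<in>J. (e \<ominus> b j) \<oplus> b j)"
      unfolding B_def M_def using e bc by (subst finsum_addf) (auto simp: J_def)
    also have "\<dots> = scal A (of_real (N - 1)) e"
      unfolding Ne using e bc by (intro finsum_cong') (auto simp: J_def minus_add_cancel)
    finally have "scal A (of_real (N - 1)) e \<oplus> b k = M \<oplus> (b k \<oplus> B)"
      using Mc Bc bc[OF kl(1)] by (metis a_assoc a_comm)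
    then have "scal A (of_real (N - 1)) e \<oplus> b k = (\<Oplus>j\<in>J. e \<ominus> b j)"
      using bB Mc by (simp add: M_def)
    moreover have "nrm A (\<Oplus>j\<in>J. e \<ominus> b j) \<le> (\<Sum>j\<in>J. nrm A (e \<ominus> b j))"
      using e bc by (intro p_finsum) (auto simp: J_def)
    moreover have "\<dots> \<le> (\<Sum>j\<in>J. 1)" using norm_eb by (intro sum_mono) (auto simp: J_def)
    ultimately show ?thesis by (simp add: N_def)
  qed
  have split: "scal A (of_real N) e = scal A (of_real (N - 1)) e \<oplus> e"
    using e add_scal[of e "of_real (N - 1)" 1] by simp
  have sgn: "nrm A z \<le> 1" if "z \<in> carrier A" "scal A (of_real N) z = w" "nrm A w \<le> N" for z w
    using that(3) p_scal[OF that(1), of "of_real N"] N that(2) by simp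
  have "nrm A (e \<oplus> h) \<le> 1"
  proof (rule sgn)
    show "scal A (of_real N) (e \<oplus> h) = (scal A (of_real (N - 1)) e \<oplus> b k) \<oplus> e"
      using e h N bc[OF kl(1)] by (simp only: scal_add split) (simp add: h_def scal_scal a_ac)
    show "nrm A ((scal A (of_real (N - 1)) e \<oplus> b k) \<oplus> e) \<le> N"
      using p_add[of "scal A (of_real (N - 1)) e \<oplus> b k" e] 1 norm_e e bc[OF kl(1)] by simp
  qed (use e h in simp)
  moreover have "nrm A (e \<ominus> h) \<le> 1"
  proof (rule sgn)
    show "scal A (of_real N) (e \<ominus> h) = scal A (of_real (N - 1)) e \<oplus> (e \<ominus> b k)"
      using e h N bc[OF kl(1)] by (simp only: scal_minus split) (simp add: h_def scal_scal a_minus_def a_assoc)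
    have "nrm A (scal A (of_real (N - 1)) e) \<le> (N - 1) * 1"
      unfolding p_scal[OF e(1)] using e norm_e by (intro mult_mono) (auto simp: N_def)
    then show "nrm A (scal A (of_real (N - 1)) e \<oplus> (e \<ominus> b k)) \<le> N"
      using p_add[of "scal A (of_real (N - 1)) e" "e \<ominus> b k"] norm_eb[OF kl(1)] e bc[OF kl(1)] by simp
  qed (use e h in simp)
  ultimately have "nrm A h = 0" using extreme_point e h by simp
  then have "nrm A (b k) = 0" using N bc[OF kl(1)] by (simp add: h_def p_scal)
  then have "b k = \<zero>" using nrm_eq_zero bc kl by simp
  moreover have "star A (q k \<otimes> q l) \<otimes> (q k \<otimes> q l) = b k"
    using e projD[OF pr[OF kl(1)]] unfolding e_def[symmetric] b_def
    by (simp add: star_mult m_assoc) (simp add: m_assoc[symmetric])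
  ultimately show ?thesis using star_mult_eq_zero[of "q k \<otimes> q l"] qc kl by simp
qed

end

subsection \<open>Completions\<close>

lemma star_homI:
  assumes "\<And>x. x \<in> carrier A \<Longrightarrow> h x \<in> carrier B"
    and "\<And>x y. \<lbrakk>x \<in> carrier A; y \<in> carrier A\<rbrakk> \<Longrightarrow> h (x \<otimes>\<^bsub>A\<^esub> y) = h x \<otimes>\<^bsub>B\<^esub> h y"
    and "\<And>x y. \<lbrakk>x \<in> carrier A; y \<in> carrier A\<rbrakk> \<Longrightarrow> h (x \<oplus>\<^bsub>A\<^esub> y) = h x \<oplus>\<^bsub>B\<^esub> h y"
    and "h \<one>\<^bsub>A\<^esub> = \<one>\<^bsub>B\<^esub>"
    and "\<And>c x. x \<in> carrier A \<Longrightarrow> h (scal A c x) = scal B c (h x)"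
    and "\<And>x. x \<in> carrier A \<Longrightarrow> h (star A x) = star B (h x)"
  shows "h \<in> star_hom A B"
  using assms by (auto simp: star_hom_def ring_hom_def)

lemma star_homD:
  assumes "h \<in> star_hom A B"
  shows "x \<in> carrier A \<Longrightarrow> h x \<in> carrier B"
    and "\<lbrakk>x \<in> carrier A; y \<in> carrier A\<rbrakk> \<Longrightarrow> h (x \<otimes>\<^bsub>A\<^esub> y) = h x \<otimes>\<^bsub>B\<^esub> h y"
    and "\<lbrakk>x \<in> carrier A; y \<in> carrier A\<rbrakk> \<Longrightarrow> h (x \<oplus>\<^bsub>A\<^esub> y) = h x \<oplus>\<^bsub>B\<^esub> h y"
    and "h \<one>\<^bsub>A\<^esub> = \<one>\<^bsub>B\<^esub>"
    and "x \<in> carrier A \<Longrightarrow> h (scal A c x) = scal B c (h x)"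
    and "x \<in> carrier A \<Longrightarrow> h (star A x) = star B (h x)"
  using assms by (auto simp: star_hom_def ring_hom_def)

lemma star_hom_comp:
  "\<lbrakk>h \<in> star_hom A B; k \<in> star_hom B C\<rbrakk> \<Longrightarrow> (\<lambda>x. k (h x)) \<in> star_hom A C"
  by (rule star_homI) (simp_all add: star_homD)

lemma star_hom_zero:
  assumes "star_alg A" "star_alg B" "h \<in> star_hom A B"
  shows "h \<zero>\<^bsub>A\<^esub> = \<zero>\<^bsub>B\<^esub>"
proof -
  interpret A: star_alg A by fact
  interpret B: star_alg B by fact
  have "h (scal A 0 \<zero>\<^bsub>A\<^esub>) = scal B 0 (h \<zero>\<^bsub>A\<^esub>)"
    by (rule star_homD[OF assms(3)]) simp
  then show ?thesis using star_homD(1)[OF assms(3)] by simp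
qed

lemma star_hom_a_inv:
  assumes "star_alg A" "star_alg B" "h \<in> star_hom A B" "x \<in> carrier A"
  shows "h (\<ominus>\<^bsub>A\<^esub> x) = \<ominus>\<^bsub>B\<^esub> h x"
  using star_homD(1,5)[OF assms(3), of x] assms(4)
  by (metis assms(1,2) star_alg.scal_uminus_one)

lemma star_hom_minus:
  assumes "star_alg A" "star_alg B" "h \<in> star_hom A B" "x \<in> carrier A" "y \<in> carrier A"
  shows "h (x \<ominus>\<^bsub>A\<^esub> y) = h x \<ominus>\<^bsub>B\<^esub> h y"
proof -
  interpret A: star_alg A by fact
  show ?thesis
    using assms(4,5) by (simp add: a_minus_def star_homD(3)[OF assms(3)] star_hom_a_inv[OF assms(1-3)])
qed

lemma star_hom_finsum:
  assumes "star_alg A" "star_alg B" "h \<in> star_hom A B" "f \<in> I \<rightarrow> carrier A"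
  shows "h (finsum A f I) = finsum B (\<lambda>i. h (f i)) I"
proof -
  interpret A: star_alg A by fact
  interpret B: star_alg B by fact
  note h = star_homD[OF assms(3)]
  show ?thesis using assms(4)
    by (induction I rule: infinite_finite_induct)
      (auto simp: star_hom_zero[OF assms(1-3)] h Pi_def)
qed

text \<open>Contractivity belongs to the notion because it is what extends maps to completions and
  lets them be compared on dense subsets. Universal maps have it by construction, which takes the
  place of a spectral argument.\<close>

definition cstar_hom ::
  "('a, 'm) cstar_algebra_scheme \<Rightarrow> ('b, 'n) cstar_algebra_scheme \<Rightarrow> ('a \<Rightarrow> 'b) set" where
  "cstar_hom A B = {h \<in> star_hom A B. \<forall>x \<in> carrier A. nrm B (h x) \<le> nrm A x}"

lemma cstar_homD:
  assumes "h \<in> cstar_hom A B"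
  shows "h \<in> star_hom A B" "x \<in> carrier A \<Longrightarrow> nrm B (h x) \<le> nrm A x"
  using assms by (auto simp: cstar_hom_def)

lemma cstar_hom_comp:
  "\<lbrakk>h \<in> cstar_hom A B; k \<in> cstar_hom B C\<rbrakk> \<Longrightarrow> (\<lambda>x. k (h x)) \<in> cstar_hom A C"
  unfolding cstar_hom_def using star_hom_comp star_homD(1) by (fastforce intro: order_trans)

lemma cstar_hom_id: "(\<lambda>x. x) \<in> cstar_hom A A"
  by (auto simp: cstar_hom_def star_hom_def ring_hom_def)

section \<open>Cauchy sequences modulo null sequences\<close>

context star_seminorm
begin

text \<open>The filter is arbitrary so that one statement serves twice: along
  \<open>sequentially\<close> it shows independence of representatives, along the product filter it
  shows that Cauchy sequences are closed under the operation. The same holds for the next three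
  lemmas.\<close>

lemma null_add:
  assumes "\<And>i. a i \<in> carrier A" "\<And>i. b i \<in> carrier A" "\<And>i. c i \<in> carrier A" "\<And>i. d i \<in> carrier A"
    and "((\<lambda>i. p (a i \<ominus> b i)) \<longlongrightarrow> 0) F" "((\<lambda>i. p (c i \<ominus> d i)) \<longlongrightarrow> 0) F"
  shows "((\<lambda>i. p ((a i \<oplus> c i) \<ominus> (b i \<oplus> d i))) \<longlongrightarrow> 0) F"
proof (rule tendsto_sandwich[OF _ _ tendsto_const])
  show "((\<lambda>i. p (a i \<ominus> b i) + p (c i \<ominus> d i)) \<longlongrightarrow> 0) F"
    using tendsto_add[OF assms(5,6)] by simp
  have "p ((a i \<oplus> c i) \<ominus> (b i \<oplus> d i)) \<le> p (a i \<ominus> b i) + p (c i \<ominus> d i)" for i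
  proof -
    have "(a i \<oplus> c i) \<ominus> (b i \<oplus> d i) = (a i \<ominus> b i) \<oplus> (c i \<ominus> d i)"
      using assms(1-4) by (simp add: a_minus_def minus_add a_ac)
    then show ?thesis using p_add assms(1-4) by simp
  qed
  then show "\<forall>\<^sub>F i in F. p ((a i \<oplus> c i) \<ominus> (b i \<oplus> d i)) \<le> p (a i \<ominus> b i) + p (c i \<ominus> d i)"
    by simp
  show "\<forall>\<^sub>F i in F. 0 \<le> p ((a i \<oplus> c i) \<ominus> (b i \<oplus> d i))"
    using assms(1-4) by simp
qed

text \<open>The difference is split through the mixed product \<open>a i \<otimes> d i\<close>, so
  bounds are required for \<open>a\<close> and \<open>d\<close> alone.\<close>

lemma null_mult:
  assumes "\<And>i. a i \<in> carrier A" "\<And>i. b i \<in> carrier A" "\<And>i. c i \<in> carrier A" "\<And>i. d i \<in> carrier A"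
    and "((\<lambda>i. p (a i \<ominus> b i)) \<longlongrightarrow> 0) F" "((\<lambda>i. p (c i \<ominus> d i)) \<longlongrightarrow> 0) F"
    and "\<And>i. p (a i) \<le> M" "\<And>i. p (d i) \<le> N"
  shows "((\<lambda>i. p ((a i \<otimes> c i) \<ominus> (b i \<otimes> d i))) \<longlongrightarrow> 0) F"
proof (rule tendsto_sandwich[OF _ _ tendsto_const])
  show "((\<lambda>i. M * p (c i \<ominus> d i) + p (a i \<ominus> b i) * N) \<longlongrightarrow> 0) F"
    using tendsto_add[OF tendsto_mult[OF tendsto_const[of M] assms(6)]
        tendsto_mult[OF assms(5) tendsto_const[of N]]] by simp
  have "p ((a i \<otimes> c i) \<ominus> (b i \<otimes> d i)) \<le> M * p (c i \<ominus> d i) + p (a i \<ominus> b i) * N" for i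
  proof -
    have "p ((a i \<otimes> c i) \<ominus> (b i \<otimes> d i))
        \<le> p (a i \<otimes> c i \<ominus> a i \<otimes> d i) + p (a i \<otimes> d i \<ominus> b i \<otimes> d i)"
      using assms(1-4) by (intro p_triangle) auto
    also have "\<dots> = p (a i \<otimes> (c i \<ominus> d i)) + p ((a i \<ominus> b i) \<otimes> d i)"
      using assms(1-4) by (simp add: r_distr_minus l_distr_minus)
    also have "\<dots> \<le> p (a i) * p (c i \<ominus> d i) + p (a i \<ominus> b i) * p (d i)"
      using assms(1-4) by (intro add_mono p_mult) auto
    also have "\<dots> \<le> M * p (c i \<ominus> d i) + p (a i \<ominus> b i) * N"
      using assms by (intro add_mono mult_left_mono mult_right_mono) auto
    finally show ?thesis .
  qed
  then show "\<forall>\<^sub>F i in F. p ((a i \<otimes> c i) \<ominus> (b i \<otimes> d i)) \<le> M * p (c i \<ominus> d i) + p (a i \<ominus> b i) * N"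
    by simp
  show "\<forall>\<^sub>F i in F. 0 \<le> p ((a i \<otimes> c i) \<ominus> (b i \<otimes> d i))"
    using assms(1-4) by simp
qed

lemma null_scal:
  assumes "\<And>i. a i \<in> carrier A" "\<And>i. b i \<in> carrier A" "((\<lambda>i. p (a i \<ominus> b i)) \<longlongrightarrow> 0) F"
  shows "((\<lambda>i. p (scal A k (a i) \<ominus> scal A k (b i))) \<longlongrightarrow> 0) F"
  using tendsto_mult[OF tendsto_const[of "cmod k"] assms(3)] assms(1,2)
  by (simp add: scal_minus[symmetric] p_scal)

lemma null_star:
  assumes "\<And>i. a i \<in> carrier A" "\<And>i. b i \<in> carrier A" "((\<lambda>i. p (a i \<ominus> b i)) \<longlongrightarrow> 0) F"
  shows "((\<lambda>i. p (star A (a i) \<ominus> star A (b i))) \<longlongrightarrow> 0) F"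
  using assms by (simp add: star_minus[symmetric])

lemma null_trans:
  assumes "\<And>i. a i \<in> carrier A" "\<And>i. b i \<in> carrier A" "\<And>i. c i \<in> carrier A"
    and "((\<lambda>i. p (a i \<ominus> b i)) \<longlongrightarrow> 0) F" "((\<lambda>i. p (b i \<ominus> c i)) \<longlongrightarrow> 0) F"
  shows "((\<lambda>i. p (a i \<ominus> c i)) \<longlongrightarrow> 0) F"
proof (rule tendsto_sandwich[OF _ _ tendsto_const])
  show "((\<lambda>i. p (a i \<ominus> b i) + p (b i \<ominus> c i)) \<longlongrightarrow> 0) F"
    using tendsto_add[OF assms(4,5)] by simp
qed (use assms(1-3) p_triangle in auto)

lemma null_commute:
  assumes "\<And>i. a i \<in> carrier A" "\<And>i. b i \<in> carrier A"
  shows "((\<lambda>i. p (a i \<ominus> b i)) \<longlongrightarrow> 0) F \<longleftrightarrow> ((\<lambda>i. p (b i \<ominus> a i)) \<longlongrightarrow> 0) F"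
  using assms by (simp add: p_minus_commute)

text \<open>As a limit along the product filter, the Cauchy property becomes an instance of the
  preceding null lemmas, applied to \<open>s (fst i)\<close> and \<open>s (snd i)\<close>.\<close>

lemma cauchy_iff:
  "s \<in> cauchy_seqs A p \<longleftrightarrow> (\<forall>n. s n \<in> carrier A) \<and>
     ((\<lambda>i. p (s (fst i) \<ominus> s (snd i))) \<longlongrightarrow> 0) (sequentially \<times>\<^sub>F sequentially)"
proof (cases "\<forall>n. s n \<in> carrier A")
  case True
  then have "\<bar>p (s m \<ominus> s n)\<bar> = p (s m \<ominus> s n)" for m n by simp
  then show ?thesis
    using True unfolding cauchy_seqs_def tendsto_iff dist_real_def eventually_prod_sequentially
    by (auto, (metis p_minus_commute)+)
qed (auto simp: cauchy_seqs_def)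

lemma cauchyD: "s \<in> cauchy_seqs A p \<Longrightarrow> s n \<in> carrier A"
  by (simp add: cauchy_seqs_def)

lemma cauchy_bounded:
  assumes "s \<in> cauchy_seqs A p" obtains M where "\<And>n. p (s n) \<le> M"
proof -
  have c: "s n \<in> carrier A" for n using cauchyD assms .
  obtain N where N: "\<And>m n. m \<ge> N \<Longrightarrow> n \<ge> N \<Longrightarrow> p (s m \<ominus> s n) < 1"
    using assms zero_less_one unfolding cauchy_seqs_def by blast
  define M where "M = Max ((\<lambda>n. p (s n)) ` {..N}) + 1"
  have "p (s n) \<le> M" for n
  proof (cases "n \<le> N")
    case True
    then have "p (s n) \<le> Max ((\<lambda>n. p (s n)) ` {..N})" by (intro Max_ge) auto
    then show ?thesis by (simp add: M_def)
  next
    case False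
    then have "p (s n) \<le> p (s N) + 1"
      using p_diff_le[OF c[of n] c[of N]] N[of n N] by simp
    moreover have "p (s N) \<le> Max ((\<lambda>n. p (s n)) ` {..N})" by (intro Max_ge) auto
    ultimately show ?thesis unfolding M_def by linarith
  qed
  then show thesis using that by blast
qed

lemma cauchy_const [simp]: "x \<in> carrier A \<Longrightarrow> (\<lambda>n. x) \<in> cauchy_seqs A p"
  by (simp add: cauchy_seqs_def a_minus_def r_neg)

lemma cauchy_add:
  "\<lbrakk>s \<in> cauchy_seqs A p; t \<in> cauchy_seqs A p\<rbrakk> \<Longrightarrow> (\<lambda>n. s n \<oplus> t n) \<in> cauchy_seqs A p"
  unfolding cauchy_iff by (auto intro: null_add)

lemma cauchy_mult:
  assumes "s \<in> cauchy_seqs A p" "t \<in> cauchy_seqs A p"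
  shows "(\<lambda>n. s n \<otimes> t n) \<in> cauchy_seqs A p"
proof -
  obtain M N where "\<And>n. p (s n) \<le> M" "\<And>n. p (t n) \<le> N"
    using cauchy_bounded assms by metis
  then show ?thesis using assms unfolding cauchy_iff by (auto intro!: null_mult[where M = M and N = N])
qed

lemma cauchy_scal: "s \<in> cauchy_seqs A p \<Longrightarrow> (\<lambda>n. scal A c (s n)) \<in> cauchy_seqs A p"
  unfolding cauchy_iff by (auto intro: null_scal)

lemma cauchy_star: "s \<in> cauchy_seqs A p \<Longrightarrow> (\<lambda>n. star A (s n)) \<in> cauchy_seqs A p"
  unfolding cauchy_iff by (auto intro: null_star)

lemma cauchy_p_convergent:
  assumes "s \<in> cauchy_seqs A p" shows "(\<lambda>n. p (s n)) \<longlonglongrightarrow> lim (\<lambda>n. p (s n))"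
proof -
  have "Cauchy (\<lambda>n. p (s n))"
    unfolding Cauchy_def
  proof (intro allI impI)
    fix e :: real assume "e > 0"
    then obtain N where N: "\<And>m n. m \<ge> N \<Longrightarrow> n \<ge> N \<Longrightarrow> p (s m \<ominus> s n) < e"
      using assms unfolding cauchy_seqs_def by blast
    then show "\<exists>M. \<forall>m\<ge>M. \<forall>n\<ge>M. dist (p (s m)) (p (s n)) < e"
      using p_diff_le cauchyD[OF assms] unfolding dist_real_def by (meson le_less_trans)
  qed
  then show ?thesis using Cauchy_convergent_iff convergent_LIMSEQ_iff by blast
qed

lemma null_rel_equiv: "equiv (cauchy_seqs A p) (null_rel A p)"
proof (rule equivI)
  show "null_rel A p \<subseteq> cauchy_seqs A p \<times> cauchy_seqs A p"
    by (auto simp: null_rel_def)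
  show "refl_on (cauchy_seqs A p) (null_rel A p)"
    by (auto simp: refl_on_def null_rel_def cauchyD a_minus_def r_neg)
  show "sym (null_rel A p)"
    by (auto simp: sym_def null_rel_def p_minus_commute cauchyD)
  show "trans (null_rel A p)"
    by (auto simp: trans_def null_rel_def intro: null_trans[OF cauchyD cauchyD cauchyD])
qed

end

section \<open>The largest seminorm of a pointwise bounded family\<close>

locale seminorm_family = star_alg A for A :: "('a, 'm) star_algebra_scheme" (structure) +
  fixes Q :: "('a \<Rightarrow> real) set"
  assumes nonempty: "Q \<noteq> {}"
    and seminorms: "q \<in> Q \<Longrightarrow> cstar_seminorm A q"
    and bdd: "x \<in> carrier A \<Longrightarrow> bdd_above ((\<lambda>q. q x) ` Q)"
begin

lemma sup_upper: "\<lbrakk>x \<in> carrier A; q \<in> Q\<rbrakk> \<Longrightarrow> q x \<le> sup_seminorm Q x"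
  unfolding sup_seminorm_def by (rule cSUP_upper[OF _ bdd])

lemma sup_least: "(\<And>q. q \<in> Q \<Longrightarrow> q x \<le> r) \<Longrightarrow> sup_seminorm Q x \<le> r"
  unfolding sup_seminorm_def by (rule cSUP_least[OF nonempty])

text \<open>The C*-identity survives suprema because squaring is monotone on nonnegative reals.
  Homogeneity needs a direct argument only as an upper bound; for \<open>c \<noteq> 0\<close> the
  lower bound is the upper bound for \<open>1 / c\<close>.\<close>

lemma sup_cstar_seminorm: "cstar_seminorm A (sup_seminorm Q)"
proof -
  have ss: "star_seminorm A q" if "q \<in> Q" for q
    using seminorms that by unfold_locales
  have nonneg: "0 \<le> sup_seminorm Q x" if "x \<in> carrier A" for x
  proof -
    obtain q where q: "q \<in> Q" using nonempty by blast
    then have "0 \<le> q x" using star_seminorm.p_nonneg[OF ss] that by blast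
    also have "q x \<le> sup_seminorm Q x" using that q by (rule sup_upper)
    finally show ?thesis .
  qed
  have scal: "sup_seminorm Q (scal A c x) \<le> cmod c * sup_seminorm Q x" if "x \<in> carrier A" for c x
    by (rule sup_least) (simp add: star_seminorm.p_scal[OF ss] that mult_left_mono sup_upper)
  show ?thesis
    unfolding cstar_seminorm_def
  proof (intro conjI ballI allI)
    fix x assume x: "x \<in> carrier A"
    show "0 \<le> sup_seminorm Q x" using nonneg x .
    show "sup_seminorm Q (star A x \<otimes> x) = (sup_seminorm Q x)\<^sup>2"
    proof (rule antisym)
      show "sup_seminorm Q (star A x \<otimes> x) \<le> (sup_seminorm Q x)\<^sup>2"
        by (rule sup_least)
          (auto simp: star_seminorm.p_star_mult[OF ss] x
            intro!: power_mono sup_upper star_seminorm.p_nonneg[OF ss])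
      have "sup_seminorm Q x \<le> sqrt (sup_seminorm Q (star A x \<otimes> x))"
      proof (rule sup_least)
        fix q assume "q \<in> Q"
        then have "(q x)\<^sup>2 \<le> sup_seminorm Q (star A x \<otimes> x)"
          using sup_upper[of "star A x \<otimes> x" q] x by (simp add: star_seminorm.p_star_mult[OF ss])
        then show "q x \<le> sqrt (sup_seminorm Q (star A x \<otimes> x))" by (rule real_le_rsqrt)
      qed
      then have "(sup_seminorm Q x)\<^sup>2 \<le> (sqrt (sup_seminorm Q (star A x \<otimes> x)))\<^sup>2"
        using nonneg[OF x] by (rule power_mono)
      then show "(sup_seminorm Q x)\<^sup>2 \<le> sup_seminorm Q (star A x \<otimes> x)"
        using nonneg[of "star A x \<otimes> x"] x by simp
    qed
  next
    fix c x assume x: "x \<in> carrier A"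
    show "sup_seminorm Q (scal A c x) = cmod c * sup_seminorm Q x"
    proof (cases "c = 0")
      case True
      have "sup_seminorm Q (scal A 0 x) \<le> 0" using scal[OF x, of 0] by simp
      then show ?thesis using True nonneg[of "scal A 0 x"] x by simp
    next
      case False
      have "sup_seminorm Q x \<le> cmod (1 / c) * sup_seminorm Q (scal A c x)"
        using scal[of "scal A c x" "1 / c"] x False by (simp add: scal_scal)
      then show ?thesis using scal[OF x, of c] False
        by (simp add: norm_divide field_simps)
    qed
  next
    fix x y assume xy: "x \<in> carrier A" "y \<in> carrier A"
    show "sup_seminorm Q (x \<oplus> y) \<le> sup_seminorm Q x + sup_seminorm Q y"
    proof (rule sup_least)
      fix q assume q: "q \<in> Q"
      show "q (x \<oplus> y) \<le> sup_seminorm Q x + sup_seminorm Q y"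
        using star_seminorm.p_add[OF ss[OF q] xy] sup_upper[OF xy(1) q] sup_upper[OF xy(2) q] by linarith
    qed
    show "sup_seminorm Q (x \<otimes> y) \<le> sup_seminorm Q x * sup_seminorm Q y"
    proof (rule sup_least)
      fix q assume q: "q \<in> Q"
      have "q (x \<otimes> y) \<le> q x * q y" using star_seminorm.p_mult[OF ss[OF q] xy] .
      also have "\<dots> \<le> sup_seminorm Q x * sup_seminorm Q y"
        using star_seminorm.p_nonneg[OF ss[OF q]] xy q by (intro mult_mono sup_upper nonneg)
      finally show "q (x \<otimes> y) \<le> sup_seminorm Q x * sup_seminorm Q y" .
    qed
  qed
qed

sublocale star_seminorm A "sup_seminorm Q"
  using sup_cstar_seminorm by unfold_locales

end

section \<open>Algebraic operations and norm on the completion\<close>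

context seminorm_family
begin

abbreviation p where "p \<equiv> sup_seminorm Q"
abbreviation C where "C \<equiv> cauchy_seqs A p"
abbreviation K where "K \<equiv> cstar_completion A Q"

definition cls :: "(nat \<Rightarrow> 'a) \<Rightarrow> (nat \<Rightarrow> 'a) set" where
  "cls s = null_rel A p `` {s}"

lemma cls_eq_iff:
  "\<lbrakk>s \<in> C; t \<in> C\<rbrakk> \<Longrightarrow> cls s = cls t \<longleftrightarrow> (\<lambda>n. p (s n \<ominus> t n)) \<longlonglongrightarrow> 0"
  unfolding cls_def eq_equiv_class_iff[OF null_rel_equiv] by (simp add: null_rel_def)

lemma mem_cls_iff: "s \<in> C \<Longrightarrow> t \<in> cls s \<longleftrightarrow> t \<in> C \<and> (\<lambda>n. p (s n \<ominus> t n)) \<longlonglongrightarrow> 0"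
  by (auto simp: cls_def null_rel_def)

lemma self_mem_cls: "s \<in> C \<Longrightarrow> s \<in> cls s"
  by (simp add: mem_cls_iff cauchyD a_minus_def r_neg)

text \<open>The operations of the completion are unions over all representatives; such a union
  collapses to a single class once the result does not depend on the representative.\<close>

lemma UN_cls:
  assumes "s \<in> C" "\<And>s'. s' \<in> cls s \<Longrightarrow> cls (f s') = cls (f s)"
  shows "(\<Union>s'\<in>cls s. cls (f s')) = cls (f s)"
  using assms self_mem_cls by blast

lemma UN_cls2:
  assumes "s \<in> C" "t \<in> C"
    and "\<And>s' t'. \<lbrakk>s' \<in> cls s; t' \<in> cls t\<rbrakk> \<Longrightarrow> cls (f s' t') = cls (f s t)"
  shows "(\<Union>s'\<in>cls s. \<Union>t'\<in>cls t. cls (f s' t')) = cls (f s t)"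
  using assms self_mem_cls by blast

lemma K_carrier: "carrier K = cls ` C"
  by (auto simp: cstar_completion_def Let_def quotient_def cls_def)

lemma K_zero: "\<zero>\<^bsub>K\<^esub> = cls (\<lambda>n. \<zero>)" and K_one: "\<one>\<^bsub>K\<^esub> = cls (\<lambda>n. \<one>)"
  by (simp_all add: cstar_completion_def Let_def cls_def)

lemma K_add:
  assumes "s \<in> C" "t \<in> C" shows "cls s \<oplus>\<^bsub>K\<^esub> cls t = cls (\<lambda>n. s n \<oplus> t n)"
proof -
  have "cls s \<oplus>\<^bsub>K\<^esub> cls t = (\<Union>s'\<in>cls s. \<Union>t'\<in>cls t. cls (\<lambda>n. s' n \<oplus> t' n))"
    by (simp add: cstar_completion_def Let_def cls_def)
  also have "\<dots> = cls (\<lambda>n. s n \<oplus> t n)"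
  proof (rule UN_cls2[OF assms])
    fix s' t' assume "s' \<in> cls s" "t' \<in> cls t"
    then have *: "s' \<in> C" "t' \<in> C" "(\<lambda>n. p (s n \<ominus> s' n)) \<longlonglongrightarrow> 0" "(\<lambda>n. p (t n \<ominus> t' n)) \<longlonglongrightarrow> 0"
      using assms by (auto simp: mem_cls_iff)
    have "cls (\<lambda>n. s n \<oplus> t n) = cls (\<lambda>n. s' n \<oplus> t' n)"
      unfolding cls_eq_iff[OF cauchy_add[OF assms] cauchy_add[OF *(1,2)]]
      by (rule null_add[OF _ _ _ _ *(3,4)]) (use assms * cauchyD in auto)
    then show "cls (\<lambda>n. s' n \<oplus> t' n) = cls (\<lambda>n. s n \<oplus> t n)" ..
  qed
  finally show ?thesis .
qed

lemma K_mult: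
  assumes "s \<in> C" "t \<in> C" shows "cls s \<otimes>\<^bsub>K\<^esub> cls t = cls (\<lambda>n. s n \<otimes> t n)"
proof -
  have "cls s \<otimes>\<^bsub>K\<^esub> cls t = (\<Union>s'\<in>cls s. \<Union>t'\<in>cls t. cls (\<lambda>n. s' n \<otimes> t' n))"
    by (simp add: cstar_completion_def Let_def cls_def)
  also have "\<dots> = cls (\<lambda>n. s n \<otimes> t n)"
  proof (rule UN_cls2[OF assms])
    fix s' t' assume "s' \<in> cls s" "t' \<in> cls t"
    then have *: "s' \<in> C" "t' \<in> C" "(\<lambda>n. p (s n \<ominus> s' n)) \<longlonglongrightarrow> 0" "(\<lambda>n. p (t n \<ominus> t' n)) \<longlonglongrightarrow> 0"
      using assms by (auto simp: mem_cls_iff)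
    obtain M N where MN: "\<And>n. p (s n) \<le> M" "\<And>n. p (t' n) \<le> N"
      using cauchy_bounded assms(1) *(2) by metis
    have "cls (\<lambda>n. s n \<otimes> t n) = cls (\<lambda>n. s' n \<otimes> t' n)"
      unfolding cls_eq_iff[OF cauchy_mult[OF assms] cauchy_mult[OF *(1,2)]]
      by (rule null_mult[OF _ _ _ _ *(3,4) MN]) (use assms * cauchyD in auto)
    then show "cls (\<lambda>n. s' n \<otimes> t' n) = cls (\<lambda>n. s n \<otimes> t n)" ..
  qed
  finally show ?thesis .
qed

lemma K_scal:
  assumes "s \<in> C" shows "scal K c (cls s) = cls (\<lambda>n. scal A c (s n))"
proof -
  have "scal K c (cls s) = (\<Union>s'\<in>cls s. cls (\<lambda>n. scal A c (s' n)))"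
    by (simp add: cstar_completion_def Let_def cls_def)
  also have "\<dots> = cls (\<lambda>n. scal A c (s n))"
  proof (rule UN_cls[OF assms])
    fix s' assume "s' \<in> cls s"
    then have *: "s' \<in> C" "(\<lambda>n. p (s n \<ominus> s' n)) \<longlonglongrightarrow> 0"
      using assms by (auto simp: mem_cls_iff)
    have "cls (\<lambda>n. scal A c (s n)) = cls (\<lambda>n. scal A c (s' n))"
      unfolding cls_eq_iff[OF cauchy_scal[OF assms] cauchy_scal[OF *(1)]]
      by (rule null_scal[OF _ _ *(2)]) (use assms * cauchyD in auto)
    then show "cls (\<lambda>n. scal A c (s' n)) = cls (\<lambda>n. scal A c (s n))" ..
  qed
  finally show ?thesis .
qed

lemma K_star:
  assumes "s \<in> C" shows "star K (cls s) = cls (\<lambda>n. star A (s n))"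
proof -
  have "star K (cls s) = (\<Union>s'\<in>cls s. cls (\<lambda>n. star A (s' n)))"
    by (simp add: cstar_completion_def Let_def cls_def)
  also have "\<dots> = cls (\<lambda>n. star A (s n))"
  proof (rule UN_cls[OF assms])
    fix s' assume "s' \<in> cls s"
    then have *: "s' \<in> C" "(\<lambda>n. p (s n \<ominus> s' n)) \<longlonglongrightarrow> 0"
      using assms by (auto simp: mem_cls_iff)
    have "cls (\<lambda>n. star A (s n)) = cls (\<lambda>n. star A (s' n))"
      unfolding cls_eq_iff[OF cauchy_star[OF assms] cauchy_star[OF *(1)]]
      by (rule null_star[OF _ _ *(2)]) (use assms * cauchyD in auto)
    then show "cls (\<lambda>n. star A (s' n)) = cls (\<lambda>n. star A (s n))" ..
  qed
  finally show ?thesis .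
qed

text \<open>The definite description has a unique solution because \<open>p\<close> of equivalent
  representatives differs by at most \<open>p\<close> of their difference, which tends to
  zero.\<close>

lemma K_nrm:
  assumes "s \<in> C" shows "(\<lambda>n. p (s n)) \<longlonglongrightarrow> nrm K (cls s)"
proof -
  define l where "l = lim (\<lambda>n. p (s n))"
  have l: "(\<lambda>n. p (s n)) \<longlonglongrightarrow> l" unfolding l_def by (rule cauchy_p_convergent[OF assms])
  have "nrm K (cls s) = (THE r. \<exists>t\<in>cls s. (\<lambda>n. p (t n)) \<longlonglongrightarrow> r)"
    by (simp add: cstar_completion_def Let_def cls_def)
  also have "\<dots> = l"
  proof (rule the_equality)
    show "\<exists>t\<in>cls s. (\<lambda>n. p (t n)) \<longlonglongrightarrow> l" using l self_mem_cls[OF assms] by blast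
    fix r assume "\<exists>t\<in>cls s. (\<lambda>n. p (t n)) \<longlonglongrightarrow> r"
    then obtain t where t: "t \<in> C" "(\<lambda>n. p (s n \<ominus> t n)) \<longlonglongrightarrow> 0" "(\<lambda>n. p (t n)) \<longlonglongrightarrow> r"
      using assms by (auto simp: mem_cls_iff)
    have "(\<lambda>n. p (s n) - p (t n)) \<longlonglongrightarrow> 0"
      by (rule tendsto_0_le[OF t(2), of _ 1])
        (use p_diff_le cauchyD assms t(1) in \<open>auto intro!: always_eventually\<close>)
    then have "(\<lambda>n. p (s n)) \<longlonglongrightarrow> 0 + r"
      using tendsto_add[OF _ t(3)] by fastforce
    then show "r = l" using l LIMSEQ_unique by fastforce
  qed
  finally show ?thesis using l by simp
qed

lemma K_cases:
  assumes "S \<in> carrier K" obtains s where "s \<in> C" "S = cls s"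
  using assms by (auto simp: K_carrier)

lemmas K_simps = K_zero K_one K_add K_mult K_scal K_star cauchy_const cauchy_add cauchy_mult
  cauchy_scal cauchy_star

lemma ring_K: "ring K"
proof (rule ringI)
  show "abelian_group K"
  proof (rule abelian_groupI)
    fix S assume "S \<in> carrier K"
    then obtain s where s: "s \<in> C" "S = cls s" by (rule K_cases)
    have "cls (\<lambda>n. scal A (-1) (s n)) \<oplus>\<^bsub>K\<^esub> S = \<zero>\<^bsub>K\<^esub>"
      unfolding s(2) K_add[OF cauchy_scal[OF s(1)] s(1)] K_zero
      using cauchyD[OF s(1)] by (simp add: scal_uminus_one l_neg)
    then show "\<exists>T\<in>carrier K. T \<oplus>\<^bsub>K\<^esub> S = \<zero>\<^bsub>K\<^esub>"
      using cauchy_scal[OF s(1)] by (auto simp: K_carrier)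
  qed (auto elim!: K_cases simp: K_simps K_carrier cauchyD a_ac intro!: imageI)
  show "Group.monoid K"
    by (rule monoidI) (auto elim!: K_cases simp: K_simps K_carrier cauchyD m_assoc intro!: imageI)
qed (auto elim!: K_cases simp: K_simps K_carrier cauchyD l_distr r_distr)

lemma star_alg_K: "star_alg K"
proof -
  interpret K: ring K by (rule ring_K)
  show ?thesis
    by unfold_locales
      (auto elim!: K_cases simp: K_simps K_carrier cauchyD scal_add add_scal scal_scal scal_mult_left
        scal_mult_right star_add star_mult star_scal intro!: imageI)
qed

lemma cauchy_minus: "\<lbrakk>s \<in> C; t \<in> C\<rbrakk> \<Longrightarrow> (\<lambda>n. s n \<ominus> t n) \<in> C"
  using cauchy_add[OF _ cauchy_scal, of s t "-1"] by (simp add: cauchyD scal_uminus_one a_minus_def)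

lemma K_minus:
  assumes "s \<in> C" "t \<in> C" shows "cls s \<ominus>\<^bsub>K\<^esub> cls t = cls (\<lambda>n. s n \<ominus> t n)"
proof -
  interpret K: star_alg K by (rule star_alg_K)
  have "\<ominus>\<^bsub>K\<^esub> cls t = scal K (-1) (cls t)"
    using assms by (simp add: K.scal_uminus_one K_carrier)
  then have "cls s \<ominus>\<^bsub>K\<^esub> cls t = cls (\<lambda>n. s n \<oplus> scal A (-1) (t n))"
    using assms by (simp only: a_minus_def K_scal K_add cauchy_scal)
  then show ?thesis
    using cauchyD[OF assms(2)] by (simp add: a_minus_def scal_uminus_one)
qed

lemma nrm_K_eqI: "\<lbrakk>s \<in> C; (\<lambda>n. p (s n)) \<longlonglongrightarrow> r\<rbrakk> \<Longrightarrow> nrm K (cls s) = r"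
  using K_nrm LIMSEQ_unique by blast

lemma star_seminorm_K: "star_seminorm K (nrm K)"
proof -
  interpret K: star_alg K by (rule star_alg_K)
  have "cstar_seminorm K (nrm K)"
    unfolding cstar_seminorm_def
  proof (intro conjI ballI allI)
    fix S assume "S \<in> carrier K"
    then obtain s where s: "s \<in> C" "S = cls s" by (rule K_cases)
    note lim = K_nrm[OF s(1)]
    show "0 \<le> nrm K S"
      unfolding s(2) by (rule LIMSEQ_le_const[OF lim]) (auto simp: cauchyD[OF s(1)])
    show "nrm K (star K S \<otimes>\<^bsub>K\<^esub> S) = (nrm K S)\<^sup>2"
      using tendsto_power[OF lim, of 2] s
      by (simp add: K_simps) (intro nrm_K_eqI, simp_all add: K_simps p_star_mult cauchyD)
    fix c show "nrm K (scal K c S) = cmod c * nrm K S"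
      using tendsto_mult_left[OF lim, of "cmod c"] s
      by (simp add: K_simps) (intro nrm_K_eqI, simp_all add: K_simps p_scal cauchyD)
  next
    fix S T assume "S \<in> carrier K" "T \<in> carrier K"
    then obtain s t where st: "s \<in> C" "S = cls s" "t \<in> C" "T = cls t" by (metis K_cases)
    note cd = cauchyD[OF st(1)] cauchyD[OF st(3)]
    show "nrm K (S \<oplus>\<^bsub>K\<^esub> T) \<le> nrm K S + nrm K T"
      unfolding st(2,4) K_add[OF st(1,3)]
      by (rule LIMSEQ_le[OF K_nrm[OF cauchy_add[OF st(1,3)]] tendsto_add[OF K_nrm[OF st(1)] K_nrm[OF st(3)]]])
        (use p_add cd in auto)
    show "nrm K (S \<otimes>\<^bsub>K\<^esub> T) \<le> nrm K S * nrm K T"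
      unfolding st(2,4) K_mult[OF st(1,3)]
      by (rule LIMSEQ_le[OF K_nrm[OF cauchy_mult[OF st(1,3)]] tendsto_mult[OF K_nrm[OF st(1)] K_nrm[OF st(3)]]])
        (use p_mult cd in auto)
  qed
  then show ?thesis by unfold_locales
qed

lemma completion_map_eq: "completion_map A Q x = cls (\<lambda>n. x)"
  by (simp add: completion_map_def cls_def)

lemma completion_map_hom: "completion_map A Q \<in> star_hom A K"
  by (rule star_homI) (auto simp: completion_map_eq K_simps K_carrier)

lemma nrm_completion_map [simp]: "x \<in> carrier A \<Longrightarrow> nrm K (completion_map A Q x) = p x"
  unfolding completion_map_eq by (rule nrm_K_eqI) auto

lemma cauchy_converges:
  assumes s: "s \<in> C" shows "(\<lambda>k. nrm K (completion_map A Q (s k) \<ominus>\<^bsub>K\<^esub> cls s)) \<longlonglongrightarrow> 0"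
proof (rule LIMSEQ_I)
  interpret K: star_seminorm K "nrm K" by (rule star_seminorm_K)
  fix e :: real assume e: "e > 0"
  then obtain N where N: "\<And>m n. m \<ge> N \<Longrightarrow> n \<ge> N \<Longrightarrow> p (s m \<ominus> s n) < e / 2"
    using s half_gt_zero[OF e] unfolding cauchy_seqs_def by blast
  show "\<exists>N. \<forall>k\<ge>N. norm (nrm K (completion_map A Q (s k) \<ominus>\<^bsub>K\<^esub> cls s) - 0) < e"
  proof (intro exI allI impI)
    fix k assume k: "k \<ge> N"
    have c: "(\<lambda>n. s k \<ominus> s n) \<in> C" using cauchy_minus[OF cauchy_const s] cauchyD[OF s] by simp
    have eq: "completion_map A Q (s k) \<ominus>\<^bsub>K\<^esub> cls s = cls (\<lambda>n. s k \<ominus> s n)"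
      unfolding completion_map_eq using s cauchyD by (simp add: K_minus)
    have "nrm K (cls (\<lambda>n. s k \<ominus> s n)) \<le> e / 2"
      by (rule LIMSEQ_le_const2[OF K_nrm[OF c]]) (use N k in \<open>auto intro!: exI[of _ N] less_imp_le\<close>)
    moreover have "0 \<le> nrm K (cls (\<lambda>n. s k \<ominus> s n))"
      using c by (intro K.p_nonneg) (simp add: K_carrier)
    ultimately show "norm (nrm K (completion_map A Q (s k) \<ominus>\<^bsub>K\<^esub> cls s) - 0) < e"
      using e unfolding eq by simp
  qed
qed

lemma dense:
  assumes "S \<in> carrier K" "e > 0"
  obtains x where "x \<in> carrier A" "nrm K (completion_map A Q x \<ominus>\<^bsub>K\<^esub> S) < e"
proof -
  interpret K: star_seminorm K "nrm K" by (rule star_seminorm_K)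
  obtain s where s: "s \<in> C" "S = cls s" using assms(1) by (rule K_cases)
  from LIMSEQ_D[OF cauchy_converges[OF s(1)] assms(2)] obtain N where
    "\<And>n. n \<ge> N \<Longrightarrow> \<bar>nrm K (completion_map A Q (s n) \<ominus>\<^bsub>K\<^esub> S)\<bar> < e"
    unfolding s(2)[symmetric] by auto
  from this[of N] show thesis using that[OF cauchyD[OF s(1), of N]] by simp
qed

text \<open>Completeness by approximation: each member \<open>S k\<close> of a Cauchy sequence of
  classes is replaced by some \<open>x k\<close> in \<open>A\<close> at distance below
  \<open>1 / Suc k\<close>. Then \<open>x\<close> is itself a Cauchy sequence in \<open>A\<close>,
  and its class is the limit.\<close>

lemma cstar_completion: "cstar K"
proof -
  interpret K: star_seminorm K "nrm K" by (rule star_seminorm_K)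
  note \<iota> = star_homD(1)[OF completion_map_hom]
  show ?thesis
  proof unfold_locales
    fix S assume "S \<in> carrier K" "nrm K S = 0"
    then obtain s where s: "s \<in> C" "S = cls s" "nrm K (cls s) = 0" by (metis K_cases)
    then have "cls s = cls (\<lambda>n. \<zero>)"
      using K_nrm[OF s(1)] by (subst cls_eq_iff) (auto simp: a_minus_def cauchyD)
    then show "S = \<zero>\<^bsub>K\<^esub>" using s by (simp add: K_zero)
  next
    fix S assume S: "S \<in> cauchy_seqs K (nrm K)"
    have Sc: "S k \<in> carrier K" for k using K.cauchyD[OF S] .
    have "\<exists>x. x \<in> carrier A \<and> nrm K (completion_map A Q x \<ominus>\<^bsub>K\<^esub> S k) < 1 / Suc k" for k
      using dense[OF Sc, of "1 / Suc k" k] by (metis divide_pos_pos of_nat_0_less_iff zero_less_Suc zero_less_one)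
    then obtain x where x: "\<And>k. x k \<in> carrier A"
      and close: "\<And>k. nrm K (completion_map A Q (x k) \<ominus>\<^bsub>K\<^esub> S k) < 1 / Suc k"
      by metis
    have lim1: "(\<lambda>k. nrm K (completion_map A Q (x k) \<ominus>\<^bsub>K\<^esub> S k)) \<longlonglongrightarrow> 0"
      by (rule tendsto_sandwich[OF _ _ tendsto_const LIMSEQ_Suc[OF lim_1_over_n]])
        (use x Sc \<iota> less_imp_le[OF close] in \<open>auto intro!: always_eventually\<close>)
    have proj: "filterlim fst sequentially (sequentially \<times>\<^sub>F sequentially)"
      "filterlim snd sequentially (sequentially \<times>\<^sub>F sequentially)"
      by (simp_all add: filterlim_def filtermap_fst_prod_filter filtermap_snd_prod_filter)
    have fst: "((\<lambda>i. nrm K (completion_map A Q (x (fst i)) \<ominus>\<^bsub>K\<^esub> S (fst i))) \<longlongrightarrow> 0)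
        (sequentially \<times>\<^sub>F sequentially)"
      by (rule filterlim_compose[OF lim1 proj(1)])
    have snd: "((\<lambda>i. nrm K (S (snd i) \<ominus>\<^bsub>K\<^esub> completion_map A Q (x (snd i)))) \<longlongrightarrow> 0)
        (sequentially \<times>\<^sub>F sequentially)"
      using filterlim_compose[OF lim1 proj(2)] x Sc \<iota> by (simp add: K.p_minus_commute)
    have mid: "((\<lambda>i. nrm K (S (fst i) \<ominus>\<^bsub>K\<^esub> S (snd i))) \<longlongrightarrow> 0) (sequentially \<times>\<^sub>F sequentially)"
      using S K.cauchy_iff by blast
    have "((\<lambda>i. nrm K (completion_map A Q (x (fst i)) \<ominus>\<^bsub>K\<^esub> completion_map A Q (x (snd i)))) \<longlongrightarrow> 0)
        (sequentially \<times>\<^sub>F sequentially)"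
      by (rule K.null_trans[OF _ _ _ fst K.null_trans[OF _ _ _ mid snd]]) (use x Sc \<iota> in auto)
    moreover have "nrm K (completion_map A Q a \<ominus>\<^bsub>K\<^esub> completion_map A Q b) = p (a \<ominus> b)"
      if "a \<in> carrier A" "b \<in> carrier A" for a b
      using that star_hom_minus[OF star_alg_axioms star_alg_K completion_map_hom that, symmetric] by simp
    ultimately have xC: "x \<in> C" using x by (simp add: cauchy_iff)
    have "(\<lambda>k. nrm K (S k \<ominus>\<^bsub>K\<^esub> cls x)) \<longlonglongrightarrow> 0"
      by (rule K.null_trans[OF _ _ _ _ cauchy_converges[OF xC]])
        (use x Sc \<iota> xC lim1 in \<open>auto simp: K_carrier K.p_minus_commute\<close>)
    then show "\<exists>T\<in>carrier K. (\<lambda>k. nrm K (S k \<ominus>\<^bsub>K\<^esub> T)) \<longlonglongrightarrow> 0"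
      using xC by (auto simp: K_carrier)
  qed
qed

end

lemma (in cstar) eq_if_nrm_minus_eq_zero:
  "\<lbrakk>nrm A (x \<ominus> y) = 0; x \<in> carrier A; y \<in> carrier A\<rbrakk> \<Longrightarrow> x = y"
  using nrm_eq_zero[of "x \<ominus> y"] minus_eq_zero_iff by simp

section \<open>Extension and uniqueness of maps out of a completion\<close>

context seminorm_family
begin

text \<open>Extension by continuity: a class goes to the limit in \<open>B\<close> of the images of
  a representative. The bound by \<open>p\<close> makes these images a Cauchy sequence, makes the
  limit independent of the representative, and becomes contractivity in the limit.\<close>

lemma completion_extend:
  assumes B: "cstar B" and \<phi>: "\<phi> \<in> star_hom A B"
    and le: "\<And>x. x \<in> carrier A \<Longrightarrow> nrm B (\<phi> x) \<le> p x"
  obtains \<Phi> where "\<Phi> \<in> cstar_hom K B" "\<And>x. x \<in> carrier A \<Longrightarrow> \<Phi> (completion_map A Q x) = \<phi> x"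
proof -
  interpret B: cstar B by fact
  note \<phi>c = star_homD(1)[OF \<phi>]
  have \<phi>_minus: "nrm B (\<phi> x \<ominus>\<^bsub>B\<^esub> \<phi> y) \<le> p (x \<ominus> y)" if "x \<in> carrier A" "y \<in> carrier A" for x y
    using le[of "x \<ominus> y"] that star_hom_minus[OF star_alg_axioms B.star_alg_axioms \<phi> that] by simp
  define L where "L s y \<longleftrightarrow> y \<in> carrier B \<and> (\<lambda>n. nrm B (\<phi> (s n) \<ominus>\<^bsub>B\<^esub> y)) \<longlonglongrightarrow> 0" for s y
  have L_ex: "\<exists>y. L s y" if s: "s \<in> C" for s
  proof -
    have "((\<lambda>i. nrm B (\<phi> (s (fst i)) \<ominus>\<^bsub>B\<^esub> \<phi> (s (snd i)))) \<longlongrightarrow> 0) (sequentially \<times>\<^sub>F sequentially)"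
      by (rule tendsto_0_le[where K = 1])
        (use s \<phi>_minus \<phi>c cauchyD[OF s] in \<open>auto simp: cauchy_iff intro!: always_eventually\<close>)
    then have "(\<lambda>n. \<phi> (s n)) \<in> cauchy_seqs B (nrm B)"
      using \<phi>c cauchyD[OF s] by (simp add: B.cauchy_iff)
    then show ?thesis using B.complete by (auto simp: L_def)
  qed
  have L_unique: "y = z" if "s \<in> C" "t \<in> C" "cls s = cls t" "L s y" "L t z" for s t y z
  proof -
    note cd = cauchyD[OF that(1)] cauchyD[OF that(2)]
    have yz: "y \<in> carrier B" "z \<in> carrier B" using that by (auto simp: L_def)
    have 1: "(\<lambda>n. nrm B (y \<ominus>\<^bsub>B\<^esub> \<phi> (s n))) \<longlonglongrightarrow> 0"
      using that(4) cd \<phi>c yz B.null_commute[of "\<lambda>n. y" "\<lambda>n. \<phi> (s n)" sequentially]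
      by (simp add: L_def)
    have 2: "(\<lambda>n. nrm B (\<phi> (s n) \<ominus>\<^bsub>B\<^esub> \<phi> (t n))) \<longlonglongrightarrow> 0"
      by (rule tendsto_0_le[where K = 1])
        (use that \<phi>_minus \<phi>c cd in \<open>auto simp: cls_eq_iff intro!: always_eventually\<close>)
    have 3: "(\<lambda>n. nrm B (\<phi> (t n) \<ominus>\<^bsub>B\<^esub> z)) \<longlonglongrightarrow> 0" using that(5) by (simp add: L_def)
    have "(\<lambda>n::nat. nrm B (y \<ominus>\<^bsub>B\<^esub> z)) \<longlonglongrightarrow> 0"
      by (rule B.null_trans[OF _ _ _ 1 B.null_trans[OF _ _ _ 2 3]]) (use yz cd \<phi>c in auto)
    then have "nrm B (y \<ominus>\<^bsub>B\<^esub> z) = 0" by (simp add: LIMSEQ_const_iff)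
    then show ?thesis using yz by (rule B.eq_if_nrm_minus_eq_zero)
  qed
  \<comment> \<open>The choice runs over limits of all representatives of \<open>S\<close>;
    \<open>L_unique\<close> identifies them, so nothing depends on which one is taken.\<close>
  define \<Phi> where "\<Phi> S = (SOME y. \<exists>s\<in>C. S = cls s \<and> L s y)" for S
  have \<Phi>_eqI: "\<Phi> (cls s) = y" if "s \<in> C" "L s y" for s y
  proof -
    have "\<exists>t\<in>C. cls s = cls t \<and> L t (\<Phi> (cls s))"
      unfolding \<Phi>_def by (rule someI[of "\<lambda>y. \<exists>t\<in>C. cls s = cls t \<and> L t y"]) (use that in blast)
    then show ?thesis using L_unique that by metis
  qed
  have \<Phi>L: "L s (\<Phi> (cls s))" if "s \<in> C" for s
    using L_ex[OF that] \<Phi>_eqI[OF that] by metis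
  note LD = \<Phi>L[unfolded L_def, THEN conjunct1] \<Phi>L[unfolded L_def, THEN conjunct2]
  have hom: "\<Phi> \<in> star_hom K B"
  proof (rule star_homI)
    fix S assume "S \<in> carrier K"
    then obtain s where s: "s \<in> C" "S = cls s" by (rule K_cases)
    note cd = cauchyD[OF s(1)]
    show "\<Phi> S \<in> carrier B" using s LD by simp
    fix c show "\<Phi> (scal K c S) = scal B c (\<Phi> S)"
      unfolding s(2) K_scal[OF s(1)]
    proof (rule \<Phi>_eqI[OF cauchy_scal[OF s(1)]])
      show "L (\<lambda>n. scal A c (s n)) (scal B c (\<Phi> (cls s)))"
        unfolding L_def using B.null_scal[OF _ _ LD(2)[OF s(1)], of c] s LD cd \<phi>c
        by (simp add: star_homD[OF \<phi>])
    qed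
    show "\<Phi> (star K S) = star B (\<Phi> S)"
      unfolding s(2) K_star[OF s(1)]
    proof (rule \<Phi>_eqI[OF cauchy_star[OF s(1)]])
      show "L (\<lambda>n. star A (s n)) (star B (\<Phi> (cls s)))"
        unfolding L_def using B.null_star[OF _ _ LD(2)[OF s(1)]] s LD cd \<phi>c
        by (simp add: star_homD[OF \<phi>])
    qed
  next
    fix S T assume "S \<in> carrier K" "T \<in> carrier K"
    then obtain s t where st: "s \<in> C" "S = cls s" "t \<in> C" "T = cls t" by (metis K_cases)
    note cd = cauchyD[OF st(1)] cauchyD[OF st(3)]
    show "\<Phi> (S \<oplus>\<^bsub>K\<^esub> T) = \<Phi> S \<oplus>\<^bsub>B\<^esub> \<Phi> T"
      unfolding st(2,4) K_add[OF st(1,3)]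
    proof (rule \<Phi>_eqI[OF cauchy_add[OF st(1,3)]])
      show "L (\<lambda>n. s n \<oplus> t n) (\<Phi> (cls s) \<oplus>\<^bsub>B\<^esub> \<Phi> (cls t))"
        unfolding L_def using B.null_add[OF _ _ _ _ LD(2)[OF st(1)] LD(2)[OF st(3)]] st LD cd \<phi>c
        by (simp add: star_homD[OF \<phi>])
    qed
    obtain M where M: "\<And>n. p (s n) \<le> M" using cauchy_bounded[OF st(1)] by blast
    have M': "nrm B (\<phi> (s n)) \<le> M" for n using M le cd order_trans by blast
    show "\<Phi> (S \<otimes>\<^bsub>K\<^esub> T) = \<Phi> S \<otimes>\<^bsub>B\<^esub> \<Phi> T"
      unfolding st(2,4) K_mult[OF st(1,3)]
    proof (rule \<Phi>_eqI[OF cauchy_mult[OF st(1,3)]])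
      show "L (\<lambda>n. s n \<otimes> t n) (\<Phi> (cls s) \<otimes>\<^bsub>B\<^esub> \<Phi> (cls t))"
        unfolding L_def
        using B.null_mult[OF _ _ _ _ LD(2)[OF st(1)] LD(2)[OF st(3)] M' order_refl] st LD cd \<phi>c
        by (simp add: star_homD[OF \<phi>])
    qed
  next
    show "\<Phi> \<one>\<^bsub>K\<^esub> = \<one>\<^bsub>B\<^esub>"
      unfolding K_one
      by (rule \<Phi>_eqI) (auto simp: L_def star_homD[OF \<phi>] a_minus_def B.r_neg)
  qed
  have "nrm B (\<Phi> S) \<le> nrm K S" if Sc: "S \<in> carrier K" for S
  proof -
    obtain s where s: "s \<in> C" "S = cls s" by (rule K_cases[OF Sc])
    note cd = cauchyD[OF s(1)]
    have "(\<lambda>n. nrm B (\<phi> (s n)) - nrm B (\<Phi> S)) \<longlonglongrightarrow> 0"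
      by (rule tendsto_0_le[OF LD(2)[OF s(1)], where K = 1])
        (use B.p_diff_le LD s cd \<phi>c in \<open>auto intro!: always_eventually\<close>)
    then have "(\<lambda>n. nrm B (\<phi> (s n))) \<longlonglongrightarrow> nrm B (\<Phi> S)"
      by (simp add: LIM_zero_iff)
    then show ?thesis
      unfolding s(2) by (rule LIMSEQ_le[OF _ K_nrm[OF s(1)]]) (use le cd in auto)
  qed
  moreover have "\<Phi> (completion_map A Q x) = \<phi> x" if "x \<in> carrier A" for x
    unfolding completion_map_eq
    by (rule \<Phi>_eqI) (use that \<phi>c in \<open>auto simp: L_def a_minus_def B.r_neg\<close>)
  ultimately show thesis using that hom by (auto simp: cstar_hom_def)
qed

text \<open>The image of \<open>A\<close> is dense and both maps are contractions, so an
  approximation of \<open>S\<close> up to \<open>e / 2\<close> moves each of the two values by at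
  most \<open>e / 2\<close>.\<close>

lemma cstar_hom_eqI:
  assumes B: "cstar B" and h: "h \<in> cstar_hom K B" and k: "k \<in> cstar_hom K B"
    and eq: "\<And>x. x \<in> carrier A \<Longrightarrow> h (completion_map A Q x) = k (completion_map A Q x)"
    and S: "S \<in> carrier K"
  shows "h S = k S"
proof -
  interpret B: cstar B by fact
  interpret K: cstar K by (rule cstar_completion)
  note hc = star_homD(1)[OF cstar_homD(1)[OF h]] and kc = star_homD(1)[OF cstar_homD(1)[OF k]]
  have "nrm B (h S \<ominus>\<^bsub>B\<^esub> k S) \<le> 0 + e" if e: "e > 0" for e
  proof -
    obtain x where x: "x \<in> carrier A" "nrm K (completion_map A Q x \<ominus>\<^bsub>K\<^esub> S) < e / 2"
      using dense[OF S, of "e / 2"] e by auto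
    define y where "y = completion_map A Q x"
    have y: "y \<in> carrier K" using star_homD(1)[OF completion_map_hom x(1)] by (simp add: y_def)
    have contr: "nrm B (g y \<ominus>\<^bsub>B\<^esub> g S) \<le> e / 2" if "g \<in> cstar_hom K B" for g
      using cstar_homD(2)[OF that, of "y \<ominus>\<^bsub>K\<^esub> S"] y S x(2)
        star_hom_minus[OF K.star_alg_axioms B.star_alg_axioms cstar_homD(1)[OF that] y S]
      by (simp add: y_def)
    have "nrm B (h S \<ominus>\<^bsub>B\<^esub> k S) \<le> nrm B (h S \<ominus>\<^bsub>B\<^esub> h y) + nrm B (h y \<ominus>\<^bsub>B\<^esub> k S)"
      using hc kc y S by (intro B.p_triangle) auto
    also have "\<dots> = nrm B (h y \<ominus>\<^bsub>B\<^esub> h S) + nrm B (k y \<ominus>\<^bsub>B\<^esub> k S)"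
      using eq[OF x(1)] hc kc y S by (simp add: y_def B.p_minus_commute)
    finally show ?thesis using contr[OF h] contr[OF k] by simp
  qed
  then have "nrm B (h S \<ominus>\<^bsub>B\<^esub> k S) \<le> 0" by (rule field_le_epsilon)
  then have "nrm B (h S \<ominus>\<^bsub>B\<^esub> k S) = 0"
    using B.p_nonneg[OF B.minus_closed[OF hc[OF S] kc[OF S]]] by linarith
  then show ?thesis using hc[OF S] kc[OF S] by (rule B.eq_if_nrm_minus_eq_zero)
qed

end

subsection \<open>The free *-algebra\<close>

lemma poly_mapping_eq_sum:
  fixes f :: "'a \<Rightarrow>\<^sub>0 'b::comm_monoid_add"
  shows "f = (\<Sum>w\<in>Poly_Mapping.keys f. Poly_Mapping.single w (Poly_Mapping.lookup f w))"
  by (rule poly_mapping_eqI)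
    (simp add: lookup_sum lookup_single when_def in_keys_iff sum.delta')

text \<open>The monomial case may assume that \<open>w\<close> occurs in \<open>f\<close>; this
  keeps an induction inside the polynomials over a given set of generators.\<close>

lemma poly_mapping_sum_induct:
  fixes f :: "'a \<Rightarrow>\<^sub>0 'b::comm_monoid_add"
  assumes "\<And>w c. w \<in> Poly_Mapping.keys f \<Longrightarrow> P (Poly_Mapping.single w c)"
    and "P 0" and "\<And>g h. P g \<Longrightarrow> P h \<Longrightarrow> P (g + h)"
  shows "P f"
proof -
  have "P (\<Sum>w\<in>S. Poly_Mapping.single w (Poly_Mapping.lookup f w))" if "S \<subseteq> Poly_Mapping.keys f" for S
    using finite_subset[OF that finite_keys] that
    by (induction S rule: finite_induct) (auto intro: assms)
  then show ?thesis by (subst poly_mapping_eq_sum) blast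
qed

lemma lookup_free_star: "Poly_Mapping.lookup (free_star f) w = cnj (Poly_Mapping.lookup f (word_star w))"
  by (simp add: free_star.rep_eq)

lemma word_star_add: "word_star (v + w) = word_star w + word_star v"
  by (simp add: word_star_def plus_word_def)

lemma free_star_add: "free_star (f + g) = free_star f + free_star g"
  by (rule poly_mapping_eqI) (simp add: lookup_free_star lookup_add)

lemma free_star_zero [simp]: "free_star 0 = 0"
  by (rule poly_mapping_eqI) (simp add: lookup_free_star)

lemma free_star_free_star [simp]: "free_star (free_star f) = f"
  by (rule poly_mapping_eqI) (simp add: lookup_free_star)

lemma free_star_single: "free_star (Poly_Mapping.single w c) = Poly_Mapping.single (word_star w) (cnj c)"
  by (rule poly_mapping_eqI) (auto simp: lookup_free_star lookup_single when_def)

lemma free_star_mult: "free_star (f * g) = free_star g * free_star f"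
proof (rule poly_mapping_sum_induct[of f])
  fix w c
  show "free_star (Poly_Mapping.single w c * g) = free_star g * free_star (Poly_Mapping.single w c)"
    by (rule poly_mapping_sum_induct[of g])
      (auto simp: mult_single free_star_single word_star_add free_star_add distrib_left distrib_right mult.commute)
qed (auto simp: free_star_add distrib_left distrib_right)

lemma free_star_algebra_simps [simp]:
  "a \<otimes>\<^bsub>free_star_algebra G\<^esub> b = a * b" "\<one>\<^bsub>free_star_algebra G\<^esub> = 1"
  "\<zero>\<^bsub>free_star_algebra G\<^esub> = 0" "a \<oplus>\<^bsub>free_star_algebra G\<^esub> b = a + b"
  "scal (free_star_algebra G) = free_scal" "star (free_star_algebra G) = free_star"
  by (simp_all add: free_star_algebra_def)

lemma free_carrier_iff:
  "f \<in> carrier (free_star_algebra G) \<longleftrightarrow> (\<forall>w \<in> Poly_Mapping.keys f. fst ` set (letters w) \<subseteq> G)"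
  by (simp add: free_star_algebra_def)

lemma free_carrier_intros [simp, intro]:
  assumes "f \<in> carrier (free_star_algebra G)"
  shows "g \<in> carrier (free_star_algebra G) \<Longrightarrow> f + g \<in> carrier (free_star_algebra G)"
    and "g \<in> carrier (free_star_algebra G) \<Longrightarrow> f * g \<in> carrier (free_star_algebra G)"
    and "g \<in> carrier (free_star_algebra G) \<Longrightarrow> f - g \<in> carrier (free_star_algebra G)"
    and "- f \<in> carrier (free_star_algebra G)"
    and "free_star f \<in> carrier (free_star_algebra G)"
    and "free_scal c f \<in> carrier (free_star_algebra G)"
proof -
  have mult: "f * g \<in> carrier (free_star_algebra G)"
    if "f \<in> carrier (free_star_algebra G)" "g \<in> carrier (free_star_algebra G)" for f g
    using that keys_mult[of f g] by (fastforce simp: free_carrier_iff plus_word_def)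
  show "f + g \<in> carrier (free_star_algebra G)" if "g \<in> carrier (free_star_algebra G)"
    using assms that keys_add[of f g] by (auto simp: free_carrier_iff)
  show "f - g \<in> carrier (free_star_algebra G)" if "g \<in> carrier (free_star_algebra G)"
    using assms that keys_diff[of f g] by (auto simp: free_carrier_iff)
  show "- f \<in> carrier (free_star_algebra G)"
    using assms by (auto simp: free_carrier_iff in_keys_iff)
  show "f * g \<in> carrier (free_star_algebra G)" if "g \<in> carrier (free_star_algebra G)"
    using mult assms that .
  have "Poly_Mapping.single 0 c \<in> carrier (free_star_algebra G)" for c
    by (auto simp: free_carrier_iff zero_word_def)
  then show "free_scal c f \<in> carrier (free_star_algebra G)"
    unfolding free_scal_def using mult assms by blast
  show "free_star f \<in> carrier (free_star_algebra G)"
    unfolding free_carrier_iff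
  proof
    fix w assume "w \<in> Poly_Mapping.keys (free_star f)"
    then have "word_star w \<in> Poly_Mapping.keys f" by (simp add: in_keys_iff lookup_free_star)
    then have "fst ` set (letters (word_star w)) \<subseteq> G" using assms by (simp add: free_carrier_iff)
    moreover have "fst ` set (letters (word_star w)) = fst ` set (letters w)"
      by (force simp: word_star_def)
    ultimately show "fst ` set (letters w) \<subseteq> G" by simp
  qed
qed

lemma free_carrier_consts [simp, intro]:
  "0 \<in> carrier (free_star_algebra G)" "1 \<in> carrier (free_star_algebra G)"
  "g \<in> G \<Longrightarrow> free_gen g \<in> carrier (free_star_algebra G)"
  by (auto simp: free_carrier_iff zero_word_def free_gen_def)

lemma free_carrier_sum:
  "(\<And>i. i \<in> I \<Longrightarrow> f i \<in> carrier (free_star_algebra G)) \<Longrightarrow> sum f I \<in> carrier (free_star_algebra G)"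
  by (induction I rule: infinite_finite_induct) auto

lemma free_scal_simps:
  "free_scal c (f + g) = free_scal c f + free_scal c g"
  "free_scal (c + d) f = free_scal c f + free_scal d f"
  "free_scal c (free_scal d f) = free_scal (c * d) f"
  "free_scal 1 f = f"
  "free_scal c f * g = free_scal c (f * g)"
  "f * free_scal c g = free_scal c (f * g)"
  "free_star (free_scal c f) = free_scal (cnj c) (free_star f)"
proof -
  have commute: "f * Poly_Mapping.single 0 c = Poly_Mapping.single 0 c * f" for c and f :: "'a free_poly"
    by (rule poly_mapping_sum_induct[of f]) (auto simp: mult_single distrib_left distrib_right mult.commute)
  have [simp]: "word_star (0 :: 'a word) = 0" by (simp add: word_star_def zero_word_def)
  show "free_scal c (f + g) = free_scal c f + free_scal c g"
    "free_scal (c + d) f = free_scal c f + free_scal d f"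
    "free_scal 1 f = f" "free_scal c f * g = free_scal c (f * g)"
    "free_scal c (free_scal d f) = free_scal (c * d) f"
    by (simp_all add: free_scal_def distrib_left distrib_right single_add mult.assoc
        mult.assoc[symmetric, of "Poly_Mapping.single 0 c" "Poly_Mapping.single 0 d"] mult_single)
  show "f * free_scal c g = free_scal c (f * g)"
    by (simp add: free_scal_def commute mult.assoc[symmetric])
  show "free_star (free_scal c f) = free_scal (cnj c) (free_star f)"
    by (simp add: free_scal_def free_star_mult free_star_single commute)
qed

lemma star_alg_free: "star_alg (free_star_algebra G)"
proof -
  have "ring (free_star_algebra G)"
  proof (rule ringI)
    show "abelian_group (free_star_algebra G)"
    proof (rule abelian_groupI)
      fix f assume "f \<in> carrier (free_star_algebra G)"
      then show "\<exists>g\<in>carrier (free_star_algebra G). g \<oplus>\<^bsub>free_star_algebra G\<^esub> f = \<zero>\<^bsub>free_star_algebra G\<^esub>"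
        by (intro bexI[of _ "- f"]) auto
    qed (auto simp: add_ac)
    show "Group.monoid (free_star_algebra G)"
      by (rule monoidI) (auto simp: mult.assoc)
  qed (auto simp: distrib_left distrib_right)
  then interpret ring "free_star_algebra G" .
  show ?thesis
    by unfold_locales
      (auto simp: free_scal_simps free_star_add free_star_mult)
qed

lemma free_minus [simp]:
  assumes "f \<in> carrier (free_star_algebra G)" "g \<in> carrier (free_star_algebra G)"
  shows "f \<ominus>\<^bsub>free_star_algebra G\<^esub> g = f - g"
proof -
  interpret star_alg "free_star_algebra G" by (rule star_alg_free)
  have "\<ominus>\<^bsub>free_star_algebra G\<^esub> g = - g"
    using assms(2) by (intro minus_equality) auto
  then show ?thesis by (simp add: a_minus_def)
qed

lemma free_finsum [simp]:
  assumes "\<And>i. i \<in> I \<Longrightarrow> f i \<in> carrier (free_star_algebra G)"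
  shows "finsum (free_star_algebra G) f I = sum f I"
proof -
  interpret star_alg "free_star_algebra G" by (rule star_alg_free)
  show ?thesis using assms
    by (induction I rule: infinite_finite_induct) (auto simp: Pi_def)
qed

text \<open>A polynomial is a linear combination of words, and a word is a product of generators and
  their adjoints. Membership in the carrier is proved along with \<open>P\<close>, since the cases
  assume it of their parts.\<close>

lemma free_induct [consumes 1, case_names gen one mult add scal star]:
  fixes f :: "'g free_poly"
  assumes f: "f \<in> carrier (free_star_algebra G)"
    and gen: "\<And>g. g \<in> G \<Longrightarrow> P (free_gen g)" and one: "P 1"
    and mult: "\<And>f g. \<lbrakk>f \<in> carrier (free_star_algebra G); g \<in> carrier (free_star_algebra G); P f; P g\<rbrakk> \<Longrightarrow> P (f * g)"
    and add: "\<And>f g. \<lbrakk>f \<in> carrier (free_star_algebra G); g \<in> carrier (free_star_algebra G); P f; P g\<rbrakk> \<Longrightarrow> P (f + g)"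
    and scal: "\<And>c f. \<lbrakk>f \<in> carrier (free_star_algebra G); P f\<rbrakk> \<Longrightarrow> P (free_scal c f)"
    and star: "\<And>f. \<lbrakk>f \<in> carrier (free_star_algebra G); P f\<rbrakk> \<Longrightarrow> P (free_star f)"
  shows "P f"
proof -
  let ?P = "\<lambda>f. f \<in> carrier (free_star_algebra G) \<and> P f"
  have word: "?P (Poly_Mapping.single (Word l) 1)" if "fst ` set l \<subseteq> G" for l
    using that
  proof (induction l)
    case Nil
    have "Poly_Mapping.single (Word [] :: 'g word) (1::complex) = 1" by (simp add: zero_word_def[symmetric])
    then show ?case using one by simp
  next
    case (Cons a l)
    obtain g b where a: "a = (g, b)" by (cases a)
    have "?P (if b then free_star (free_gen g) else free_gen g)"
      using Cons.prems gen star a by auto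
    moreover have "Poly_Mapping.single (Word (a # l)) (1::complex)
        = (if b then free_star (free_gen g) else free_gen g) * Poly_Mapping.single (Word l) 1"
      using a by (auto simp: free_gen_def free_star_single word_star_def mult_single plus_word_def)
    ultimately show ?case using Cons mult by auto
  qed
  have "?P f"
  proof (rule poly_mapping_sum_induct[of f])
    fix w c assume "w \<in> Poly_Mapping.keys f"
    then have "?P (Poly_Mapping.single w 1)"
      using word[of "letters w"] f by (simp add: free_carrier_iff)
    moreover have "Poly_Mapping.single w c = free_scal c (Poly_Mapping.single w 1)"
      by (simp add: free_scal_def mult_single)
    ultimately show "?P (Poly_Mapping.single w c)" using scal by auto
  next
    have "(free_scal 0 1 :: 'g free_poly) = 0" by (simp add: free_scal_def)
    then show "?P 0" using scal[OF _ one, of 0] by simp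
  qed (use add in auto)
  then show ?thesis ..
qed

section \<open>Evaluation of free polynomials in a *-algebra\<close>

context star_alg
begin

definition word_eval :: "('g \<Rightarrow> 'a) \<Rightarrow> 'g word \<Rightarrow> 'a" where
  "word_eval v w = foldr (\<lambda>(g, b) x. (if b then star A (v g) else v g) \<otimes> x) (letters w) \<one>"

definition free_eval :: "('g \<Rightarrow> 'a) \<Rightarrow> 'g free_poly \<Rightarrow> 'a" where
  "free_eval v f = (\<Oplus>w\<in>Poly_Mapping.keys f. scal A (Poly_Mapping.lookup f w) (word_eval v w))"

context
  fixes v :: "'g \<Rightarrow> 'a"
  assumes v: "\<And>g. v g \<in> carrier A"
begin

lemma word_eval_Nil: "word_eval v (Word []) = \<one>"
  and word_eval_Cons: "word_eval v (Word ((g, b) # l)) =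
    (if b then star A (v g) else v g) \<otimes> word_eval v (Word l)"
  by (simp_all add: word_eval_def)

lemma word_eval_closed [simp]: "word_eval v w \<in> carrier A"
proof (cases w)
  case (Word l)
  have "word_eval v (Word l) \<in> carrier A"
    by (induction l) (auto simp: word_eval_Nil word_eval_Cons v)
  then show ?thesis using Word by simp
qed

lemma word_eval_add: "word_eval v (w + w') = word_eval v w \<otimes> word_eval v w'"
proof (cases w)
  case (Word l)
  have "word_eval v (Word l + w') = word_eval v (Word l) \<otimes> word_eval v w'"
  proof (induction l)
    case Nil
    then show ?case by (simp add: word_eval_Nil plus_word_def)
  next
    case (Cons a l)
    obtain g b where a: "a = (g, b)" by (cases a)
    have "Word (a # l) + w' = Word ((g, b) # letters (Word l + w'))"
      by (simp add: plus_word_def a)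
    then show ?case using Cons v by (simp add: a word_eval_Cons m_assoc)
  qed
  then show ?thesis using Word by simp
qed

lemma word_eval_star: "word_eval v (word_star w) = star A (word_eval v w)"
proof (cases w)
  case (Word l)
  have "word_eval v (word_star (Word l)) = star A (word_eval v (Word l))"
  proof (induction l)
    case Nil
    then show ?case by (simp add: word_star_def word_eval_def)
  next
    case (Cons a l)
    have "word_star (Word (a # l)) = word_star (Word l) + word_star (Word [a])"
      by (simp add: word_star_def plus_word_def)
    moreover have "word_eval v (Word (a # l)) = word_eval v (Word [a]) \<otimes> word_eval v (Word l)"
      by (simp add: word_eval_add[symmetric] plus_word_def)
    moreover have "word_eval v (word_star (Word [a])) = star A (word_eval v (Word [a]))"
      by (cases a) (auto simp: word_eval_def word_star_def v)
    ultimately show ?case using Cons by (simp add: word_eval_add star_mult)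
  qed
  then show ?thesis using Word by simp
qed

text \<open>Coefficients may cancel in a sum, so additivity compares the evaluations over one finite
  set of words that contains the keys of both summands.\<close>

lemma free_eval_superset:
  assumes "finite S" "Poly_Mapping.keys f \<subseteq> S"
  shows "free_eval v f = (\<Oplus>w\<in>S. scal A (Poly_Mapping.lookup f w) (word_eval v w))"
  unfolding free_eval_def using assms
  by (intro add.finprod_mono_neutral_cong_left) (auto simp: in_keys_iff)

lemma free_eval_closed [simp]: "free_eval v f \<in> carrier A"
  unfolding free_eval_def by (intro finsum_closed) auto

lemma free_eval_zero [simp]: "free_eval v 0 = \<zero>"
  by (simp add: free_eval_def)

lemma free_eval_single: "free_eval v (Poly_Mapping.single w c) = scal A c (word_eval v w)"
  by (subst free_eval_superset[of "{w}"]) auto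

lemma free_eval_add: "free_eval v (f + g) = free_eval v f \<oplus> free_eval v g"
proof -
  let ?S = "Poly_Mapping.keys f \<union> Poly_Mapping.keys g"
  have "free_eval v (f + g) = (\<Oplus>w\<in>?S. scal A (Poly_Mapping.lookup (f + g) w) (word_eval v w))"
    using keys_add[of f g] by (intro free_eval_superset) auto
  also have "\<dots> = (\<Oplus>w\<in>?S. scal A (Poly_Mapping.lookup f w) (word_eval v w) \<oplus> scal A (Poly_Mapping.lookup g w) (word_eval v w))"
    by (intro finsum_cong') (auto simp: lookup_add add_scal)
  also have "\<dots> = (\<Oplus>w\<in>?S. scal A (Poly_Mapping.lookup f w) (word_eval v w)) \<oplus> (\<Oplus>w\<in>?S. scal A (Poly_Mapping.lookup g w) (word_eval v w))"
    by (rule finsum_addf) auto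
  also have "\<dots> = free_eval v f \<oplus> free_eval v g"
    by (simp add: free_eval_superset[of ?S])
  finally show ?thesis .
qed

lemma free_eval_mult: "free_eval v (f * g) = free_eval v f \<otimes> free_eval v g"
proof (rule poly_mapping_sum_induct[of f])
  fix w c
  show "free_eval v (Poly_Mapping.single w c * g) = free_eval v (Poly_Mapping.single w c) \<otimes> free_eval v g"
    by (rule poly_mapping_sum_induct[of g])
      (auto simp: mult_single free_eval_single word_eval_add scal_mult_left scal_mult_right scal_scal
        distrib_left free_eval_add r_distr mult.commute)
qed (auto simp: distrib_right free_eval_add l_distr)

lemma free_eval_star: "free_eval v (free_star f) = star A (free_eval v f)"
  by (rule poly_mapping_sum_induct[of f])
    (auto simp: free_star_single free_eval_single word_eval_star star_scal free_star_add free_eval_add star_add)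

lemma free_eval_gen: "free_eval v (free_gen g) = v g"
  by (simp add: free_gen_def free_eval_single word_eval_def v)

lemma free_eval_hom: "free_eval v \<in> star_hom (free_star_algebra G) A"
proof (rule star_homI)
  have one: "word_eval v 0 = \<one>" by (simp add: word_eval_def zero_word_def)
  then show "free_eval v \<one>\<^bsub>free_star_algebra G\<^esub> = \<one>"
    using free_eval_single[of 0 1] by simp
  show "free_eval v (scal (free_star_algebra G) c f) = scal A c (free_eval v f)" for c f
    by (simp add: free_scal_def free_eval_mult free_eval_single one scal_mult_left)
qed (auto simp: free_eval_add free_eval_mult free_eval_star)

end

end

subsection \<open>Universal constructions\<close>

lemma cstar_seminorm_pullback:
  assumes "star_alg A" "cstar_seminorm B q" "\<phi> \<in> star_hom A B"
  shows "cstar_seminorm A (\<lambda>x. q (\<phi> x))"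
proof -
  interpret A: star_alg A by fact
  show ?thesis using assms(2) by (simp add: cstar_seminorm_def star_homD[OF assms(3)])
qed

lemma cstar_seminorm_zero: "cstar_seminorm A (\<lambda>_. 0)"
  by (simp add: cstar_seminorm_def)

text \<open>A bound at the generators that is uniform in \<open>q\<close> propagates through all
  operations: sums, products and multiples of the bounds are again uniform in \<open>q\<close>,
  adjoints keep them, and \<open>q 1 \<le> 1\<close> because \<open>1\<close> is a
  projection.\<close>

lemma seminorm_family_freeI:
  assumes sn: "\<And>q. q \<in> Q \<Longrightarrow> cstar_seminorm (free_star_algebra G) q" and "Q \<noteq> {}"
    and bound: "\<And>g. g \<in> G \<Longrightarrow> \<exists>M. \<forall>q\<in>Q. q (free_gen g) \<le> M"
  shows "seminorm_family (free_star_algebra G) Q"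
proof -
  interpret F: star_alg "free_star_algebra G" by (rule star_alg_free)
  have ss: "star_seminorm (free_star_algebra G) q" if "q \<in> Q" for q
    using sn[OF that] by unfold_locales
  note props = star_seminorm.p_nonneg[OF ss] star_seminorm.p_mult[OF ss, simplified]
    star_seminorm.p_add[OF ss, simplified] star_seminorm.p_scal[OF ss, simplified]
    star_seminorm.p_star[OF ss, simplified]
  have "\<exists>M. \<forall>q\<in>Q. q f \<le> M" if "f \<in> carrier (free_star_algebra G)" for f
    using that
  proof (induction rule: free_induct)
    case one
    have "q 1 \<le> 1" if "q \<in> Q" for q
      using star_seminorm.p_projection_le_one[OF ss[OF that], of 1] F.star_one by simp
    then show ?case by blast
  next
    case (mult f g)
    then obtain M N where MN: "\<And>q. q \<in> Q \<Longrightarrow> q f \<le> M" "\<And>q. q \<in> Q \<Longrightarrow> q g \<le> N" by blast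
    have "q (f * g) \<le> M * N" if q: "q \<in> Q" for q
    proof -
      have "q (f * g) \<le> q f * q g" using props(2)[OF q mult(1,2)] .
      also have "\<dots> \<le> M * N"
        using MN[OF q] props(1)[OF q mult(1)] props(1)[OF q mult(2)] by (intro mult_mono) linarith+
      finally show ?thesis .
    qed
    then show ?case by blast
  next
    case (add f g)
    then obtain M N where "\<And>q. q \<in> Q \<Longrightarrow> q f \<le> M" "\<And>q. q \<in> Q \<Longrightarrow> q g \<le> N" by blast
    then have MN: "q f + q g \<le> M + N" if "q \<in> Q" for q
      using that by (simp add: add_mono)
    have "q (f + g) \<le> M + N" if "q \<in> Q" for q
      using props(3)[OF that add(1,2)] MN[OF that] by linarith
    then show ?case by blast
  next
    case (scal c f)
    then obtain M where M: "\<And>q. q \<in> Q \<Longrightarrow> q f \<le> M" by blast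
    have "q (free_scal c f) \<le> cmod c * M" if "q \<in> Q" for q
      using props(4)[OF that scal(1)] M[OF that] by (simp add: mult_left_mono)
    then show ?case by blast
  next
    case (star f)
    then obtain M where "\<And>q. q \<in> Q \<Longrightarrow> q f \<le> M" by blast
    then have "q (free_star f) \<le> M" if "q \<in> Q" for q
      using props(5)[OF that star(1)] that by simp
    then show ?case by blast
  qed (rule bound)
  then show ?thesis
    using sn \<open>Q \<noteq> {}\<close> by unfold_locales (auto simp: bdd_above_def)
qed

lemma free_universal:
  assumes "star_alg B" "\<And>g. g \<in> G \<Longrightarrow> v g \<in> carrier B"
  obtains \<phi> where "\<phi> \<in> star_hom (free_star_algebra G) B" "\<And>g. g \<in> G \<Longrightarrow> \<phi> (free_gen g) = v g"
proof -
  interpret B: star_alg B by fact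
  \<comment> \<open>Evaluation is set up for total assignments; generators outside \<open>G\<close>
    receive the default zero.\<close>
  let ?v = "\<lambda>g. if g \<in> G then v g else \<zero>\<^bsub>B\<^esub>"
  have v: "\<And>g. ?v g \<in> carrier B" using assms(2) by simp
  show thesis
  proof (rule that[OF B.free_eval_hom[OF v]])
    show "B.free_eval ?v (free_gen g) = v g" if "g \<in> G" for g
      using that by (simp add: B.free_eval_gen[OF v])
  qed
qed

context seminorm_family
begin

lemma completion_map_eq_zeroI:
  assumes "x \<in> carrier A" "\<And>q. q \<in> Q \<Longrightarrow> q x = 0"
  shows "completion_map A Q x = \<zero>\<^bsub>K\<^esub>"
proof -
  interpret K: cstar K by (rule cstar_completion)
  have "p x \<le> 0" by (rule sup_least, rule eq_refl, rule assms(2))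
  then have "nrm K (completion_map A Q x) = 0" using assms(1) p_nonneg[OF assms(1)] by simp
  then show ?thesis using K.nrm_eq_zero star_homD(1)[OF completion_map_hom] assms(1) by blast
qed

lemma completion_map_eqI:
  assumes "x \<in> carrier A" "y \<in> carrier A" "\<And>q. q \<in> Q \<Longrightarrow> q (x \<ominus> y) = 0"
  shows "completion_map A Q x = completion_map A Q y"
proof -
  interpret K: cstar K by (rule cstar_completion)
  have "completion_map A Q x \<ominus>\<^bsub>K\<^esub> completion_map A Q y = \<zero>\<^bsub>K\<^esub>"
    using completion_map_eq_zeroI[of "x \<ominus> y"] assms
      star_hom_minus[OF star_alg_axioms star_alg_K completion_map_hom assms(1,2)] by simp
  then show ?thesis
    using star_homD(1)[OF completion_map_hom] assms by (simp add: K.minus_eq_zero_iff)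
qed

text \<open>The common mechanism of all universal properties below: if the norm pulled back along
  \<open>\<phi>\<close> is itself a member of \<open>Q\<close>, then it lies below the supremum,
  which is the bound that extension by continuity requires.\<close>

lemma extend_if_mem:
  assumes "cstar B" "\<phi> \<in> star_hom A B" "(\<lambda>x. nrm B (\<phi> x)) \<in> Q"
  obtains \<Phi> where "\<Phi> \<in> cstar_hom K B" "\<And>x. x \<in> carrier A \<Longrightarrow> \<Phi> (completion_map A Q x) = \<phi> x"
  using completion_extend[OF assms(1,2)] sup_upper[OF _ assms(3)] by blast

end

lemma free_completion_hom_eqI:
  assumes fam: "seminorm_family (free_star_algebra G) Q" and B: "cstar B"
    and h: "h \<in> cstar_hom (cstar_completion (free_star_algebra G) Q) B"
    and k: "k \<in> cstar_hom (cstar_completion (free_star_algebra G) Q) B"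
    and eq: "\<And>g. g \<in> G \<Longrightarrow> h (completion_map (free_star_algebra G) Q (free_gen g))
        = k (completion_map (free_star_algebra G) Q (free_gen g))"
    and x: "x \<in> carrier (cstar_completion (free_star_algebra G) Q)"
  shows "h x = k x"
proof -
  interpret seminorm_family "free_star_algebra G" Q by fact
  note c = star_homD[OF completion_map_hom, simplified]
  note h' = star_homD[OF cstar_homD(1)[OF h]] and k' = star_homD[OF cstar_homD(1)[OF k]]
  have "h (completion_map (free_star_algebra G) Q f) = k (completion_map (free_star_algebra G) Q f)"
    if "f \<in> carrier (free_star_algebra G)" for f
    using that by (induction rule: free_induct) (simp_all add: eq c h' k')
  then show ?thesis using cstar_hom_eqI[OF B h k _ x] by blast
qed

lemma hom_seminorm_zero:
  assumes "cstar A" shows "hom_seminorm A \<iota> (\<lambda>_. 0)"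
proof -
  interpret cstar A by fact
  show ?thesis by (simp add: hom_seminorm_def)
qed

lemma hom_seminormD:
  assumes "hom_seminorm A \<iota> q"
  shows "\<lbrakk>x \<in> carrier A; y \<in> carrier A\<rbrakk> \<Longrightarrow> q (\<iota> (x \<oplus>\<^bsub>A\<^esub> y) - (\<iota> x + \<iota> y)) = 0"
    and "\<lbrakk>x \<in> carrier A; y \<in> carrier A\<rbrakk> \<Longrightarrow> q (\<iota> (x \<otimes>\<^bsub>A\<^esub> y) - \<iota> x * \<iota> y) = 0"
    and "x \<in> carrier A \<Longrightarrow> q (\<iota> (scal A c x) - free_scal c (\<iota> x)) = 0"
    and "x \<in> carrier A \<Longrightarrow> q (\<iota> (star A x) - free_star (\<iota> x)) = 0"
    and "q (\<iota> \<one>\<^bsub>A\<^esub> - 1) = 0"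
    and "x \<in> carrier A \<Longrightarrow> q (\<iota> x) \<le> nrm A x"
  using assms by (auto simp: hom_seminorm_def)

text \<open>Each defect of \<open>\<iota>\<close> from being a homomorphism has seminorm zero for
  every member of \<open>Q\<close>, hence also for the supremum, and therefore vanishes in the
  completion.\<close>

lemma hom_seminorm_hom:
  assumes fam: "seminorm_family (free_star_algebra G) Q" and A: "star_alg A"
    and G: "\<And>x. x \<in> carrier A \<Longrightarrow> \<iota> x \<in> carrier (free_star_algebra G)"
    and hs: "\<And>q. q \<in> Q \<Longrightarrow> hom_seminorm A \<iota> q"
  shows "(\<lambda>x. completion_map (free_star_algebra G) Q (\<iota> x))
    \<in> cstar_hom A (cstar_completion (free_star_algebra G) Q)"
proof -
  interpret seminorm_family "free_star_algebra G" Q by fact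
  interpret A: star_alg A by fact
  note c = star_homD[OF completion_map_hom, simplified]
  let ?c = "completion_map (free_star_algebra G) Q"
  have eqI: "?c f = ?c g"
    if "f \<in> carrier (free_star_algebra G)" "g \<in> carrier (free_star_algebra G)"
      "\<And>q. hom_seminorm A \<iota> q \<Longrightarrow> q (f - g) = 0" for f g
  proof (rule completion_map_eqI[OF that(1,2)])
    fix q assume "q \<in> Q"
    from that(3)[OF hs[OF this]] show "q (f \<ominus>\<^bsub>free_star_algebra G\<^esub> g) = 0"
      using that(1,2) by simp
  qed
  have "(\<lambda>x. ?c (\<iota> x)) \<in> star_hom A K"
  proof (rule star_homI)
    fix x y assume xy: "x \<in> carrier A" "y \<in> carrier A"
    have "?c (\<iota> (x \<otimes>\<^bsub>A\<^esub> y)) = ?c (\<iota> x * \<iota> y)"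
    proof (rule eqI)
      fix q assume "hom_seminorm A \<iota> q"
      from hom_seminormD(2)[OF this xy] show "q ((\<iota> (x \<otimes>\<^bsub>A\<^esub> y)) - (\<iota> x * \<iota> y)) = 0" .
    qed (use xy G in auto)
    then show "?c (\<iota> (x \<otimes>\<^bsub>A\<^esub> y)) = ?c (\<iota> x) \<otimes>\<^bsub>K\<^esub> ?c (\<iota> y)"
      using xy G c(2) by simp
    have "?c (\<iota> (x \<oplus>\<^bsub>A\<^esub> y)) = ?c (\<iota> x + \<iota> y)"
    proof (rule eqI)
      fix q assume "hom_seminorm A \<iota> q"
      from hom_seminormD(1)[OF this xy] show "q ((\<iota> (x \<oplus>\<^bsub>A\<^esub> y)) - (\<iota> x + \<iota> y)) = 0" .
    qed (use xy G in auto)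
    then show "?c (\<iota> (x \<oplus>\<^bsub>A\<^esub> y)) = ?c (\<iota> x) \<oplus>\<^bsub>K\<^esub> ?c (\<iota> y)"
      using xy G c(3) by simp
  next
    fix x a assume x: "x \<in> carrier A"
    show "?c (\<iota> x) \<in> carrier K" using x G c(1) by simp
    have "?c (\<iota> (star A x)) = ?c (free_star (\<iota> x))"
    proof (rule eqI)
      fix q assume "hom_seminorm A \<iota> q"
      from hom_seminormD(4)[OF this x] show "q ((\<iota> (star A x)) - (free_star (\<iota> x))) = 0" .
    qed (use x G in auto)
    then show "?c (\<iota> (star A x)) = star K (?c (\<iota> x))" using x G c(6) by simp
    have "?c (\<iota> (scal A a x)) = ?c (free_scal a (\<iota> x))"
    proof (rule eqI)
      fix q assume "hom_seminorm A \<iota> q"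
      from hom_seminormD(3)[OF this x] show "q ((\<iota> (scal A a x)) - (free_scal a (\<iota> x))) = 0" .
    qed (use x G in auto)
    then show "?c (\<iota> (scal A a x)) = scal K a (?c (\<iota> x))" using x G c(5) by simp
  next
    have "?c (\<iota> \<one>\<^bsub>A\<^esub>) = ?c 1"
    proof (rule eqI)
      fix q assume "hom_seminorm A \<iota> q"
      from hom_seminormD(5)[OF this] show "q ((\<iota> \<one>\<^bsub>A\<^esub>) - 1) = 0" .
    qed (use G in auto)
    then show "?c (\<iota> \<one>\<^bsub>A\<^esub>) = \<one>\<^bsub>K\<^esub>" using c(4) by simp
  qed
  moreover have "nrm K (?c (\<iota> x)) \<le> nrm A x" if "x \<in> carrier A" for x
  proof -
    have "p (\<iota> x) \<le> nrm A x"
    proof (rule sup_least)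
      fix q assume "q \<in> Q"
      from hom_seminormD(6)[OF hs[OF this] that] show "q (\<iota> x) \<le> nrm A x" .
    qed
    then show ?thesis using that G by simp
  qed
  ultimately show ?thesis by (simp add: cstar_hom_def)
qed

text \<open>The opposite direction: where \<open>\<phi>\<close> agrees with a contractive
  homomorphism \<open>f\<close>, it kills the defects of \<open>\<iota>\<close>, so the pulled-back
  norm qualifies as a seminorm of the defining family.\<close>

lemma hom_seminorm_pullback:
  assumes A: "cstar A" and B: "cstar B" and \<phi>: "\<phi> \<in> star_hom (free_star_algebra G) B"
    and f: "f \<in> cstar_hom A B"
    and eq: "\<And>x. x \<in> carrier A \<Longrightarrow> \<iota> x \<in> carrier (free_star_algebra G) \<and> \<phi> (\<iota> x) = f x"
  shows "hom_seminorm A \<iota> (\<lambda>z. nrm B (\<phi> z))"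
proof -
  interpret A: cstar A by fact
  interpret B: cstar B by fact
  note \<phi>' = star_homD[OF \<phi>, simplified]
    star_hom_minus[OF star_alg_free B.star_alg_axioms \<phi>]
  have \<phi>m: "\<phi> (x - y) = \<phi> x \<ominus>\<^bsub>B\<^esub> \<phi> y"
    if "x \<in> carrier (free_star_algebra G)" "y \<in> carrier (free_star_algebra G)" for x y
    using \<phi>'(7)[OF that] that by simp
  note f' = star_homD[OF cstar_homD(1)[OF f]]
  have [simp]: "nrm B (x \<ominus>\<^bsub>B\<^esub> x) = 0" if "x \<in> carrier B" for x
    using that by (simp add: a_minus_def B.r_neg)
  show ?thesis
    unfolding hom_seminorm_def
    using cstar_homD(2)[OF f] by (simp add: \<phi>m \<phi>'(1-6) eq f')
qed

section \<open>Copowers, coproducts and quotients\<close>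

lemma copower_seminorm_family:
  assumes A: "cstar A"
  shows "seminorm_family (free_star_algebra (J \<times> carrier A)) (copower_seminorms J A)"
proof (rule seminorm_family_freeI)
  have "(\<lambda>_. 0) \<in> copower_seminorms J A"
    using A by (simp add: copower_seminorms_def cstar_seminorm_zero hom_seminorm_zero)
  then show "copower_seminorms J A \<noteq> {}" by blast
next
  fix g assume "g \<in> J \<times> carrier A"
  \<comment> \<open>The last clause of \<open>hom_seminorm\<close> bounds all admissible seminorms
    at a generator simultaneously.\<close>
  then have "\<forall>q\<in>copower_seminorms J A. q (free_gen g) \<le> nrm A (snd g)"
    by (auto simp: copower_seminorms_def hom_seminorm_def)
  then show "\<exists>M. \<forall>q\<in>copower_seminorms J A. q (free_gen g) \<le> M" by blast
qed (simp add: copower_seminorms_def)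

lemma cstar_copower: "cstar A \<Longrightarrow> cstar (cstar_copower J A)"
  unfolding cstar_copower_def by (rule seminorm_family.cstar_completion[OF copower_seminorm_family])

lemma copower_in_hom:
  assumes A: "cstar A" and a: "a \<in> J" shows "copower_in J A a \<in> cstar_hom A (cstar_copower J A)"
proof -
  interpret A: cstar A by fact
  show ?thesis
    unfolding cstar_copower_def copower_in_def
    by (rule hom_seminorm_hom[OF copower_seminorm_family[OF A] A.star_alg_axioms])
      (use a in \<open>auto simp: copower_seminorms_def\<close>)
qed

lemma copower_universal:
  assumes A: "cstar A" and B: "cstar B" and f: "\<And>a. a \<in> J \<Longrightarrow> f a \<in> cstar_hom A B"
  shows "\<exists>\<Phi> \<in> cstar_hom (cstar_copower J A) B. \<forall>a \<in> J. \<forall>x \<in> carrier A. \<Phi> (copower_in J A a x) = f a x"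
proof -
  interpret B: cstar B by fact
  interpret fam: seminorm_family "free_star_algebra (J \<times> carrier A)" "copower_seminorms J A"
    by (rule copower_seminorm_family[OF A])
  obtain \<phi> where \<phi>: "\<phi> \<in> star_hom (free_star_algebra (J \<times> carrier A)) B"
    "\<And>g. g \<in> J \<times> carrier A \<Longrightarrow> \<phi> (free_gen g) = f (fst g) (snd g)"
    by (rule free_universal[OF B.star_alg_axioms, of "J \<times> carrier A" "\<lambda>g. f (fst g) (snd g)"])
      (use star_homD(1)[OF cstar_homD(1)[OF f]] in auto)
  have "hom_seminorm A (\<lambda>x. free_gen (a, x)) (\<lambda>z. nrm B (\<phi> z))" if "a \<in> J" for a
    by (rule hom_seminorm_pullback[OF A B \<phi>(1) f[OF that]]) (use that \<phi>(2) in auto)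
  then have "(\<lambda>z. nrm B (\<phi> z)) \<in> copower_seminorms J A"
    using cstar_seminorm_pullback[OF star_alg_free B.seminorm \<phi>(1)] by (simp add: copower_seminorms_def)
  from fam.extend_if_mem[OF B \<phi>(1) this] obtain \<Phi> where \<Phi>: "\<Phi> \<in> cstar_hom (cstar_copower J A) B"
    "\<And>x. x \<in> carrier (free_star_algebra (J \<times> carrier A)) \<Longrightarrow>
      \<Phi> (completion_map (free_star_algebra (J \<times> carrier A)) (copower_seminorms J A) x) = \<phi> x"
    unfolding cstar_copower_def by blast
  show ?thesis by (rule bexI[OF _ \<Phi>(1)]) (simp add: copower_in_def \<Phi>(2) \<phi>(2))
qed

lemma copower_hom_eqI:
  assumes "cstar A" "cstar B" "h \<in> cstar_hom (cstar_copower J A) B" "k \<in> cstar_hom (cstar_copower J A) B"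
    and "\<And>a x. \<lbrakk>a \<in> J; x \<in> carrier A\<rbrakk> \<Longrightarrow> h (copower_in J A a x) = k (copower_in J A a x)"
    and "x \<in> carrier (cstar_copower J A)"
  shows "h x = k x"
  by (rule free_completion_hom_eqI[OF copower_seminorm_family[OF assms(1)] assms(2)
        assms(3,4)[unfolded cstar_copower_def] _ assms(6)[unfolded cstar_copower_def]])
    (use assms(5) in \<open>auto simp: copower_in_def\<close>)

lemma coprod_seminorm_family:
  assumes "cstar A" "cstar B"
  shows "seminorm_family (free_star_algebra (carrier A <+> carrier B)) (coprod_seminorms A B)"
proof (rule seminorm_family_freeI)
  have "(\<lambda>_. 0) \<in> coprod_seminorms A B"
    using assms by (simp add: coprod_seminorms_def cstar_seminorm_zero hom_seminorm_zero)
  then show "coprod_seminorms A B \<noteq> {}" by blast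
next
  fix g assume "g \<in> carrier A <+> carrier B"
  then have "\<forall>q\<in>coprod_seminorms A B. q (free_gen g) \<le> case_sum (nrm A) (nrm B) g"
    by (auto simp: coprod_seminorms_def hom_seminorm_def)
  then show "\<exists>M. \<forall>q\<in>coprod_seminorms A B. q (free_gen g) \<le> M" by blast
qed (simp add: coprod_seminorms_def)

lemma cstar_coprod: "\<lbrakk>cstar A; cstar B\<rbrakk> \<Longrightarrow> cstar (cstar_coprod A B)"
  unfolding cstar_coprod_def by (rule seminorm_family.cstar_completion[OF coprod_seminorm_family])

lemma coprod_in_hom:
  assumes "cstar A" "cstar B"
  shows "(\<lambda>x. coprod_in A B (Inl x)) \<in> cstar_hom A (cstar_coprod A B)"
    and "(\<lambda>y. coprod_in A B (Inr y)) \<in> cstar_hom B (cstar_coprod A B)"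
proof -
  interpret A: cstar A by fact
  interpret B: cstar B by fact
  show "(\<lambda>x. coprod_in A B (Inl x)) \<in> cstar_hom A (cstar_coprod A B)"
    unfolding cstar_coprod_def coprod_in_def
    by (rule hom_seminorm_hom[OF coprod_seminorm_family[OF assms] A.star_alg_axioms])
      (auto simp: coprod_seminorms_def)
  show "(\<lambda>y. coprod_in A B (Inr y)) \<in> cstar_hom B (cstar_coprod A B)"
    unfolding cstar_coprod_def coprod_in_def
    by (rule hom_seminorm_hom[OF coprod_seminorm_family[OF assms] B.star_alg_axioms])
      (auto simp: coprod_seminorms_def)
qed

lemma coprod_universal:
  assumes A: "cstar A" and B: "cstar B" and D: "cstar D"
    and f: "f \<in> cstar_hom A D" and g: "g \<in> cstar_hom B D"
  shows "\<exists>\<Phi> \<in> cstar_hom (cstar_coprod A B) D.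
    (\<forall>x \<in> carrier A. \<Phi> (coprod_in A B (Inl x)) = f x) \<and>
    (\<forall>y \<in> carrier B. \<Phi> (coprod_in A B (Inr y)) = g y)"
proof -
  interpret D: cstar D by fact
  interpret fam: seminorm_family "free_star_algebra (carrier A <+> carrier B)" "coprod_seminorms A B"
    by (rule coprod_seminorm_family[OF A B])
  obtain \<phi> where \<phi>: "\<phi> \<in> star_hom (free_star_algebra (carrier A <+> carrier B)) D"
    "\<And>z. z \<in> carrier A <+> carrier B \<Longrightarrow> \<phi> (free_gen z) = case_sum f g z"
    by (rule free_universal[OF D.star_alg_axioms, of "carrier A <+> carrier B" "case_sum f g"])
      (use star_homD(1)[OF cstar_homD(1)[OF f]] star_homD(1)[OF cstar_homD(1)[OF g]] in auto)
  have "hom_seminorm A (\<lambda>x. free_gen (Inl x)) (\<lambda>z. nrm D (\<phi> z))"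
    by (rule hom_seminorm_pullback[OF A D \<phi>(1) f]) (simp add: \<phi>(2) InlI)
  moreover have "hom_seminorm B (\<lambda>x. free_gen (Inr x)) (\<lambda>z. nrm D (\<phi> z))"
    by (rule hom_seminorm_pullback[OF B D \<phi>(1) g]) (simp add: \<phi>(2) InrI)
  ultimately have "(\<lambda>z. nrm D (\<phi> z)) \<in> coprod_seminorms A B"
    using cstar_seminorm_pullback[OF star_alg_free D.seminorm \<phi>(1)] by (simp add: coprod_seminorms_def)
  from fam.extend_if_mem[OF D \<phi>(1) this] obtain \<Phi> where \<Phi>: "\<Phi> \<in> cstar_hom (cstar_coprod A B) D"
    "\<And>x. x \<in> carrier (free_star_algebra (carrier A <+> carrier B)) \<Longrightarrow>
      \<Phi> (completion_map (free_star_algebra (carrier A <+> carrier B)) (coprod_seminorms A B) x) = \<phi> x"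
    unfolding cstar_coprod_def by blast
  show ?thesis by (rule bexI[OF _ \<Phi>(1)]) (simp add: coprod_in_def \<Phi>(2) \<phi>(2) InlI InrI)
qed

lemma coprod_hom_eqI:
  assumes "cstar A" "cstar B" "cstar D" "h \<in> cstar_hom (cstar_coprod A B) D" "k \<in> cstar_hom (cstar_coprod A B) D"
    and "\<And>x. x \<in> carrier A \<Longrightarrow> h (coprod_in A B (Inl x)) = k (coprod_in A B (Inl x))"
    and "\<And>y. y \<in> carrier B \<Longrightarrow> h (coprod_in A B (Inr y)) = k (coprod_in A B (Inr y))"
    and "x \<in> carrier (cstar_coprod A B)"
  shows "h x = k x"
  by (rule free_completion_hom_eqI[OF coprod_seminorm_family[OF assms(1,2)] assms(3)
        assms(4,5)[unfolded cstar_coprod_def] _ assms(8)[unfolded cstar_coprod_def]])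
    (use assms(6,7) in \<open>auto simp: coprod_in_def\<close>)

lemma quotient_seminorm_family:
  assumes "cstar A" shows "seminorm_family A (quotient_seminorms A S)"
proof -
  interpret A: cstar A by fact
  have "(\<lambda>_. 0) \<in> quotient_seminorms A S"
    by (simp add: quotient_seminorms_def cstar_seminorm_zero)
  then show ?thesis
    by unfold_locales (auto simp: quotient_seminorms_def bdd_above_def)
qed

lemma cstar_quotient: "cstar A \<Longrightarrow> cstar (cstar_quotient A S)"
  unfolding cstar_quotient_def by (rule seminorm_family.cstar_completion[OF quotient_seminorm_family])

lemma quotient_map_hom:
  assumes A: "cstar A" shows "quotient_map A S \<in> cstar_hom A (cstar_quotient A S)"
proof -
  interpret fam: seminorm_family A "quotient_seminorms A S" by (rule quotient_seminorm_family[OF A])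
  have "fam.p x \<le> nrm A x" if "x \<in> carrier A" for x
    by (rule fam.sup_least) (use that in \<open>simp add: quotient_seminorms_def\<close>)
  then show ?thesis
    unfolding quotient_map_def cstar_quotient_def cstar_hom_def
    using fam.completion_map_hom by simp
qed

lemma quotient_map_eq_zero:
  assumes A: "cstar A" and "s \<in> S" "s \<in> carrier A"
  shows "quotient_map A S s = \<zero>\<^bsub>cstar_quotient A S\<^esub>"
proof -
  interpret fam: seminorm_family A "quotient_seminorms A S" by (rule quotient_seminorm_family[OF A])
  show ?thesis
    unfolding quotient_map_def cstar_quotient_def
    by (rule fam.completion_map_eq_zeroI) (use assms in \<open>auto simp: quotient_seminorms_def\<close>)
qed

text \<open>The norm pulled back along \<open>f\<close> vanishes on \<open>S\<close>, and it is
  bounded by the norm of \<open>A\<close> because \<open>f\<close> is contractive; so it is one of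
  the seminorms that define the quotient.\<close>

lemma quotient_universal:
  assumes A: "cstar A" and B: "cstar B" and f: "f \<in> cstar_hom A B"
    and S: "\<And>s. s \<in> S \<Longrightarrow> f s = \<zero>\<^bsub>B\<^esub>"
  shows "\<exists>\<Phi> \<in> cstar_hom (cstar_quotient A S) B. \<forall>x \<in> carrier A. \<Phi> (quotient_map A S x) = f x"
proof -
  interpret A: cstar A by fact
  interpret B: cstar B by fact
  interpret fam: seminorm_family A "quotient_seminorms A S" by (rule quotient_seminorm_family[OF A])
  have "(\<lambda>x. nrm B (f x)) \<in> quotient_seminorms A S"
    using cstar_seminorm_pullback[OF A.star_alg_axioms B.seminorm cstar_homD(1)[OF f]] cstar_homD(2)[OF f] S
    by (simp add: quotient_seminorms_def)
  from fam.extend_if_mem[OF B cstar_homD(1)[OF f] this] obtain \<Phi> where \<Phi>: "\<Phi> \<in> cstar_hom fam.K B"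
    "\<And>x. x \<in> carrier A \<Longrightarrow> \<Phi> (completion_map A (quotient_seminorms A S) x) = f x"
    by blast
  show ?thesis
    unfolding cstar_quotient_def quotient_map_def by (rule bexI[OF _ \<Phi>(1)]) (simp add: \<Phi>(2))
qed

lemma quotient_hom_eqI:
  assumes A: "cstar A" and "cstar B" "h \<in> cstar_hom (cstar_quotient A S) B" "k \<in> cstar_hom (cstar_quotient A S) B"
    and "\<And>x. x \<in> carrier A \<Longrightarrow> h (quotient_map A S x) = k (quotient_map A S x)"
    and "x \<in> carrier (cstar_quotient A S)"
  shows "h x = k x"
  using seminorm_family.cstar_hom_eqI[OF quotient_seminorm_family[OF A]] assms(2-)
  unfolding cstar_quotient_def quotient_map_def by blast

subsection \<open>Magic unitaries\<close>

definition (in cstar) magic :: "'i set \<Rightarrow> ('i \<Rightarrow> 'i \<Rightarrow> 'a) \<Rightarrow> bool" where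
  "magic I u \<longleftrightarrow> (\<forall>i\<in>I. \<forall>j\<in>I. proj (u i j)) \<and>
     (\<forall>i\<in>I. (\<Oplus>j\<in>I. u i j) = \<one>) \<and> (\<forall>j\<in>I. (\<Oplus>i\<in>I. u i j) = \<one>)"

definition (in cstar) graph_magic :: "'v pair_pre_digraph \<Rightarrow> ('v \<Rightarrow> 'v \<Rightarrow> 'a) \<Rightarrow> bool" where
  "graph_magic X u \<longleftrightarrow> magic (pverts X) u \<and>
     (\<forall>i\<in>pverts X. \<forall>j\<in>pverts X. \<forall>k\<in>pverts X. \<forall>l\<in>pverts X.
        ((i, k) \<in> parcs X \<and> (j, l) \<notin> parcs X \<or> (i, k) \<notin> parcs X \<and> (j, l) \<in> parcs X) \<longrightarrow>
        u i j \<otimes> u k l = \<zero>)"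

lemma (in cstar) graph_magic_cong:
  assumes "\<And>i j. \<lbrakk>i \<in> pverts X; j \<in> pverts X\<rbrakk> \<Longrightarrow> u i j = v i j"
    and "\<And>i j. \<lbrakk>i \<in> pverts X; j \<in> pverts X\<rbrakk> \<Longrightarrow> v i j \<in> carrier A"
  shows "graph_magic X u \<longleftrightarrow> graph_magic X v"
proof -
  have "(\<Oplus>j\<in>pverts X. u i j) = (\<Oplus>j\<in>pverts X. v i j)"
    "(\<Oplus>j\<in>pverts X. u j i) = (\<Oplus>j\<in>pverts X. v j i)" if "i \<in> pverts X" for i
    using assms that by (auto intro!: finsum_cong')
  then show ?thesis
    unfolding graph_magic_def magic_def using assms by (simp cong: ball_cong)
qed

lemma qut_relations_carrier:
  "qut_relations X \<subseteq> carrier (free_star_algebra (pverts X \<times> pverts X))"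
  by (auto simp: qut_relations_def magic_relations_def intro!: free_carrier_sum)

text \<open>A generator is a projection only up to \<open>q\<close>-null differences, but that
  suffices: \<open>q\<close> takes the same value at \<open>star g g\<close>, \<open>g g\<close> and
  \<open>g\<close>, so \<open>q g\<close> equals its own square and is at most 1.\<close>

lemma qut_seminorm_family:
  "seminorm_family (free_star_algebra (pverts X \<times> pverts X))
     (universal_seminorms (pverts X \<times> pverts X) (qut_relations X))"
proof (rule seminorm_family_freeI)
  have "(\<lambda>_. 0) \<in> universal_seminorms (pverts X \<times> pverts X) (qut_relations X)"
    by (simp add: universal_seminorms_def cstar_seminorm_zero)
  then show "universal_seminorms (pverts X \<times> pverts X) (qut_relations X) \<noteq> {}" by blast
next
  let ?G = "pverts X \<times> pverts X"
  fix g assume g: "g \<in> ?G"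
  have "q (free_gen g) \<le> 1" if "q \<in> universal_seminorms ?G (qut_relations X)" for q
  proof -
    have "cstar_seminorm (free_star_algebra ?G) q" using that by (simp add: universal_seminorms_def)
    then interpret star_seminorm "free_star_algebra ?G" q
      by (intro star_seminorm.intro star_alg_free star_seminorm_axioms.intro)
    let ?g = "free_gen g"
    have "?g * ?g - ?g \<in> qut_relations X" "free_star ?g - ?g \<in> qut_relations X"
      using g unfolding qut_relations_def magic_relations_def by blast+
    then have 0: "q (?g * ?g - ?g) = 0" "q (free_star ?g - ?g) = 0"
      using that unfolding universal_seminorms_def by blast+
    have gc: "?g \<in> carrier (free_star_algebra ?G)" using g by simp
    have "q (free_star ?g * ?g - ?g * ?g) \<le> 0"
      using p_mult[OF free_carrier_intros(3)[OF free_carrier_intros(5)[OF gc] gc] gc] 0(2)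
      by (simp add: left_diff_distrib)
    moreover have "\<bar>q (free_star ?g * ?g) - q (?g * ?g)\<bar> \<le> q (free_star ?g * ?g - ?g * ?g)"
      using p_diff_le[of "free_star ?g * ?g" "?g * ?g"] gc by simp
    moreover have "\<bar>q (?g * ?g) - q ?g\<bar> \<le> q (?g * ?g - ?g)"
      using p_diff_le[of "?g * ?g" ?g] gc by simp
    moreover have "q (free_star ?g * ?g) = (q ?g)\<^sup>2"
      using p_star_mult[of ?g] gc by simp
    ultimately have "q ?g * q ?g = q ?g" using 0 unfolding power2_eq_square by linarith
    then show ?thesis by auto
  qed
  then show "\<exists>M. \<forall>q\<in>universal_seminorms ?G (qut_relations X). q (free_gen g) \<le> M" by blast
qed (simp add: universal_seminorms_def)

lemma cstar_Qut: "cstar (cfun (Qut X))"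
  unfolding Qut_def cstar_universal_def
  by (simp add: seminorm_family.cstar_completion[OF qut_seminorm_family])

lemma points_Qut [simp]: "points (Qut X) = pverts X"
  by (simp add: Qut_def)

text \<open>Used in both directions: for the canonical map into the completion it yields
  \<open>graph_magic_Qut\<close>, and for an evaluation at a given magic unitary it shows that the
  pulled-back norm is admissible in \<open>Qut_universal\<close>.\<close>

lemma star_hom_qut_relations:
  assumes B: "cstar B" and \<phi>: "\<phi> \<in> star_hom (free_star_algebra (pverts X \<times> pverts X)) B"
  shows "(\<forall>r\<in>qut_relations X. \<phi> r = \<zero>\<^bsub>B\<^esub>) \<longleftrightarrow> cstar.graph_magic B X (\<lambda>i j. \<phi> (free_gen (i, j)))"
proof -
  interpret B: cstar B by fact
  let ?F = "free_star_algebra (pverts X \<times> pverts X)"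
  have \<phi>m: "\<phi> (x - y) = \<phi> x \<ominus>\<^bsub>B\<^esub> \<phi> y" if "x \<in> carrier ?F" "y \<in> carrier ?F" for x y
    using star_hom_minus[OF star_alg_free B.star_alg_axioms \<phi> that] that by simp
  note \<phi>' = star_homD[OF \<phi>, simplified]
  let ?u = "\<lambda>i j. free_gen (i, j)"
  let ?V = "pverts X"
  have sums: "\<phi> (\<Sum>j\<in>?V. f j) = (\<Oplus>\<^bsub>B\<^esub>j\<in>?V. \<phi> (f j))" if "\<And>j. j \<in> ?V \<Longrightarrow> f j \<in> carrier ?F" for f
    using star_hom_finsum[OF star_alg_free B.star_alg_axioms \<phi>, of f ?V] that by (simp add: Pi_def)
  have sumc: "(\<Sum>j\<in>?V. f j) \<in> carrier ?F" if "\<And>j. j \<in> ?V \<Longrightarrow> f j \<in> carrier ?F" for f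
    using that by (rule free_carrier_sum)
  have uc: "\<And>i j. i \<in> ?V \<Longrightarrow> j \<in> ?V \<Longrightarrow> ?u i j \<in> carrier ?F" by simp
  have iff: "\<phi> x \<ominus>\<^bsub>B\<^esub> \<phi> y = \<zero>\<^bsub>B\<^esub> \<longleftrightarrow> \<phi> x = \<phi> y" if "x \<in> carrier ?F" "y \<in> carrier ?F" for x y
    using that by (intro B.minus_eq_zero_iff \<phi>'(1))
  have "(\<forall>r\<in>magic_relations ?V ?u. \<phi> r = \<zero>\<^bsub>B\<^esub>) \<longleftrightarrow>
      (\<forall>i\<in>?V. \<forall>j\<in>?V. \<phi> (?u i j * ?u i j - ?u i j) = \<zero>\<^bsub>B\<^esub> \<and> \<phi> (free_star (?u i j) - ?u i j) = \<zero>\<^bsub>B\<^esub>) \<and>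
      (\<forall>i\<in>?V. \<phi> ((\<Sum>j\<in>?V. ?u i j) - 1) = \<zero>\<^bsub>B\<^esub>) \<and> (\<forall>j\<in>?V. \<phi> ((\<Sum>i\<in>?V. ?u i j) - 1) = \<zero>\<^bsub>B\<^esub>)"
    unfolding magic_relations_def by blast
  also have "\<dots> \<longleftrightarrow> B.magic ?V (\<lambda>i j. \<phi> (?u i j))"
  proof -
    have "\<phi> (?u i j * ?u i j - ?u i j) = \<zero>\<^bsub>B\<^esub> \<longleftrightarrow> \<phi> (?u i j) \<otimes>\<^bsub>B\<^esub> \<phi> (?u i j) = \<phi> (?u i j)"
      "\<phi> (free_star (?u i j) - ?u i j) = \<zero>\<^bsub>B\<^esub> \<longleftrightarrow> star B (\<phi> (?u i j)) = \<phi> (?u i j)"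
      "\<phi> (?u i j) \<in> carrier B"
      if "i \<in> ?V" "j \<in> ?V" for i j
      using uc[OF that] \<phi>'(1)[OF uc[OF that]]
      by (simp_all add: \<phi>m \<phi>'(2,6) B.minus_eq_zero_iff)
    moreover have "\<phi> ((\<Sum>j\<in>?V. ?u i j) - 1) = \<zero>\<^bsub>B\<^esub> \<longleftrightarrow> (\<Oplus>\<^bsub>B\<^esub>j\<in>?V. \<phi> (?u i j)) = \<one>\<^bsub>B\<^esub>"
      if "i \<in> ?V" for i
    proof -
      have "\<phi> ((\<Sum>j\<in>?V. ?u i j) - 1) = (\<Oplus>\<^bsub>B\<^esub>j\<in>?V. \<phi> (?u i j)) \<ominus>\<^bsub>B\<^esub> \<one>\<^bsub>B\<^esub>"
        using that by (subst \<phi>m) (simp_all add: sumc sums \<phi>'(4))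
      moreover have "(\<Oplus>\<^bsub>B\<^esub>j\<in>?V. \<phi> (?u i j)) \<in> carrier B"
        by (rule B.finsum_closed) (use \<phi>'(1) uc that in auto)
      ultimately show ?thesis by (simp add: B.minus_eq_zero_iff)
    qed
    moreover have "\<phi> ((\<Sum>i\<in>?V. ?u i j) - 1) = \<zero>\<^bsub>B\<^esub> \<longleftrightarrow> (\<Oplus>\<^bsub>B\<^esub>i\<in>?V. \<phi> (?u i j)) = \<one>\<^bsub>B\<^esub>"
      if "j \<in> ?V" for j
    proof -
      have "\<phi> ((\<Sum>i\<in>?V. ?u i j) - 1) = (\<Oplus>\<^bsub>B\<^esub>i\<in>?V. \<phi> (?u i j)) \<ominus>\<^bsub>B\<^esub> \<one>\<^bsub>B\<^esub>"
        using that by (subst \<phi>m) (simp_all add: sumc sums \<phi>'(4))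
      moreover have "(\<Oplus>\<^bsub>B\<^esub>i\<in>?V. \<phi> (?u i j)) \<in> carrier B"
        by (rule B.finsum_closed) (use \<phi>'(1) uc that in auto)
      ultimately show ?thesis by (simp add: B.minus_eq_zero_iff)
    qed
    ultimately show ?thesis unfolding B.magic_def B.proj_def by (simp cong: ball_cong)
  qed
  finally have magic: "(\<forall>r\<in>magic_relations ?V ?u. \<phi> r = \<zero>\<^bsub>B\<^esub>) \<longleftrightarrow> B.magic ?V (\<lambda>i j. \<phi> (?u i j))" .
  show ?thesis
    unfolding qut_relations_def B.graph_magic_def ball_Un magic
    by (rule conj_cong[OF refl]) (fastforce simp: \<phi>'(2) uc)
qed

lemma graph_magic_Qut: "cstar.graph_magic (cfun (Qut X)) X (fund (Qut X))"
proof -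
  let ?F = "free_star_algebra (pverts X \<times> pverts X)"
  let ?Q = "universal_seminorms (pverts X \<times> pverts X) (qut_relations X)"
  interpret fam: seminorm_family ?F ?Q by (rule qut_seminorm_family)
  have "completion_map ?F ?Q r = \<zero>\<^bsub>cstar_completion ?F ?Q\<^esub>" if "r \<in> qut_relations X" for r
    by (rule fam.completion_map_eq_zeroI)
      (use that qut_relations_carrier in \<open>auto simp: universal_seminorms_def\<close>)
  then show ?thesis
    using star_hom_qut_relations[OF fam.cstar_completion fam.completion_map_hom]
    by (simp add: Qut_def cstar_universal_def universal_gen_def)
qed

lemma Qut_universal:
  assumes B: "cstar B" and u: "cstar.graph_magic B X u"
  shows "\<exists>\<Phi> \<in> cstar_hom (cfun (Qut X)) B.
    \<forall>i \<in> pverts X. \<forall>j \<in> pverts X. \<Phi> (fund (Qut X) i j) = u i j"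
proof -
  let ?G = "pverts X \<times> pverts X"
  let ?F = "free_star_algebra ?G"
  let ?Q = "universal_seminorms (pverts X \<times> pverts X) (qut_relations X)"
  interpret B: cstar B by fact
  interpret fam: seminorm_family ?F ?Q by (rule qut_seminorm_family)
  have uc: "u i j \<in> carrier B" if "i \<in> pverts X" "j \<in> pverts X" for i j
    using u that by (simp add: B.graph_magic_def B.magic_def B.proj_def)
  obtain \<phi> where \<phi>: "\<phi> \<in> star_hom ?F B" "\<And>g. g \<in> ?G \<Longrightarrow> \<phi> (free_gen g) = u (fst g) (snd g)"
    by (rule free_universal[OF B.star_alg_axioms, of ?G "\<lambda>g. u (fst g) (snd g)"]) (use uc in auto)
  have "B.graph_magic X (\<lambda>i j. \<phi> (free_gen (i, j)))"
    using u \<phi>(2) by (subst B.graph_magic_cong[of _ _ u]) (use uc in auto)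
  then have "\<phi> r = \<zero>\<^bsub>B\<^esub>" if "r \<in> qut_relations X" for r
    using star_hom_qut_relations[OF B \<phi>(1)] that by blast
  then have "(\<lambda>x. nrm B (\<phi> x)) \<in> ?Q"
    using cstar_seminorm_pullback[OF star_alg_free B.seminorm \<phi>(1)] by (simp add: universal_seminorms_def)
  from fam.extend_if_mem[OF B \<phi>(1) this] obtain \<Phi> where \<Phi>: "\<Phi> \<in> cstar_hom (cfun (Qut X)) B"
    "\<And>x. x \<in> carrier ?F \<Longrightarrow> \<Phi> (completion_map ?F ?Q x) = \<phi> x"
    unfolding Qut_def cstar_universal_def by auto
  show ?thesis by (rule bexI[OF _ \<Phi>(1)]) (simp add: Qut_def universal_gen_def \<Phi>(2) \<phi>(2))
qed

lemma Qut_hom_eqI: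
  assumes "cstar B" "h \<in> cstar_hom (cfun (Qut X)) B" "k \<in> cstar_hom (cfun (Qut X)) B"
    and "\<And>i j. \<lbrakk>i \<in> pverts X; j \<in> pverts X\<rbrakk> \<Longrightarrow> h (fund (Qut X) i j) = k (fund (Qut X) i j)"
    and "x \<in> carrier (cfun (Qut X))"
  shows "h x = k x"
  by (rule free_completion_hom_eqI[OF qut_seminorm_family[of X] assms(1)])
    (use assms(2-) in \<open>auto simp: Qut_def cstar_universal_def universal_gen_def\<close>)

lemma mem_graph_lex [simp]:
  "((a, i), (b, j)) \<in> parcs (graph_lex X Y) \<longleftrightarrow>
     (a, b) \<in> parcs X \<and> i \<in> pverts Y \<and> j \<in> pverts Y \<or> a = b \<and> a \<in> pverts X \<and> (i, j) \<in> parcs Y"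
  by (auto simp: graph_lex_def)

lemma pverts_graph_lex [simp]: "pverts (graph_lex X Y) = pverts X \<times> pverts Y"
  by (simp add: graph_lex_def)

lemma pverts_graph_compl [simp]: "pverts (graph_compl X) = pverts X"
  by (simp add: graph_compl_def)

lemma mem_graph_compl [simp]:
  "(x, y) \<in> parcs (graph_compl X) \<longleftrightarrow> x \<in> pverts X \<and> y \<in> pverts X \<and> x \<noteq> y \<and> (x, y) \<notin> parcs X"
  by (simp add: graph_compl_def)

section \<open>Finite sums and the insertion of a partition of unity\<close>

context star_alg
begin

lemma finsum_cartesian:
  assumes "finite I" "finite J" "\<And>i j. \<lbrakk>i \<in> I; j \<in> J\<rbrakk> \<Longrightarrow> f (i, j) \<in> carrier A"
  shows "(\<Oplus>k\<in>I \<times> J. f k) = (\<Oplus>i\<in>I. \<Oplus>j\<in>J. f (i, j))"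
  using assms(1,3)
proof (induction I rule: finite_induct)
  case (insert i I)
  have "insert i I \<times> J = {i} \<times> J \<union> I \<times> J" by auto
  moreover have "(\<Oplus>k\<in>{i} \<times> J \<union> I \<times> J. f k) = (\<Oplus>k\<in>{i} \<times> J. f k) \<oplus> (\<Oplus>k\<in>I \<times> J. f k)"
    using insert assms(2) by (intro finsum_Un_disjoint) auto
  moreover have "(\<Oplus>k\<in>{i} \<times> J. f k) = (\<Oplus>j\<in>J. f (i, j))"
  proof -
    have "{i} \<times> J = Pair i ` J" by auto
    then show ?thesis using insert by (simp only:) (subst finsum_reindex, auto simp: inj_on_def)
  qed
  moreover have "(\<Oplus>i'\<in>insert i I. \<Oplus>j\<in>J. f (i', j)) = (\<Oplus>j\<in>J. f (i, j)) \<oplus> (\<Oplus>i'\<in>I. \<Oplus>j\<in>J. f (i', j))"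
    using insert by (intro finsum_insert) (auto intro!: finsum_closed)
  ultimately show ?case using insert by simp
qed simp

lemma finsum_swap:
  assumes "finite I" "finite J" "\<And>i j. \<lbrakk>i \<in> I; j \<in> J\<rbrakk> \<Longrightarrow> f i j \<in> carrier A"
  shows "(\<Oplus>i\<in>I. \<Oplus>j\<in>J. f i j) = (\<Oplus>j\<in>J. \<Oplus>i\<in>I. f i j)"
  using assms(1,3)
proof (induction I rule: finite_induct)
  case (insert i I)
  have "(\<Oplus>i'\<in>insert i I. \<Oplus>j\<in>J. f i' j) = (\<Oplus>j\<in>J. f i j) \<oplus> (\<Oplus>i'\<in>I. \<Oplus>j\<in>J. f i' j)"
    using insert by (intro finsum_insert) (auto intro!: finsum_closed)
  also have "\<dots> = (\<Oplus>j\<in>J. f i j) \<oplus> (\<Oplus>j\<in>J. \<Oplus>i'\<in>I. f i' j)"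
    using insert by simp
  also have "\<dots> = (\<Oplus>j\<in>J. f i j \<oplus> (\<Oplus>i'\<in>I. f i' j))"
    using insert by (intro finsum_addf[symmetric]) (auto intro!: finsum_closed)
  also have "\<dots> = (\<Oplus>j\<in>J. \<Oplus>i'\<in>insert i I. f i' j)"
    using insert by (intro finsum_cong') (auto intro!: finsum_closed finsum_insert[symmetric])
  finally show ?case .
qed (simp add: assms)

lemma finsum_mult_finsum:
  assumes "finite I" "finite J" "f \<in> I \<rightarrow> carrier A" "g \<in> J \<rightarrow> carrier A"
  shows "(\<Oplus>i\<in>I. f i) \<otimes> (\<Oplus>j\<in>J. g j) = (\<Oplus>i\<in>I. \<Oplus>j\<in>J. f i \<otimes> g j)"
proof -
  have "(\<Oplus>i\<in>I. f i) \<otimes> (\<Oplus>j\<in>J. g j) = (\<Oplus>i\<in>I. f i \<otimes> (\<Oplus>j\<in>J. g j))"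
    using assms by (intro finsum_ldistr) auto
  also have "\<dots> = (\<Oplus>i\<in>I. \<Oplus>j\<in>J. f i \<otimes> g j)"
    using assms by (intro finsum_cong' finsum_rdistr) (auto intro!: finsum_closed)
  finally show ?thesis .
qed

text \<open>The tool for longer products: a row or column sum of a magic unitary is inserted as
  \<open>\<one>\<close> between \<open>x\<close> and \<open>y\<close>, and \<open>F\<close> collects
  the indices that neither side excludes.\<close>

lemma insert_unity:
  assumes I: "finite I" "F \<subseteq> I" "f \<in> I \<rightarrow> carrier A" "(\<Oplus>i\<in>I. f i) = \<one>"
    and xy: "x \<in> carrier A" "y \<in> carrier A"
    and zero: "\<And>i. i \<in> I - F \<Longrightarrow> x \<otimes> f i \<otimes> y = \<zero>"
  shows "x \<otimes> y = x \<otimes> (\<Oplus>i\<in>F. f i) \<otimes> y"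
proof -
  have fc: "f i \<in> carrier A" if "i \<in> I" for i using I that by auto
  have fin: "finite F" "finite (I - F)" using I finite_subset by auto
  have "I = F \<union> (I - F)" using I by auto
  then have split: "(\<Oplus>i\<in>I. f i) = (\<Oplus>i\<in>F. f i) \<oplus> (\<Oplus>i\<in>I - F. f i)"
    using finsum_Un_disjoint[of F "I - F" f] fin fc I by (auto simp: Pi_def)
  have closed: "(\<Oplus>i\<in>F. f i) \<in> carrier A" "(\<Oplus>i\<in>I - F. f i) \<in> carrier A"
    using fc I by (auto intro!: finsum_closed)
  have "x \<otimes> (\<Oplus>i\<in>I - F. f i) \<otimes> y = (\<Oplus>i\<in>I - F. x \<otimes> f i \<otimes> y)"
    using fin fc xy by (simp add: finsum_rdistr finsum_ldistr Pi_def)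
  also have "\<dots> = \<zero>" using zero by (intro add.finprod_one_eqI) auto
  finally have rest: "x \<otimes> (\<Oplus>i\<in>I - F. f i) \<otimes> y = \<zero>" .
  have "x \<otimes> y = x \<otimes> (\<Oplus>i\<in>I. f i) \<otimes> y" using I xy by simp
  also have "\<dots> = x \<otimes> (\<Oplus>i\<in>F. f i) \<otimes> y \<oplus> x \<otimes> (\<Oplus>i\<in>I - F. f i) \<otimes> y"
    unfolding split using closed xy by (simp add: l_distr r_distr)
  finally show ?thesis using rest closed xy by simp
qed

end

lemma graph_magic_hom:
  assumes A: "cstar A" and B: "cstar B" and h: "h \<in> cstar_hom A B" and u: "cstar.graph_magic A X u"
  shows "cstar.graph_magic B X (\<lambda>i j. h (u i j))"
proof -
  interpret A: cstar A by fact
  interpret B: cstar B by fact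
  note h' = cstar_homD(1)[OF h]
  note hs = star_homD[OF h']
  have uc: "u i j \<in> carrier A" if "i \<in> pverts X" "j \<in> pverts X" for i j
    using u that by (simp add: A.graph_magic_def A.magic_def A.proj_def)
  have sum: "(\<Oplus>\<^bsub>B\<^esub>j\<in>pverts X. h (f j)) = h (\<Oplus>\<^bsub>A\<^esub>j\<in>pverts X. f j)"
    if "\<And>j. j \<in> pverts X \<Longrightarrow> f j \<in> carrier A" for f
    using star_hom_finsum[OF A.star_alg_axioms B.star_alg_axioms h', of f "pverts X"] that
    by (simp add: Pi_def)
  have mult: "h (u i j) \<otimes>\<^bsub>B\<^esub> h (u k l) = h (u i j \<otimes>\<^bsub>A\<^esub> u k l)"
    if "i \<in> pverts X" "j \<in> pverts X" "k \<in> pverts X" "l \<in> pverts X" for i j k l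
    using that uc hs(2) by simp
  have pr: "B.proj (h (u i j))" if "i \<in> pverts X" "j \<in> pverts X" for i j
  proof -
    have "A.proj (u i j)" using u that by (simp add: A.graph_magic_def A.magic_def)
    then show ?thesis unfolding A.proj_def B.proj_def
      using hs(1)[of "u i j"] hs(2)[of "u i j" "u i j"] hs(6)[of "u i j"] by simp
  qed
  show ?thesis
    unfolding B.graph_magic_def B.magic_def
  proof (intro conjI ballI impI)
    fix i assume i: "i \<in> pverts X"
    have "(\<Oplus>\<^bsub>A\<^esub>j\<in>pverts X. u i j) = \<one>\<^bsub>A\<^esub>" "(\<Oplus>\<^bsub>A\<^esub>j\<in>pverts X. u j i) = \<one>\<^bsub>A\<^esub>"
      using u i by (simp_all add: A.graph_magic_def A.magic_def)
    then show "(\<Oplus>\<^bsub>B\<^esub>j\<in>pverts X. h (u i j)) = \<one>\<^bsub>B\<^esub>" "(\<Oplus>\<^bsub>B\<^esub>j\<in>pverts X. h (u j i)) = \<one>\<^bsub>B\<^esub>"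
      using sum[of "u i"] sum[of "\<lambda>j. u j i"] uc i hs(4) by simp_all
  next
    fix i j k l assume V: "i \<in> pverts X" "j \<in> pverts X" "k \<in> pverts X" "l \<in> pverts X"
      and "(i, k) \<in> parcs X \<and> (j, l) \<notin> parcs X \<or> (i, k) \<notin> parcs X \<and> (j, l) \<in> parcs X"
    then have "u i j \<otimes>\<^bsub>A\<^esub> u k l = \<zero>\<^bsub>A\<^esub>" using u unfolding A.graph_magic_def by blast
    then show "h (u i j) \<otimes>\<^bsub>B\<^esub> h (u k l) = \<zero>\<^bsub>B\<^esub>"
      using mult[OF V] star_hom_zero[OF A.star_alg_axioms B.star_alg_axioms h'] by simp
  qed (rule pr)
qed

section \<open>Relations between the entries of a magic unitary\<close>

context cstar
begin

lemma magic_closed: "\<lbrakk>magic I u; i \<in> I; j \<in> I\<rbrakk> \<Longrightarrow> u i j \<in> carrier A"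
  by (simp add: magic_def proj_def)

lemma magic_proj: "\<lbrakk>magic I u; i \<in> I; j \<in> I\<rbrakk> \<Longrightarrow> proj (u i j)"
  by (simp add: magic_def)

lemma magic_transpose: "magic I u \<Longrightarrow> magic I (\<lambda>i j. u j i)"
  by (auto simp: magic_def)

lemma magic_row_orth:
  "\<lbrakk>magic I u; finite I; i \<in> I; j \<in> I; l \<in> I; j \<noteq> l\<rbrakk> \<Longrightarrow> u i j \<otimes> u i l = \<zero>"
  by (rule proj_orthogonal[of I "u i"]) (auto simp: magic_def)

lemma magic_col_orth:
  "\<lbrakk>magic I u; finite I; i \<in> I; j \<in> I; k \<in> I; i \<noteq> k\<rbrakk> \<Longrightarrow> u i j \<otimes> u k j = \<zero>"
  using magic_row_orth[OF magic_transpose] .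

lemma graph_magic_transpose: "graph_magic X u \<Longrightarrow> graph_magic X (\<lambda>i j. u j i)"
  unfolding graph_magic_def by (auto intro: magic_transpose)

lemma graph_magicD:
  assumes "graph_magic X u" "pair_graph X"
  shows "magic (pverts X) u" "finite (pverts X)"
  using assms by (auto simp: graph_magic_def pair_graph_def pair_digraph_def pair_fin_digraph_def
      pair_fin_digraph_axioms_def)

text \<open>Orthogonality within rows and columns adds equality to adjacency among the relations
  that \<open>u\<close> preserves: being equal, adjacent, or distinct and nonadjacent.\<close>

lemma graph_magic_mult_eq_zero:
  assumes "graph_magic X u" "pair_graph X"
    and "i \<in> pverts X" "j \<in> pverts X" "k \<in> pverts X" "l \<in> pverts X"
    and "\<not> (((i, k) \<in> parcs X \<longleftrightarrow> (j, l) \<in> parcs X) \<and> (i = k \<longleftrightarrow> j = l))"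
  shows "u i j \<otimes> u k l = \<zero>"
  using assms magic_row_orth[OF graph_magicD[OF assms(1,2)]] magic_col_orth[OF graph_magicD[OF assms(1,2)]]
  unfolding graph_magic_def by metis

text \<open>A mismatch of adjacency in the complement is a mismatch of adjacency or of equality in
  \<open>X\<close>. This is what makes every argument available for complements.\<close>

lemma graph_magic_graph_compl:
  assumes "graph_magic X u" "pair_graph X" shows "graph_magic (graph_compl X) u"
  unfolding graph_magic_def
  using assms graph_magic_mult_eq_zero[OF assms] by (auto simp: graph_magic_def)

lemma proj_finsum:
  assumes "finite I" "\<And>i. i \<in> I \<Longrightarrow> proj (f i)"
    and orth: "\<And>i k. \<lbrakk>i \<in> I; k \<in> I; i \<noteq> k\<rbrakk> \<Longrightarrow> f i \<otimes> f k = \<zero>"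
  shows "proj (\<Oplus>i\<in>I. f i)" "\<And>i. i \<in> I \<Longrightarrow> f i \<otimes> (\<Oplus>k\<in>I. f k) = f i"
proof -
  have fc: "f \<in> I \<rightarrow> carrier A" using assms projD by auto
  show absorb: "f i \<otimes> (\<Oplus>k\<in>I. f k) = f i" if i: "i \<in> I" for i
  proof -
    have "f i \<otimes> (\<Oplus>k\<in>I. f k) = (\<Oplus>k\<in>I. f i \<otimes> f k)"
      using assms(1) fc i by (intro finsum_rdistr) auto
    also have "\<dots> = (\<Oplus>k\<in>I. if i = k then f i else \<zero>)"
      using orth assms(2) fc i by (intro finsum_cong') (auto simp: projD)
    also have "\<dots> = f i" using assms(1) fc i by (intro add.finprod_singleton) auto
    finally show ?thesis .
  qed
  have "(\<Oplus>i\<in>I. f i) \<otimes> (\<Oplus>k\<in>I. f k) = (\<Oplus>i\<in>I. f i \<otimes> (\<Oplus>k\<in>I. f k))"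
    using assms(1) fc by (intro finsum_ldistr) auto
  also have "\<dots> = (\<Oplus>i\<in>I. f i)" using absorb fc by (intro finsum_cong') auto
  finally show "proj (\<Oplus>i\<in>I. f i)"
    unfolding proj_def using fc assms(2) by (auto simp: star_finsum projD intro!: finsum_cong')
qed

text \<open>For \<open>x = P \<otimes> W\<close> and \<open>y = R \<otimes> W\<close>, the
  hypotheses reduce both \<open>star x x\<close> and \<open>star x y\<close> to \<open>W x\<close>,
  and both \<open>star y y\<close> and \<open>star y x\<close> to \<open>W y\<close>. Hence
  everything cancels in the square of \<open>x \<ominus> y\<close>.\<close>

lemma proj_mult_eq_if_absorb:
  assumes "proj P" "proj R" "proj W"
    and PR: "P \<otimes> W = P \<otimes> R \<otimes> W" and RP: "R \<otimes> W = R \<otimes> P \<otimes> W"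
  shows "P \<otimes> W = R \<otimes> W"
proof -
  note cl = projD(1)[OF assms(1)] projD(1)[OF assms(2)] projD(1)[OF assms(3)]
  note idem = projD(2)[OF assms(1)] projD(2)[OF assms(2)]
  define x y where "x = P \<otimes> W" and "y = R \<otimes> W"
  have xy: "x \<in> carrier A" "y \<in> carrier A" using cl by (simp_all add: x_def y_def)
  have star: "star A x = W \<otimes> P" "star A y = W \<otimes> R"
    unfolding x_def y_def using assms(1-3) by (simp_all add: star_mult projD)
  have "star A x \<otimes> x = W \<otimes> ((P \<otimes> P) \<otimes> W)" "star A y \<otimes> y = W \<otimes> ((R \<otimes> R) \<otimes> W)"
    "star A x \<otimes> y = W \<otimes> (P \<otimes> R \<otimes> W)" "star A y \<otimes> x = W \<otimes> (R \<otimes> P \<otimes> W)"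
    unfolding star unfolding x_def y_def using cl by (simp_all add: m_assoc)
  then have prods: "star A x \<otimes> x = W \<otimes> x" "star A y \<otimes> y = W \<otimes> y"
    "star A x \<otimes> y = W \<otimes> x" "star A y \<otimes> x = W \<otimes> y"
    unfolding idem PR[symmetric] RP[symmetric] x_def[symmetric] y_def[symmetric] by auto
  have "star A (x \<ominus> y) \<otimes> (x \<ominus> y) = W \<otimes> x \<ominus> W \<otimes> y \<ominus> (W \<otimes> x \<ominus> W \<otimes> y)"
    using xy by (simp add: star_minus r_distr_minus l_distr_minus prods)
  also have "\<dots> = \<zero>" using xy cl by (subst minus_eq_zero_iff) auto
  finally have "x \<ominus> y = \<zero>" by (rule star_mult_eq_zero[rotated]) (use xy in simp)
  then show ?thesis using xy by (simp add: minus_eq_zero_iff x_def y_def)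
qed

end

subsection \<open>Connectedness and complements\<close>

lemma pair_graphD:
  assumes "pair_graph X"
  shows "(x, y) \<in> parcs X \<Longrightarrow> (y, x) \<in> parcs X" "(x, x) \<notin> parcs X"
    "(x, y) \<in> parcs X \<Longrightarrow> x \<in> pverts X" "(x, y) \<in> parcs X \<Longrightarrow> y \<in> pverts X" "finite (pverts X)"
proof -
  interpret pair_graph X by fact
  show "(x, y) \<in> parcs X \<Longrightarrow> (y, x) \<in> parcs X"
    using pair_sym_arcs by (auto simp: symmetric_def dest: symD)
  show "(x, x) \<notin> parcs X" using pair_no_loops by fastforce
  show "(x, y) \<in> parcs X \<Longrightarrow> x \<in> pverts X" "(x, y) \<in> parcs X \<Longrightarrow> y \<in> pverts X"
    using arc_fst_in_verts arc_snd_in_verts by fastforce+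
  show "finite (pverts X)" by (rule pair_finite_verts)
qed

lemma pair_graphI:
  assumes "\<And>x y. (x, y) \<in> parcs X \<Longrightarrow> (y, x) \<in> parcs X \<and> x \<noteq> y \<and> x \<in> pverts X"
    and "finite (pverts X)"
  shows "pair_graph X"
proof -
  have "parcs X \<subseteq> pverts X \<times> pverts X" using assms(1) by auto
  then have "finite (parcs X)" using assms(2) finite_subset by blast
  then show ?thesis
    using assms by unfold_locales (auto simp: symmetric_def intro!: symI, blast)
qed

lemma pair_graph_compl:
  assumes "pair_graph X" shows "pair_graph (graph_compl X)"
proof (rule pair_graphI)
  fix x y assume "(x, y) \<in> parcs (graph_compl X)"
  then show "(y, x) \<in> parcs (graph_compl X) \<and> x \<noteq> y \<and> x \<in> pverts (graph_compl X)"
    using pair_graphD(1)[OF assms, of y x] by auto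
qed (simp add: pair_graphD(5)[OF assms])

lemma pair_graph_lex:
  assumes "pair_graph X" "pair_graph Y" shows "pair_graph (graph_lex X Y)"
proof (rule pair_graphI)
  fix s t assume st: "(s, t) \<in> parcs (graph_lex X Y)"
  obtain a i b j where "s = (a, i)" "t = (b, j)" by (cases s, cases t)
  then show "(t, s) \<in> parcs (graph_lex X Y) \<and> s \<noteq> t \<and> s \<in> pverts (graph_lex X Y)"
    using st pair_graphD(1,3)[OF assms(1), of a b] pair_graphD(1,3)[OF assms(2), of i j]
      pair_graphD(2)[OF assms(1), of a] pair_graphD(2)[OF assms(2), of i] by auto
qed (simp add: pair_graphD(5)[OF assms(1)] pair_graphD(5)[OF assms(2)])

lemma graph_compl_graph_compl:
  assumes "pair_graph X" shows "graph_compl (graph_compl X) = X"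
proof -
  have "parcs (graph_compl (graph_compl X)) = parcs X"
    using pair_graphD(2-4)[OF assms] by auto
  then show ?thesis by (cases X) (simp add: graph_compl_def)
qed

lemma graph_compl_lex:
  assumes "pair_graph X" "pair_graph Y"
  shows "graph_compl (graph_lex X Y) = graph_lex (graph_compl X) (graph_compl Y)"
proof -
  have "((a, i), (b, j)) \<in> parcs (graph_compl (graph_lex X Y)) \<longleftrightarrow>
      ((a, i), (b, j)) \<in> parcs (graph_lex (graph_compl X) (graph_compl Y))" for a i b j
    using pair_graphD(2)[OF assms(1), of a] pair_graphD(3,4)[OF assms(2), of i j] by auto
  then have "parcs (graph_compl (graph_lex X Y)) = parcs (graph_lex (graph_compl X) (graph_compl Y))"
    by auto
  then show ?thesis by (simp add: graph_compl_def graph_lex_def)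
qed

text \<open>Connectedness is strong connectedness of the symmetric closure, and the arcs of a
  \<open>pair_graph\<close> are symmetric already.\<close>

lemma connected_iff_rtrancl_on:
  assumes "pair_graph X" "pverts X \<noteq> {}"
  shows "Digraph_Component.connected (with_proj X) \<longleftrightarrow>
    (\<forall>u\<in>pverts X. \<forall>v\<in>pverts X. (u, v) \<in> rtrancl_on (pverts X) (parcs X))"
proof -
  have "parcs (mk_symmetric (with_proj X)) = parcs X"
    by (auto simp: parcs_mk_symmetric intro: pair_graphD(1)[OF assms(1)] bexI[rotated])
  then show ?thesis
    using assms(2) by (simp add: connected_def strongly_connected_def reachable_def)
qed

lemma connected_const:
  assumes "pair_graph X" "pverts X \<noteq> {}" "Digraph_Component.connected (with_proj X)"
    and f: "\<And>i j. (i, j) \<in> parcs X \<Longrightarrow> f i = f j" and "i \<in> pverts X" "j \<in> pverts X"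
  shows "f i = f j"
proof -
  have "(i, j) \<in> rtrancl_on (pverts X) (parcs X)"
    using assms by (simp add: connected_iff_rtrancl_on)
  then show ?thesis by (induction rule: rtrancl_on_induct) (use f in auto)
qed

lemma disconnected_split:
  assumes X: "pair_graph X" "pverts X \<noteq> {}" and "\<not> Digraph_Component.connected (with_proj X)"
  shows "\<exists>C u v. C \<subseteq> pverts X \<and> u \<in> C \<and> v \<in> pverts X - C \<and>
    (\<forall>x y. (x, y) \<in> parcs X \<longrightarrow> (x \<in> C \<longleftrightarrow> y \<in> C))"
proof -
  obtain u v where uv: "u \<in> pverts X" "v \<in> pverts X" "(u, v) \<notin> rtrancl_on (pverts X) (parcs X)"
    using assms by (auto simp: connected_iff_rtrancl_on)
  define C where "C = {x. (u, x) \<in> rtrancl_on (pverts X) (parcs X)}"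
  have step: "y \<in> C" if "x \<in> C" "(x, y) \<in> parcs X" for x y
    using that(1) rtrancl_on_into_rtrancl_on[OF _ that(2) pair_graphD(4)[OF X(1) that(2)]]
    by (simp add: C_def)
  have "C \<subseteq> pverts X" using in_rtrancl_on_in_F by (fastforce simp: C_def)
  moreover have "x \<in> C \<longleftrightarrow> y \<in> C" if "(x, y) \<in> parcs X" for x y
    using step that pair_graphD(1)[OF X(1)] by blast
  moreover have "u \<in> C" "v \<in> pverts X - C" using uv by (auto simp: C_def)
  ultimately show ?thesis by blast
qed

text \<open>In the complement every vertex of a union \<open>C\<close> of components is adjacent to
  every vertex outside \<open>C\<close>, and two vertices on the same side are joined through one on
  the other side.\<close>

lemma connected_compl_if_disconnected:
  assumes X: "pair_graph X" "pverts X \<noteq> {}" and "\<not> Digraph_Component.connected (with_proj X)"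
  shows "Digraph_Component.connected (with_proj (graph_compl X))"
proof -
  obtain C u v where C: "C \<subseteq> pverts X" "u \<in> C" "v \<in> pverts X - C"
    "\<And>x y. (x, y) \<in> parcs X \<Longrightarrow> x \<in> C \<longleftrightarrow> y \<in> C"
    using disconnected_split[OF assms] by metis
  let ?R = "rtrancl_on (pverts X) (parcs (graph_compl X))"
  have edge: "(x, y) \<in> ?R" if "x \<in> pverts X" "y \<in> pverts X" "(x \<in> C) \<noteq> (y \<in> C)" for x y
  proof (rule rtrancl_on_into_rtrancl_on[of x x])
    have "(x, y) \<notin> parcs X" using C(4) that(3) by blast
    then show "(x, y) \<in> parcs (graph_compl X)" using that by auto
  qed (use that in auto)
  have "(x, y) \<in> ?R" if xy: "x \<in> pverts X" "y \<in> pverts X" for x y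
  proof (cases "(x \<in> C) = (y \<in> C)")
    case True
    obtain z where "z \<in> pverts X" "(x \<in> C) \<noteq> (z \<in> C)" using C by blast
    then show ?thesis using True xy by (intro rtrancl_on_trans[OF edge edge]) auto
  qed (use edge xy in blast)
  then show ?thesis
    using connected_iff_rtrancl_on[OF pair_graph_compl[OF X(1)]] X(2) by simp
qed

lemma not_twinsE:
  assumes "pair_graph X" "\<nexists>x y. twins X x y" "b \<in> pverts X" "c \<in> pverts X" "b \<noteq> c"
  obtains d where "d \<in> pverts X" "((b, d) \<in> parcs X) \<noteq> ((c, d) \<in> parcs X)"
proof -
  have "nbrs X b \<noteq> nbrs X c" using assms by (auto simp: twins_def)
  then obtain d where "((b, d) \<in> parcs X) \<noteq> ((c, d) \<in> parcs X)" by (auto simp: nbrs_def)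
  then show thesis using that pair_graphD[OF assms(1)] by metis
qed

subsection \<open>Fibres of a lexicographic product\<close>

context cstar
begin

context
  fixes X :: "'x pair_pre_digraph" and Y :: "'y pair_pre_digraph"
    and w :: "'x \<times> 'y \<Rightarrow> 'x \<times> 'y \<Rightarrow> 'a"
  assumes X: "pair_graph X" and Y: "pair_graph Y" "pverts Y \<noteq> {}"
    and w: "graph_magic (graph_lex X Y) w"
begin

lemma lex_magic: "magic (pverts X \<times> pverts Y) w"
  using graph_magicD(1)[OF w pair_graph_lex[OF X Y(1)]] by simp

lemma lex_finite: "finite (pverts X)" "finite (pverts Y)" "finite (pverts X \<times> pverts Y)"
  using pair_graphD(5)[OF X] pair_graphD(5)[OF Y(1)] by auto

lemma lex_mult_eq_zero:
  assumes "s \<in> pverts X \<times> pverts Y" "t \<in> pverts X \<times> pverts Y"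
    and "s' \<in> pverts X \<times> pverts Y" "t' \<in> pverts X \<times> pverts Y"
    and "\<not> (((s, s') \<in> parcs (graph_lex X Y) \<longleftrightarrow> (t, t') \<in> parcs (graph_lex X Y)) \<and> (s = s' \<longleftrightarrow> t = t'))"
  shows "w s t \<otimes> w s' t' = \<zero>"
  using graph_magic_mult_eq_zero[OF w pair_graph_lex[OF X Y(1)]] assms by simp

lemma fibres_adj:
  assumes conn: "Digraph_Component.connected (with_proj (graph_compl Y))"
    and bc: "(b, c) \<in> parcs X" and a: "a \<in> pverts X"
    and V: "i \<in> pverts Y" "i' \<in> pverts Y" "j \<in> pverts Y" "k \<in> pverts Y"
  shows "w (a, i) (b, j) \<otimes> w (a, i') (c, k) = \<zero>"
proof -
  note XD = pair_graphD[OF X]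
  have bcV: "b \<in> pverts X" "c \<in> pverts X" "b \<noteq> c" using XD(2-4) bc by auto
  define F where "F x = {x} \<times> pverts Y" for x :: 'x
  have F: "F x \<subseteq> pverts X \<times> pverts Y" if "x \<in> pverts X" for x using that by (auto simp: F_def)
  have finF: "finite (F x)" for x using lex_finite by (simp add: F_def)
  define Q where "Q t = (\<Oplus>s\<in>F a. w s t)" for t
  define W where "W = w (a, i') (c, k)"
  note wc = magic_closed[OF lex_magic] and wp = magic_proj[OF lex_magic]
  have Fa: "s \<in> F a \<Longrightarrow> s \<in> pverts X \<times> pverts Y" and Fb: "s \<in> F b \<Longrightarrow> s \<in> pverts X \<times> pverts Y" for s
    using F a bcV by auto
  have s't': "(a, i') \<in> pverts X \<times> pverts Y" "(c, k) \<in> pverts X \<times> pverts Y" using a bcV V by auto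
  have W: "proj W" "W \<in> carrier A" using wp wc s't' by (auto simp: W_def)
  note col = magic_col_orth[OF lex_magic lex_finite(3)] and row = magic_row_orth[OF lex_magic lex_finite(3)]
  have Q: "proj (Q t)" "\<And>s. s \<in> F a \<Longrightarrow> w s t \<otimes> Q t = w s t" if t: "t \<in> pverts X \<times> pverts Y" for t
    using proj_finsum[OF finF, of a "\<lambda>s. w s t"] wp[OF Fa t] col[OF Fa t Fa] by (auto simp: Q_def)
  have absorb: "Q (b, l) \<otimes> W = Q (b, l) \<otimes> Q (b, m) \<otimes> W"
    if lm: "l \<in> pverts Y" "m \<in> pverts Y" "(l, m) \<in> parcs (graph_compl Y)" for l m
  proof -
    have t: "(b, l) \<in> pverts X \<times> pverts Y" "(b, m) \<in> pverts X \<times> pverts Y" using lm bcV by auto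
    have "w s (b, l) \<otimes> W = w s (b, l) \<otimes> (Q (b, m) \<otimes> W)" if s: "s \<in> F a" for s
    proof -
      have "w s (b, l) \<otimes> W = w s (b, l) \<otimes> Q (b, m) \<otimes> W"
        unfolding Q_def
      proof (rule insert_unity[OF lex_finite(3) F[OF a]])
        show "(\<Oplus>r\<in>pverts X \<times> pverts Y. w r (b, m)) = \<one>" using lex_magic t by (simp add: magic_def)
        fix r assume r: "r \<in> pverts X \<times> pverts Y - F a"
        obtain d n where dn: "r = (d, n)" "d \<in> pverts X" "n \<in> pverts Y" "d \<noteq> a"
          using r by (auto simp: F_def)
        obtain i0 where s0: "s = (a, i0)" "i0 \<in> pverts Y" using s by (auto simp: F_def)
        \<comment> \<open>If \<open>d\<close> is adjacent to \<open>a\<close>, then \<open>s\<close>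
          and \<open>r\<close> are adjacent while \<open>(b, l)\<close> and \<open>(b, m)\<close>
          are not. Otherwise \<open>r\<close> and \<open>(a, i')\<close> are nonadjacent, whereas
          \<open>(b, m)\<close> and \<open>(c, k)\<close> are adjacent.\<close>
        show "w s (b, l) \<otimes> w r (b, m) \<otimes> W = \<zero>"
        proof (cases "(a, d) \<in> parcs X")
          case True
          have "w s (b, l) \<otimes> w r (b, m) = \<zero>"
            by (rule lex_mult_eq_zero) (use True lm dn s0 a bcV XD(2) in auto)
          then show ?thesis using W by simp
        next
          case False
          have da: "(d, a) \<notin> parcs X" using False XD(1) by blast
          have "w r (b, m) \<otimes> W = \<zero>"
            unfolding W_def
            by (rule lex_mult_eq_zero) (use da lm dn s0 a bcV V bc in auto)
          moreover have "w s (b, l) \<otimes> w r (b, m) \<otimes> W = w s (b, l) \<otimes> (w r (b, m) \<otimes> W)"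
            using wc[OF Fa[OF s] t(1)] wc[of r "(b, m)"] r t W by (intro m_assoc) auto
          ultimately show ?thesis using wc[OF Fa[OF s] t(1)] by simp
        qed
      qed (use wc[OF Fa[OF s] t(1)] wc[OF _ t(2)] W in auto)
      then show ?thesis
        using wc[OF Fa[OF s] t(1)] projD(1)[OF Q(1)[OF t(2)]] W by (simp add: m_assoc)
    qed
    then have "(\<Oplus>s\<in>F a. w s (b, l) \<otimes> W) = (\<Oplus>s\<in>F a. w s (b, l) \<otimes> (Q (b, m) \<otimes> W))"
      using wc[OF Fa t(1)] projD(1)[OF Q(1)[OF t(2)]] W by (intro finsum_cong') auto
    moreover have "(\<Oplus>s\<in>F a. w s (b, l) \<otimes> y) = Q (b, l) \<otimes> y" if "y \<in> carrier A" for y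
      unfolding Q_def using wc[OF Fa t(1)] finF that by (intro finsum_ldistr[symmetric]) auto
    ultimately show ?thesis
      using W projD(1)[OF Q(1)[OF t(1)]] projD(1)[OF Q(1)[OF t(2)]] by (simp add: m_assoc)
  qed
  define x where "x = Q (b, j) \<otimes> W"
  have xc: "x \<in> carrier A" using W projD(1)[OF Q(1)] bcV V by (simp add: x_def)
  have QW: "Q t \<otimes> W = x" if "t \<in> F b" for t
  proof -
    obtain l where l: "t = (b, l)" "l \<in> pverts Y" using \<open>t \<in> F b\<close> by (auto simp: F_def)
    have "Q (b, m) \<otimes> W = Q (b, n) \<otimes> W" if mn: "(m, n) \<in> parcs (graph_compl Y)" for m n
    proof -
      have mn': "m \<in> pverts Y" "n \<in> pverts Y" "(n, m) \<in> parcs (graph_compl Y)"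
        using mn pair_graphD(1)[OF Y(1)] by auto
      then show ?thesis
        using mn bcV by (intro proj_mult_eq_if_absorb[OF Q(1) Q(1) W(1) absorb absorb]) auto
    qed
    from connected_const[where f = "\<lambda>l. Q (b, l) \<otimes> W" and i = l and j = j,
        OF pair_graph_compl[OF Y(1)] _ conn this] show ?thesis
      using Y(2) V l by (simp add: x_def)
  qed
  \<comment> \<open>Adding up the block of \<open>w\<close> with rows over \<open>a\<close> and
    columns over \<open>b\<close> in the other order replaces the sum of the \<open>Q t\<close> by a
    sum of projections indexed by rows, one of which can be discarded.\<close>
  define R where "R s = (\<Oplus>t\<in>F b. w s t)" for s
  have R: "proj (R s)" if "s \<in> F a" for s
    using proj_finsum(1)[OF finF, of b "w s"] wp[OF Fa[OF that] Fb] row[OF Fa[OF that] Fb Fb]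
    by (auto simp: R_def)
  have Qx: "Q t \<otimes> x = x" if t: "t \<in> F b" for t
  proof -
    have "Q t \<otimes> x = (Q t \<otimes> Q t) \<otimes> W"
      using QW[OF t, symmetric] projD(1)[OF Q(1)[OF Fb[OF t]]] W by (simp add: m_assoc)
    then show ?thesis using projD(2)[OF Q(1)[OF Fb[OF t]]] QW[OF t] by simp
  qed
  have s'F: "(a, i') \<in> F a" using V by (simp add: F_def)
  \<comment> \<open>The discarded row: \<open>w (a, i') t\<close> absorbs \<open>Q t\<close>, and
    what is left is its product with \<open>W\<close>, an entry of the same row in another column
    because \<open>b \<noteq> c\<close>.\<close>
  have "R (a, i') \<otimes> x = (\<Oplus>t\<in>F b. w (a, i') t \<otimes> x)"
    unfolding R_def using wc[OF s't'(1) Fb] xc finF by (intro finsum_ldistr) auto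
  also have "\<dots> = \<zero>"
  proof (rule add.finprod_one_eqI)
    fix t assume t: "t \<in> F b"
    have "w (a, i') t \<otimes> x = w (a, i') t \<otimes> Q t \<otimes> W"
      using QW[OF t, symmetric] projD(1)[OF Q(1)[OF Fb[OF t]]] W wc[OF s't'(1) Fb[OF t]]
      by (simp add: m_assoc)
    also have "\<dots> = w (a, i') t \<otimes> W" using Q(2)[OF Fb[OF t] s'F] by simp
    also have "\<dots> = \<zero>"
      unfolding W_def using t bcV by (intro row[OF s't'(1) Fb[OF t] s't'(2)]) (auto simp: F_def)
    finally show "w (a, i') t \<otimes> x = \<zero>\<^bsub>A\<^esub>" .
  qed
  finally have Rx: "R (a, i') \<otimes> x = \<zero>" .
  have Rc: "R s \<in> carrier A" if "s \<in> F a" for s using projD(1)[OF R[OF that]] .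
  have "scal A (of_nat (card (F b))) x = (\<Oplus>t\<in>F b. x)"
    using finsum_const_scal[OF xc finF] by simp
  also have "\<dots> = (\<Oplus>t\<in>F b. Q t \<otimes> x)"
    using Qx xc by (intro finsum_cong') auto
  also have "\<dots> = (\<Oplus>t\<in>F b. Q t) \<otimes> x"
    using projD(1)[OF Q(1)[OF Fb]] xc finF by (intro finsum_ldistr[symmetric]) auto
  also have "(\<Oplus>t\<in>F b. Q t) = (\<Oplus>s\<in>F a. R s)"
    unfolding Q_def R_def using wc[OF Fa Fb] by (intro finsum_swap finF) auto
  also have "(\<Oplus>s\<in>F a. R s) \<otimes> x = (\<Oplus>s\<in>F a. R s \<otimes> x)"
    using Rc xc finF by (intro finsum_ldistr) auto
  also have "\<dots> = (\<Oplus>s\<in>F a - {(a, i')}. R s \<otimes> x)"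
    using Rc xc finF Rx by (intro add.finprod_mono_neutral_cong_right) auto
  finally have eq: "scal A (of_nat (card (F b))) x = (\<Oplus>s\<in>F a - {(a, i')}. R s \<otimes> x)" .
  have card: "card (F a) = card (F b)" by (simp add: F_def card_cartesian_product)
  \<comment> \<open>Both fibres have \<open>card (F b)\<close> points, so without the row
    \<open>(a, i')\<close> there is one contraction fewer than there are copies of
    \<open>x\<close>.\<close>
  have card_pos: "card (F a - {(a, i')}) + 1 = card (F b)"
    using s'F finF[of a] card by (metis Suc_eq_plus1 card.remove)
  have "real (card (F b)) * nrm A x = nrm A (\<Oplus>s\<in>F a - {(a, i')}. R s \<otimes> x)"
    using p_scal[OF xc, of "of_nat (card (F b))"] eq by simp
  also have "\<dots> \<le> (\<Sum>s\<in>F a - {(a, i')}. nrm A (R s \<otimes> x))"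
    using Rc xc by (intro p_finsum) auto
  also have "\<dots> \<le> (\<Sum>s\<in>F a - {(a, i')}. nrm A x)"
  proof (rule sum_mono)
    fix s assume "s \<in> F a - {(a, i')}"
    then have s: "s \<in> F a" by simp
    have "nrm A (R s) \<le> 1" using p_projection_le_one projD[OF R[OF s]] by blast
    then have "nrm A (R s) * nrm A x \<le> 1 * nrm A x" using xc by (intro mult_right_mono) auto
    then show "nrm A (R s \<otimes> x) \<le> nrm A x" using p_mult[OF Rc[OF s] xc] by linarith
  qed
  also have "\<dots> = real (card (F a - {(a, i')})) * nrm A x" by simp
  finally have "nrm A x \<le> 0" unfolding card_pos[symmetric] by (simp add: algebra_simps)
  then have "nrm A x = 0" using p_nonneg[OF xc] by linarith
  then have x0: "x = \<zero>" using nrm_eq_zero xc by simp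
  have si: "(a, i) \<in> F a" "(b, j) \<in> pverts X \<times> pverts Y" using V bcV by (auto simp: F_def)
  have "w (a, i) (b, j) \<otimes> W = w (a, i) (b, j) \<otimes> Q (b, j) \<otimes> W" using Q(2)[OF si(2,1)] by simp
  also have "\<dots> = w (a, i) (b, j) \<otimes> x"
    unfolding x_def using wc[OF Fa[OF si(1)] si(2)] projD(1)[OF Q(1)[OF si(2)]] W by (simp add: m_assoc)
  also have "\<dots> = \<zero>" using x0 wc[OF Fa[OF si(1)] si(2)] by simp
  finally show ?thesis by (simp add: W_def)
qed

lemma fibres_nonadj:
  assumes conn: "Digraph_Component.connected (with_proj (graph_compl Y))" and tw: "\<nexists>x y. twins X x y"
    and bc: "(b, c) \<notin> parcs X" "b \<noteq> c" "b \<in> pverts X" "c \<in> pverts X" and a: "a \<in> pverts X"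
    and V: "i \<in> pverts Y" "i' \<in> pverts Y" "j \<in> pverts Y" "k \<in> pverts Y"
  shows "w (a, i) (b, j) \<otimes> w (a, i') (c, k) = \<zero>"
proof -
  note XD = pair_graphD[OF X]
  note wc = magic_closed[OF lex_magic]
  obtain d where d: "d \<in> pverts X" "((b, d) \<in> parcs X) \<noteq> ((c, d) \<in> parcs X)"
    by (rule not_twinsE[OF X tw bc(3,4,2)])
  have neq: "d \<noteq> b" "d \<noteq> c" using d(2) bc(1) XD(1,2) by blast+
  have V': "(a, i) \<in> pverts X \<times> pverts Y" "(b, j) \<in> pverts X \<times> pverts Y"
    "(a, i') \<in> pverts X \<times> pverts Y" "(c, k) \<in> pverts X \<times> pverts Y" "(d, j) \<in> pverts X \<times> pverts Y"
    using a bc d V by auto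
  have "w (a, i) (b, j) \<otimes> w (a, i') (c, k)
      = w (a, i) (b, j) \<otimes> (\<Oplus>r\<in>{}. w r (d, j)) \<otimes> w (a, i') (c, k)"
  proof (rule insert_unity[OF lex_finite(3)])
    show "(\<Oplus>r\<in>pverts X \<times> pverts Y. w r (d, j)) = \<one>" using lex_magic V' by (simp add: magic_def)
    fix r assume "r \<in> pverts X \<times> pverts Y - {}"
    then obtain e n where r: "r = (e, n)" "e \<in> pverts X" "n \<in> pverts Y" by auto
    \<comment> \<open>No index survives the insertion. If \<open>r\<close> stays over
      \<open>a\<close>, then \<open>fibres_adj\<close> applies to the adjacent one of the pairs
      \<open>b, d\<close> and \<open>d, c\<close>. If \<open>r\<close> leaves that fibre, the
      adjacency of \<open>e\<close> to \<open>a\<close> can agree with that of \<open>d\<close> to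
      only one of \<open>b\<close> and \<open>c\<close>.\<close>
    have "w (a, i) (b, j) \<otimes> w r (d, j) = \<zero> \<or> w r (d, j) \<otimes> w (a, i') (c, k) = \<zero>"
    proof (cases "e = a")
      case True
      show ?thesis
      proof (cases "(b, d) \<in> parcs X")
        case True
        then show ?thesis using fibres_adj[OF conn True a V(1) r(3) V(3) V(3)] r \<open>e = a\<close> by simp
      next
        case False
        then have "(d, c) \<in> parcs X" using d XD by blast
        then show ?thesis using fibres_adj[OF conn _ a r(3) V(2) V(3) V(4)] r \<open>e = a\<close> by simp
      qed
    next
      case False
      show ?thesis
      proof (cases "(a, e) \<in> parcs X \<longleftrightarrow> (b, d) \<in> parcs X")
        case True
        then have "\<not> ((e, a) \<in> parcs X \<longleftrightarrow> (d, c) \<in> parcs X)" using d XD(1) by blast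
        then have "w r (d, j) \<otimes> w (a, i') (c, k) = \<zero>"
          by (intro lex_mult_eq_zero) (use \<open>e \<noteq> a\<close> V' r neq V in auto)
        then show ?thesis ..
      next
        case False
        then have "w (a, i) (b, j) \<otimes> w r (d, j) = \<zero>"
          by (intro lex_mult_eq_zero) (use \<open>e \<noteq> a\<close> V' r neq V in auto)
        then show ?thesis ..
      qed
    qed
    then show "w (a, i) (b, j) \<otimes> w r (d, j) \<otimes> w (a, i') (c, k) = \<zero>"
      using wc[OF V'(1,2)] wc[OF V'(3,4)] wc[of r "(d, j)"] V' r
      by (elim disjE) (simp, simp add: m_assoc)
  qed (use wc V' in auto)
  then show ?thesis using wc V' by simp
qed

end

end

section \<open>Factorisation of a magic unitary that respects fibres\<close>

context cstar
begin

text \<open>Both preceding lemmas assume that the complement of \<open>Y\<close> is connected. They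
  are applied to \<open>X\<close> and \<open>Y\<close> or to their complements, where edges and
  non-edges of \<open>X\<close> trade places; whichever of \<open>Y\<close> and its complement is
  disconnected, the other one is connected.\<close>

lemma lex_fibres:
  assumes X: "pair_graph X" and Y: "pair_graph Y" "pverts Y \<noteq> {}"
    and w: "graph_magic (graph_lex X Y) w"
    and tw: "\<not> Digraph_Component.connected (with_proj Y) \<Longrightarrow> \<nexists>x y. twins X x y"
    and tw': "\<not> Digraph_Component.connected (with_proj (graph_compl Y)) \<Longrightarrow>
      \<nexists>x y. twins (graph_compl X) x y"
    and V: "a \<in> pverts X" "b \<in> pverts X" "c \<in> pverts X" "b \<noteq> c"
      "i \<in> pverts Y" "i' \<in> pverts Y" "j \<in> pverts Y" "k \<in> pverts Y"
  shows "w (a, i) (b, j) \<otimes> w (a, i') (c, k) = \<zero>"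
proof -
  note X' = pair_graph_compl[OF X] and Y' = pair_graph_compl[OF Y(1)]
  have ne: "pverts (graph_compl Y) \<noteq> {}" using Y(2) by simp
  have w': "graph_magic (graph_lex (graph_compl X) (graph_compl Y)) w"
    using graph_magic_graph_compl[OF w pair_graph_lex[OF X Y(1)]] by (simp add: graph_compl_lex X Y(1))
  note adj = fibres_adj[OF X Y w] and adj' = fibres_adj[OF X' Y' ne w']
    and nonadj = fibres_nonadj[OF X Y w] and nonadj' = fibres_nonadj[OF X' Y' ne w']
  note cc = graph_compl_graph_compl[OF Y(1)]
  show ?thesis
  proof (cases "(b, c) \<in> parcs X")
    case True
    show ?thesis
    proof (cases "Digraph_Component.connected (with_proj (graph_compl Y))")
      case conn: True
      show ?thesis by (rule adj[OF conn True V(1,5-8)])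
    next
      case disc: False
      then have "Digraph_Component.connected (with_proj (graph_compl (graph_compl Y)))"
        using connected_compl_if_disconnected[OF Y' ne] by blast
      from nonadj'[OF this tw'[OF disc]] show ?thesis using True V by simp
    qed
  next
    case False
    then have bc: "(b, c) \<in> parcs (graph_compl X)" using V by simp
    show ?thesis
    proof (cases "Digraph_Component.connected (with_proj Y)")
      case True
      then have "Digraph_Component.connected (with_proj (graph_compl (graph_compl Y)))"
        by (simp add: cc)
      from adj'[OF this bc] show ?thesis using V by simp
    next
      case disc: False
      from nonadj[OF connected_compl_if_disconnected[OF Y disc] tw[OF disc]] show ?thesis
        using False V by simp
    qed
  qed
qed

text \<open>Inserting the row \<open>(a, i')\<close> behind \<open>S i\<close> leaves only its part
  over \<open>b\<close>, so \<open>S i = S i \<otimes> S i'\<close>; taking adjoints and exchanging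
  \<open>i\<close> with \<open>i'\<close> gives equality. Thus it does not depend on the point of
  the fibre whether the fibre of \<open>a\<close> goes to that of \<open>b\<close>.\<close>

lemma fibre_sum_const:
  assumes X: "finite (pverts X)" and Y: "finite (pverts Y)"
    and w: "magic (pverts X \<times> pverts Y) w"
    and fib: "\<And>a b c i i' j k. \<lbrakk>a \<in> pverts X; b \<in> pverts X; c \<in> pverts X; b \<noteq> c; i \<in> pverts Y;
      i' \<in> pverts Y; j \<in> pverts Y; k \<in> pverts Y\<rbrakk> \<Longrightarrow> w (a, i) (b, j) \<otimes> w (a, i') (c, k) = \<zero>"
    and V: "a \<in> pverts X" "b \<in> pverts X" "i \<in> pverts Y" "i' \<in> pverts Y"
  shows "(\<Oplus>j\<in>pverts Y. w (a, i) (b, j)) = (\<Oplus>j\<in>pverts Y. w (a, i') (b, j))"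
proof -
  define S where "S i = (\<Oplus>j\<in>pverts Y. w (a, i) (b, j))" for i
  have wc: "w (a, i) (c, j) \<in> carrier A" if "i \<in> pverts Y" "c \<in> pverts X" "j \<in> pverts Y" for i j c
    using magic_closed[OF w] that V by simp
  have S: "proj (S i)" if "i \<in> pverts Y" for i
    unfolding S_def
  proof (rule proj_finsum(1)[OF Y])
    fix j k assume "j \<in> pverts Y" "k \<in> pverts Y" "j \<noteq> k"
    then show "w (a, i) (b, j) \<otimes> w (a, i) (b, k) = \<zero>"
      using magic_row_orth[OF w finite_cartesian_product[OF X Y]] that V by simp
  qed (use magic_proj[OF w] that V in simp)
  have SS: "S i = S i \<otimes> S i'" if ii: "i \<in> pverts Y" "i' \<in> pverts Y" for i i'
  proof -
    have Sc: "S i \<in> carrier A" using S[OF ii(1)] by (rule projD)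
    have "S i \<otimes> \<one> = S i \<otimes> (\<Oplus>t\<in>{b} \<times> pverts Y. w (a, i') t) \<otimes> \<one>"
    proof (rule insert_unity[of "pverts X \<times> pverts Y"])
      show "(\<Oplus>t\<in>pverts X \<times> pverts Y. w (a, i') t) = \<one>" using w ii V by (simp add: magic_def)
      fix t assume "t \<in> pverts X \<times> pverts Y - {b} \<times> pverts Y"
      then obtain c k where t: "t = (c, k)" "c \<in> pverts X" "k \<in> pverts Y" "b \<noteq> c" by auto
      have "S i \<otimes> w (a, i') t = (\<Oplus>j\<in>pverts Y. w (a, i) (b, j) \<otimes> w (a, i') t)"
        unfolding S_def t using Y wc ii t V by (intro finsum_ldistr) auto
      also have "\<dots> = \<zero>"
        using fib ii t V by (intro add.finprod_one_eqI) auto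
      finally show "S i \<otimes> w (a, i') t \<otimes> \<one> = \<zero>" by simp
    qed (use X Y V wc ii Sc in auto)
    moreover have "(\<Oplus>t\<in>{b} \<times> pverts Y. w (a, i') t) = S i'"
      unfolding S_def using Y wc ii V by (subst finsum_cartesian) auto
    ultimately show ?thesis using Sc projD(1)[OF S[OF ii(2)]] by simp
  qed
  have "S i = star A (S i \<otimes> S i')" using SS[OF V(3,4)] projD(3)[OF S[OF V(3)]] by simp
  also have "\<dots> = S i' \<otimes> S i" using S V projD by (simp add: star_mult)
  also have "\<dots> = S i'" using SS[OF V(4,3)] by simp
  finally show ?thesis by (simp add: S_def)
qed

text \<open>
  The vertices of \<open>X\<close> are permuted by \<open>V\<close>; given that the fibre over \<open>a\<close> is mapped somewhere,
  its points are permuted by \<open>U a\<close>.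
\<close>

lemma lex_factor:
  assumes X: "pair_graph X" and Y: "pair_graph Y" "i0 \<in> pverts Y"
    and w: "graph_magic (graph_lex X Y) w"
    and tw: "\<not> Digraph_Component.connected (with_proj Y) \<Longrightarrow> \<nexists>x y. twins X x y"
    and tw': "\<not> Digraph_Component.connected (with_proj (graph_compl Y)) \<Longrightarrow>
      \<nexists>x y. twins (graph_compl X) x y"
  defines "U \<equiv> \<lambda>a i j. \<Oplus>b\<in>pverts X. w (a, i) (b, j)"
    and "V \<equiv> \<lambda>a b. \<Oplus>j\<in>pverts Y. w (a, i0) (b, j)"
  shows "graph_magic X V" "\<And>a. a \<in> pverts X \<Longrightarrow> graph_magic Y (U a)"
    and "\<And>a b i j. \<lbrakk>a \<in> pverts X; b \<in> pverts X; i \<in> pverts Y; j \<in> pverts Y\<rbrakk> \<Longrightarrow>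
      U a i j \<otimes> V a b = w (a, i) (b, j)"
    and "\<And>a b i j. \<lbrakk>a \<in> pverts X; b \<in> pverts X; i \<in> pverts Y; j \<in> pverts Y\<rbrakk> \<Longrightarrow>
      V a b \<otimes> U a i j = w (a, i) (b, j)"
proof -
  have ne: "pverts Y \<noteq> {}" using Y(2) by blast
  note fin = lex_finite[OF X Y(1) ne w]
  note m = lex_magic[OF X Y(1) ne w]
  \<comment> \<open>The transpose plays the part of the inverse automorphism: it satisfies the same
    relations, and through it preservation of fibres by rows becomes preservation by
    columns.\<close>
  note wT = graph_magic_transpose[OF w]
  note row_fib = lex_fibres[OF X Y(1) ne w tw tw'] and col_fib = lex_fibres[OF X Y(1) ne wT tw tw']
  note zero = lex_mult_eq_zero[OF X Y(1) ne w]
  note row = magic_row_orth[OF m fin(3)] and col = magic_col_orth[OF m fin(3)]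
  have wc: "w (a, i) (b, j) \<in> carrier A" and wp: "proj (w (a, i) (b, j))"
    if "a \<in> pverts X" "b \<in> pverts X" "i \<in> pverts Y" "j \<in> pverts Y" for a b i j
    using magic_closed[OF m] magic_proj[OF m] that by simp_all
  have V_row: "(\<Oplus>j\<in>pverts Y. w (a, i) (b, j)) = V a b"
    if "a \<in> pverts X" "b \<in> pverts X" "i \<in> pverts Y" for a b i
    unfolding V_def using that Y(2) by (intro fibre_sum_const[OF fin(1,2) m] row_fib)
  have sums: "(\<Oplus>t\<in>pverts X \<times> pverts Y. w (a, i) t) = \<one>" "(\<Oplus>t\<in>pverts X \<times> pverts Y. w t (a, i)) = \<one>"
    if "a \<in> pverts X" "i \<in> pverts Y" for a i
    using m that by (simp_all add: magic_def)
  have Vc: "V a b \<in> carrier A" if "a \<in> pverts X" "b \<in> pverts X" for a b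
    unfolding V_def using wc that Y(2) by (intro finsum_closed) auto
  \<comment> \<open>All row sums of a block equal \<open>V a b\<close> and all column sums equal
    \<open>T\<close>; counting the block both ways gives the same multiple of each, which is then
    divided by the number of vertices of \<open>Y\<close>.\<close>
  have V_col: "(\<Oplus>i\<in>pverts Y. w (a, i) (b, j)) = V a b"
    if V: "a \<in> pverts X" "b \<in> pverts X" "j \<in> pverts Y" for a b j
  proof -
    define T where "T = (\<Oplus>i\<in>pverts Y. w (a, i) (b, j))"
    have Tc: "T \<in> carrier A" unfolding T_def using wc V by (intro finsum_closed) auto
    have T: "(\<Oplus>i\<in>pverts Y. w (a, i) (b, l)) = T" if "l \<in> pverts Y" for l
      unfolding T_def
      by (rule fibre_sum_const[OF fin(1,2) magic_transpose[OF m] col_fib]) (use that V in auto)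
    have "scal A (of_nat (card (pverts Y))) (V a b) = (\<Oplus>i\<in>pverts Y. V a b)"
      using finsum_const_scal[OF Vc[OF V(1,2)] fin(2)] by simp
    also have "\<dots> = (\<Oplus>i\<in>pverts Y. \<Oplus>l\<in>pverts Y. w (a, i) (b, l))"
      using V_row[OF V(1,2)] wc V by (intro finsum_cong') (auto intro!: finsum_closed)
    also have "\<dots> = (\<Oplus>l\<in>pverts Y. \<Oplus>i\<in>pverts Y. w (a, i) (b, l))"
      using wc V fin by (intro finsum_swap) auto
    also have "\<dots> = (\<Oplus>l\<in>pverts Y. T)" using T Tc by (intro finsum_cong') auto
    also have "\<dots> = scal A (of_nat (card (pverts Y))) T" using finsum_const_scal[OF Tc fin(2)] .
    finally have eq: "scal A (of_nat (card (pverts Y))) (V a b) = scal A (of_nat (card (pverts Y))) T" .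
    have "card (pverts Y) \<noteq> 0" using fin(2) ne by simp
    then have "scal A (1 / of_nat (card (pverts Y))) (scal A (of_nat (card (pverts Y))) x) = x"
      if "x \<in> carrier A" for x
      using that by (simp add: scal_scal)
    from this[OF Tc] this[OF Vc[OF V(1,2)]] eq show ?thesis by (simp add: T_def)
  qed
  have Uc: "U a i j \<in> carrier A" if "a \<in> pverts X" "i \<in> pverts Y" "j \<in> pverts Y" for a i j
    unfolding U_def using wc that by (intro finsum_closed) auto
  have Up: "proj (U a i j)" if "a \<in> pverts X" "i \<in> pverts Y" "j \<in> pverts Y" for a i j
    unfolding U_def by (rule proj_finsum(1)[OF fin(1)]) (use that wp row in auto)
  have Vp: "proj (V a b)" if "a \<in> pverts X" "b \<in> pverts X" for a b
    unfolding V_def by (rule proj_finsum(1)[OF fin(2)]) (use that Y(2) wp row in auto)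
  have V_sum: "(\<Oplus>b\<in>pverts X. V a b) = \<one>" if "a \<in> pverts X" for a
    unfolding V_def sums(1)[OF that Y(2), symmetric]
    by (rule finsum_cartesian[symmetric]) (use fin wc that Y(2) in auto)
  show "graph_magic X V"
    unfolding graph_magic_def magic_def
  proof (intro conjI ballI impI)
    fix b assume b: "b \<in> pverts X"
    have "(\<Oplus>a\<in>pverts X. V a b) = (\<Oplus>a\<in>pverts X. \<Oplus>i\<in>pverts Y. w (a, i) (b, i0))"
      using V_col b Y(2) wc by (intro finsum_cong') (auto intro!: finsum_closed)
    also have "\<dots> = (\<Oplus>s\<in>pverts X \<times> pverts Y. w s (b, i0))"
      by (rule finsum_cartesian[symmetric]) (use fin wc b Y(2) in auto)
    finally show "(\<Oplus>a\<in>pverts X. V a b) = \<one>" using sums(2)[OF b Y(2)] by simp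
  next
    fix a b c d assume abcd: "a \<in> pverts X" "b \<in> pverts X" "c \<in> pverts X" "d \<in> pverts X"
      and mis: "(a, c) \<in> parcs X \<and> (b, d) \<notin> parcs X \<or> (a, c) \<notin> parcs X \<and> (b, d) \<in> parcs X"
    have "V a b \<otimes> V c d = (\<Oplus>j\<in>pverts Y. \<Oplus>l\<in>pverts Y. w (a, i0) (b, j) \<otimes> w (c, i0) (d, l))"
      unfolding V_def using fin wc abcd Y(2) by (intro finsum_mult_finsum) auto
    also have "\<dots> = \<zero>"
    proof (intro add.finprod_one_eqI)
      fix j l assume jl: "j \<in> pverts Y" "l \<in> pverts Y"
      \<comment> \<open>Without loops, a mismatch excludes \<open>a = c\<close> together with
        \<open>b = d\<close>. The first two cases are preservation of fibres by rows and by columns;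
        the third is a mismatch in the product graph itself.\<close>
      consider "a = c" "b \<noteq> d" | "a \<noteq> c" "b = d" | "a \<noteq> c" "b \<noteq> d"
        using mis pair_graphD(2)[OF X] by metis
      then show "w (a, i0) (b, j) \<otimes> w (c, i0) (d, l) = \<zero>\<^bsub>A\<^esub>"
      proof cases
        case 1
        then show ?thesis using row_fib[of a b d i0 i0 j l] abcd jl Y(2) by simp
      next
        case 2
        then show ?thesis using col_fib[of b a c j l i0 i0] abcd jl Y(2) by simp
      next
        case 3
        then show ?thesis using mis abcd jl Y(2) by (intro zero) auto
      qed
    qed
    finally show "V a b \<otimes> V c d = \<zero>" .
  qed (use Vp V_sum in auto)
  show "graph_magic Y (U a)" if a: "a \<in> pverts X" for a
    unfolding graph_magic_def magic_def
  proof (intro conjI ballI impI)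
    fix i assume i: "i \<in> pverts Y"
    have "(\<Oplus>j\<in>pverts Y. U a i j) = (\<Oplus>b\<in>pverts X. \<Oplus>j\<in>pverts Y. w (a, i) (b, j))"
      unfolding U_def using fin wc a i by (intro finsum_swap) auto
    also have "\<dots> = (\<Oplus>t\<in>pverts X \<times> pverts Y. w (a, i) t)"
      by (rule finsum_cartesian[symmetric]) (use fin wc a i in auto)
    finally show "(\<Oplus>j\<in>pverts Y. U a i j) = \<one>" using sums(1)[OF a i] by simp
    have "(\<Oplus>j\<in>pverts Y. U a j i) = (\<Oplus>b\<in>pverts X. \<Oplus>j\<in>pverts Y. w (a, j) (b, i))"
      unfolding U_def using fin wc a i by (intro finsum_swap) auto
    also have "\<dots> = (\<Oplus>b\<in>pverts X. V a b)"
      using V_col a i Vc by (intro finsum_cong') auto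
    finally show "(\<Oplus>j\<in>pverts Y. U a j i) = \<one>" using V_sum[OF a] by simp
  next
    fix i j k l assume ijkl: "i \<in> pverts Y" "j \<in> pverts Y" "k \<in> pverts Y" "l \<in> pverts Y"
      and mis: "(i, k) \<in> parcs Y \<and> (j, l) \<notin> parcs Y \<or> (i, k) \<notin> parcs Y \<and> (j, l) \<in> parcs Y"
    have "U a i j \<otimes> U a k l = (\<Oplus>b\<in>pverts X. \<Oplus>c\<in>pverts X. w (a, i) (b, j) \<otimes> w (a, k) (c, l))"
      unfolding U_def using fin wc a ijkl by (intro finsum_mult_finsum) auto
    also have "\<dots> = \<zero>"
    proof (intro add.finprod_one_eqI)
      fix b c assume bc: "b \<in> pverts X" "c \<in> pverts X"
      show "w (a, i) (b, j) \<otimes> w (a, k) (c, l) = \<zero>\<^bsub>A\<^esub>"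
      proof (cases "b = c")
        case True
        then show ?thesis using mis a bc ijkl pair_graphD(2)[OF X] by (intro zero) auto
      next
        case False
        then show ?thesis using row_fib[of a b c i k j l] a bc ijkl by simp
      qed
    qed
    finally show "U a i j \<otimes> U a k l = \<zero>" .
  qed (use Up a in auto)
  show UV: "U a i j \<otimes> V a b = w (a, i) (b, j)"
    if "a \<in> pverts X" "b \<in> pverts X" "i \<in> pverts Y" "j \<in> pverts Y" for a b i j
  proof -
    have "U a i j \<otimes> V a b = (\<Oplus>c\<in>pverts X. w (a, i) (c, j) \<otimes> V a b)"
      unfolding U_def using fin wc that Vc by (intro finsum_ldistr) auto
    \<comment> \<open>\<open>V a b\<close> is computed along the row \<open>i\<close> instead of
      \<open>i0\<close>; for \<open>c \<noteq> b\<close> only products of distinct entries of that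
      row remain.\<close>
    also have "\<dots> = (\<Oplus>c\<in>pverts X. if b = c then w (a, i) (b, j) else \<zero>)"
    proof (rule finsum_cong')
      fix c assume c: "c \<in> pverts X"
      show "w (a, i) (c, j) \<otimes> V a b = (if b = c then w (a, i) (b, j) else \<zero>)"
      proof (cases "b = c")
        case True
        have "w (a, i) (b, j) \<otimes> (\<Oplus>k\<in>pverts Y. w (a, i) (b, k)) = w (a, i) (b, j)"
          by (rule proj_finsum(2)[OF fin(2), of "\<lambda>k. w (a, i) (b, k)"]) (use wp row that in auto)
        then show ?thesis using True V_row that by simp
      next
        case False
        have "w (a, i) (c, j) \<otimes> V a b = w (a, i) (c, j) \<otimes> (\<Oplus>k\<in>pverts Y. w (a, i) (b, k))"
          using V_row that by simp
        also have "\<dots> = (\<Oplus>k\<in>pverts Y. w (a, i) (c, j) \<otimes> w (a, i) (b, k))"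
          using fin wc that c by (intro finsum_rdistr) auto
        also have "\<dots> = \<zero>" using row that c False by (intro add.finprod_one_eqI) auto
        finally show ?thesis using False by simp
      qed
    qed (use wc that in auto)
    also have "\<dots> = w (a, i) (b, j)"
      using fin wc that by (intro add.finprod_singleton) auto
    finally show ?thesis .
  qed
  show "V a b \<otimes> U a i j = w (a, i) (b, j)"
    if "a \<in> pverts X" "b \<in> pverts X" "i \<in> pverts Y" "j \<in> pverts Y" for a b i j
  proof -
    \<comment> \<open>The product \<open>w (a, i) (b, j)\<close> and both factors are selfadjoint,
      so the order of the factors may be reversed.\<close>
    have "w (a, i) (b, j) = star A (U a i j \<otimes> V a b)"
      using UV[OF that] projD(3)[OF wp[OF that]] by simp
    also have "\<dots> = V a b \<otimes> U a i j"
      using projD(3)[OF Up] projD(3)[OF Vp] Uc Vc that by (simp add: star_mult)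
    finally show ?thesis by simp
  qed
qed

lemma wreath_graph_magic:
  assumes X: "pair_graph X" and Y: "pair_graph Y"
    and V: "graph_magic X V" and U: "\<And>a. a \<in> pverts X \<Longrightarrow> graph_magic Y (U a)"
    and comm: "\<And>a b i j. \<lbrakk>a \<in> pverts X; b \<in> pverts X; i \<in> pverts Y; j \<in> pverts Y\<rbrakk> \<Longrightarrow>
      U a i j \<otimes> V a b = V a b \<otimes> U a i j"
  shows "graph_magic (graph_lex X Y) (\<lambda>(a, i) (b, j). U a i j \<otimes> V a b)"
proof -
  note fin = pair_graphD(5)[OF X] pair_graphD(5)[OF Y]
  note mV = graph_magicD(1)[OF V X] and mU = graph_magicD(1)[OF U Y]
  note Vp = magic_proj[OF mV] and Up = magic_proj[OF mU]
  note Vc = projD(1)[OF Vp] and Uc = projD(1)[OF Up]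
  have sumU: "(\<Oplus>j\<in>pverts Y. U a i j) = \<one>" "(\<Oplus>j\<in>pverts Y. U a j i) = \<one>"
    if "a \<in> pverts X" "i \<in> pverts Y" for a i
    using mU[OF that(1)] that(2) by (simp_all add: magic_def)
  have sumV: "(\<Oplus>b\<in>pverts X. V a b) = \<one>" "(\<Oplus>b\<in>pverts X. V b a) = \<one>" if "a \<in> pverts X" for a
    using mV that by (simp_all add: magic_def)
  show ?thesis
    unfolding graph_magic_def magic_def pverts_graph_lex
  proof (intro conjI ballI impI)
    fix s t assume "s \<in> pverts X \<times> pverts Y" "t \<in> pverts X \<times> pverts Y"
    then obtain a i b j where st: "s = (a, i)" "t = (b, j)" "a \<in> pverts X" "i \<in> pverts Y"
      "b \<in> pverts X" "j \<in> pverts Y" by auto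
    note u = projD[OF Up[OF st(3) st(4) st(6)]] and v = projD[OF Vp[OF st(3) st(5)]]
    note c = comm[OF st(3) st(5) st(4) st(6)]
    have "(U a i j \<otimes> V a b) \<otimes> (U a i j \<otimes> V a b) = U a i j \<otimes> (V a b \<otimes> U a i j) \<otimes> V a b"
      using u(1) v(1) by (simp add: m_assoc)
    also have "\<dots> = (U a i j \<otimes> U a i j) \<otimes> (V a b \<otimes> V a b)"
      unfolding c[symmetric] using u(1) v(1) by (simp add: m_assoc)
    finally have "(U a i j \<otimes> V a b) \<otimes> (U a i j \<otimes> V a b) = U a i j \<otimes> V a b" by (simp only: u v)
    moreover have "star A (U a i j \<otimes> V a b) = U a i j \<otimes> V a b"
      using u v c by (simp add: star_mult)
    ultimately show "proj ((case s of (a, i) \<Rightarrow> \<lambda>(b, j). U a i j \<otimes> V a b) t)"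
      using u(1) v(1) st by (simp add: proj_def)
  next
    fix s assume "s \<in> pverts X \<times> pverts Y"
    then obtain a i where s: "s = (a, i)" "a \<in> pverts X" "i \<in> pverts Y" by auto
    have "(\<Oplus>t\<in>pverts X \<times> pverts Y. (case s of (a, i) \<Rightarrow> \<lambda>(b, j). U a i j \<otimes> V a b) t)
        = (\<Oplus>b\<in>pverts X. \<Oplus>j\<in>pverts Y. U a i j \<otimes> V a b)"
      using fin Uc Vc s by (subst finsum_cartesian) auto
    also have "\<dots> = (\<Oplus>b\<in>pverts X. V a b)"
    proof (rule finsum_cong')
      fix b assume b: "b \<in> pverts X"
      have "(\<Oplus>j\<in>pverts Y. U a i j \<otimes> V a b) = (\<Oplus>j\<in>pverts Y. U a i j) \<otimes> V a b"
        using fin Uc Vc s b by (intro finsum_ldistr[symmetric]) auto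
      then show "(\<Oplus>j\<in>pverts Y. U a i j \<otimes> V a b) = V a b" using sumU s b Vc by simp
    qed (use Vc s in auto)
    finally show "(\<Oplus>t\<in>pverts X \<times> pverts Y. (case s of (a, i) \<Rightarrow> \<lambda>(b, j). U a i j \<otimes> V a b) t) = \<one>"
      using sumV s by simp
  next
    fix t assume "t \<in> pverts X \<times> pverts Y"
    then obtain b j where t: "t = (b, j)" "b \<in> pverts X" "j \<in> pverts Y" by auto
    have "(\<Oplus>s\<in>pverts X \<times> pverts Y. (case s of (a, i) \<Rightarrow> \<lambda>(b, j). U a i j \<otimes> V a b) t)
        = (\<Oplus>a\<in>pverts X. \<Oplus>i\<in>pverts Y. U a i j \<otimes> V a b)"
      using fin Uc Vc t by (subst finsum_cartesian) auto
    also have "\<dots> = (\<Oplus>a\<in>pverts X. V a b)"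
    proof (rule finsum_cong')
      fix a assume a: "a \<in> pverts X"
      have "(\<Oplus>i\<in>pverts Y. U a i j \<otimes> V a b) = (\<Oplus>i\<in>pverts Y. U a i j) \<otimes> V a b"
        using fin Uc Vc t a by (intro finsum_ldistr[symmetric]) auto
      then show "(\<Oplus>i\<in>pverts Y. U a i j \<otimes> V a b) = V a b" using sumU t a Vc by simp
    qed (use Vc t in auto)
    finally show "(\<Oplus>s\<in>pverts X \<times> pverts Y. (case s of (a, i) \<Rightarrow> \<lambda>(b, j). U a i j \<otimes> V a b) t) = \<one>"
      using sumV t by simp
  next
    fix s t s' t' assume "s \<in> pverts X \<times> pverts Y" "t \<in> pverts X \<times> pverts Y"
      "s' \<in> pverts X \<times> pverts Y" "t' \<in> pverts X \<times> pverts Y"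
      and mis: "(s, s') \<in> parcs (graph_lex X Y) \<and> (t, t') \<notin> parcs (graph_lex X Y) \<or>
        (s, s') \<notin> parcs (graph_lex X Y) \<and> (t, t') \<in> parcs (graph_lex X Y)"
    then obtain a i b j c k d l where st: "s = (a, i)" "t = (b, j)" "s' = (c, k)" "t' = (d, l)"
      and abcd: "a \<in> pverts X" "b \<in> pverts X" "c \<in> pverts X" "d \<in> pverts X"
      and ijkl: "i \<in> pverts Y" "j \<in> pverts Y" "k \<in> pverts Y" "l \<in> pverts Y" by auto
    note cl = Uc[OF abcd(1) ijkl(1,2)] Vc[OF abcd(1,2)] Uc[OF abcd(3) ijkl(3,4)] Vc[OF abcd(3,4)]
    \<comment> \<open>If the mismatch is not visible in \<open>X\<close>, both pairs lie in single
      fibres and it occurs in \<open>Y\<close>, so commuting \<open>V a b\<close> to the right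
      brings two entries of the same \<open>U a\<close> together. Otherwise commuting within the
      second factor brings \<open>V a b\<close> next to \<open>V c d\<close>.\<close>
    have "(U a i j \<otimes> V a b) \<otimes> (U c k l \<otimes> V c d) = \<zero>"
    proof (cases "((a, c) \<in> parcs X \<longleftrightarrow> (b, d) \<in> parcs X) \<and> (a = c \<longleftrightarrow> b = d)")
      case True
      then have eq: "c = a" "d = b"
        using mis abcd ijkl by (auto simp: st)
      then have "(i, k) \<in> parcs Y \<and> (j, l) \<notin> parcs Y \<or> (i, k) \<notin> parcs Y \<and> (j, l) \<in> parcs Y"
        using mis abcd pair_graphD(2)[OF X] by (auto simp: st)
      then have UU: "U a i j \<otimes> U a k l = \<zero>"
        using U[OF abcd(1)] ijkl unfolding graph_magic_def by blast
      have "(U a i j \<otimes> V a b) \<otimes> (U a k l \<otimes> V a b) = U a i j \<otimes> (V a b \<otimes> U a k l) \<otimes> V a b"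
        using cl eq by (simp add: m_assoc)
      also have "\<dots> = (U a i j \<otimes> U a k l) \<otimes> (V a b \<otimes> V a b)"
        unfolding comm[OF abcd(1,2) ijkl(3,4), symmetric] using cl eq by (simp add: m_assoc)
      finally show ?thesis using UU cl eq by simp
    next
      case False
      then have VV: "V a b \<otimes> V c d = \<zero>"
        using graph_magic_mult_eq_zero[OF V X abcd] by simp
      have "(U a i j \<otimes> V a b) \<otimes> (U c k l \<otimes> V c d) = U a i j \<otimes> (V a b \<otimes> V c d) \<otimes> U c k l"
        unfolding comm[OF abcd(3,4) ijkl(3,4)] using cl by (simp add: m_assoc)
      then show ?thesis using VV cl by simp
    qed
    then show "(case s of (a, i) \<Rightarrow> \<lambda>(b, j). U a i j \<otimes> V a b) t \<otimes>
        (case s' of (a, i) \<Rightarrow> \<lambda>(b, j). U a i j \<otimes> V a b) t' = \<zero>"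
      by (simp add: st)
  qed
qed

end

subsection \<open>The free wreath product\<close>

text \<open>These definitions name the local bindings of \<open>free_wreath\<close>. The maps
  \<open>wreath_base\<close> and \<open>wreath_top\<close> are defined on the whole algebras and not
  only on the fundamental representations, so that they can be treated as homomorphisms.\<close>

definition wreath_coprod where
  "wreath_coprod \<G> \<H> = cstar_coprod (cstar_copower (points \<H>) (cfun \<G>)) (cfun \<H>)"

definition wreath_base where
  "wreath_base \<G> \<H> a x = coprod_in (cstar_copower (points \<H>) (cfun \<G>)) (cfun \<H>)
     (Inl (copower_in (points \<H>) (cfun \<G>) a x))"

definition wreath_top where
  "wreath_top \<G> \<H> y = coprod_in (cstar_copower (points \<H>) (cfun \<G>)) (cfun \<H>) (Inr y)"

definition wreath_commutators where
  "wreath_commutators \<G> \<H> =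
     {wreath_base \<G> \<H> a (fund \<G> i j) \<otimes>\<^bsub>wreath_coprod \<G> \<H>\<^esub> wreath_top \<G> \<H> (fund \<H> a b)
      \<ominus>\<^bsub>wreath_coprod \<G> \<H>\<^esub>
      wreath_top \<G> \<H> (fund \<H> a b) \<otimes>\<^bsub>wreath_coprod \<G> \<H>\<^esub> wreath_base \<G> \<H> a (fund \<G> i j) | i j a b.
        i \<in> points \<G> \<and> j \<in> points \<G> \<and> a \<in> points \<H> \<and> b \<in> points \<H>}"

definition wreath_quot where
  "wreath_quot \<G> \<H> = quotient_map (wreath_coprod \<G> \<H>) (wreath_commutators \<G> \<H>)"

lemma free_wreath_eq:
  "free_wreath \<G> \<H> =
     \<lparr> points = points \<H> \<times> points \<G>,
       cfun = cstar_quotient (wreath_coprod \<G> \<H>) (wreath_commutators \<G> \<H>),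
       fund = (\<lambda>(a, i) (b, j). wreath_quot \<G> \<H>
         (wreath_base \<G> \<H> a (fund \<G> i j) \<otimes>\<^bsub>wreath_coprod \<G> \<H>\<^esub> wreath_top \<G> \<H> (fund \<H> a b))) \<rparr>"
  by (simp add: free_wreath_def Let_def wreath_coprod_def wreath_base_def wreath_top_def
      wreath_commutators_def wreath_quot_def)

locale wreath =
  fixes \<G> :: "('i, 'a) quantum_perm_group" and \<H> :: "('j, 'b) quantum_perm_group"
  assumes cstar_base: "cstar (cfun \<G>)" and cstar_top: "cstar (cfun \<H>)"
    and base_fund: "\<lbrakk>i \<in> points \<G>; j \<in> points \<G>\<rbrakk> \<Longrightarrow> fund \<G> i j \<in> carrier (cfun \<G>)"
    and top_fund: "\<lbrakk>a \<in> points \<H>; b \<in> points \<H>\<rbrakk> \<Longrightarrow> fund \<H> a b \<in> carrier (cfun \<H>)"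
begin

abbreviation "W \<equiv> cfun (free_wreath \<G> \<H>)"
abbreviation "D \<equiv> wreath_coprod \<G> \<H>"

definition U where "U a x = wreath_quot \<G> \<H> (wreath_base \<G> \<H> a x)"
definition V where "V y = wreath_quot \<G> \<H> (wreath_top \<G> \<H> y)"

lemma cstar_D: "cstar D"
  unfolding wreath_coprod_def by (intro cstar_coprod cstar_copower cstar_base cstar_top)

lemma cstar_W: "cstar W"
  by (simp add: free_wreath_eq cstar_quotient[OF cstar_D])

lemma quot_hom: "wreath_quot \<G> \<H> \<in> cstar_hom D W"
  using quotient_map_hom[OF cstar_D] by (simp add: wreath_quot_def free_wreath_eq)

lemma base_hom: "a \<in> points \<H> \<Longrightarrow> wreath_base \<G> \<H> a \<in> cstar_hom (cfun \<G>) D"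
  unfolding wreath_base_def[abs_def] wreath_coprod_def
  by (rule cstar_hom_comp[OF copower_in_hom[OF cstar_base]
        coprod_in_hom(1)[OF cstar_copower[OF cstar_base] cstar_top]])

lemma top_hom: "wreath_top \<G> \<H> \<in> cstar_hom (cfun \<H>) D"
  using coprod_in_hom(2)[OF cstar_copower[OF cstar_base] cstar_top]
  unfolding wreath_top_def[abs_def] wreath_coprod_def .

lemma U_hom: "a \<in> points \<H> \<Longrightarrow> U a \<in> cstar_hom (cfun \<G>) W"
  using cstar_hom_comp[OF base_hom quot_hom] unfolding U_def[abs_def] .

lemma V_hom: "V \<in> cstar_hom (cfun \<H>) W"
  using cstar_hom_comp[OF top_hom quot_hom] unfolding V_def[abs_def] .

lemma D_closed:
  "\<lbrakk>a \<in> points \<H>; x \<in> carrier (cfun \<G>)\<rbrakk> \<Longrightarrow> wreath_base \<G> \<H> a x \<in> carrier D"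
  "y \<in> carrier (cfun \<H>) \<Longrightarrow> wreath_top \<G> \<H> y \<in> carrier D"
  by (rule star_homD(1)[OF cstar_homD(1)[OF base_hom]], assumption+)
    (rule star_homD(1)[OF cstar_homD(1)[OF top_hom]])

lemma UV_mult:
  assumes "a \<in> points \<H>" "x \<in> carrier (cfun \<G>)" "y \<in> carrier (cfun \<H>)"
  shows "wreath_quot \<G> \<H> (wreath_base \<G> \<H> a x \<otimes>\<^bsub>D\<^esub> wreath_top \<G> \<H> y) = U a x \<otimes>\<^bsub>W\<^esub> V y"
    and "wreath_quot \<G> \<H> (wreath_top \<G> \<H> y \<otimes>\<^bsub>D\<^esub> wreath_base \<G> \<H> a x) = V y \<otimes>\<^bsub>W\<^esub> U a x"
  unfolding U_def V_def using assms D_closed star_homD(2)[OF cstar_homD(1)[OF quot_hom]] by auto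

lemma fund_wreath:
  assumes "a \<in> points \<H>" "b \<in> points \<H>" "i \<in> points \<G>" "j \<in> points \<G>"
  shows "fund (free_wreath \<G> \<H>) (a, i) (b, j) = U a (fund \<G> i j) \<otimes>\<^bsub>W\<^esub> V (fund \<H> a b)"
  unfolding UV_mult(1)[OF assms(1) base_fund[OF assms(3,4)] top_fund[OF assms(1,2)], symmetric]
  by (simp add: free_wreath_eq)

lemma commute:
  assumes "a \<in> points \<H>" "b \<in> points \<H>" "i \<in> points \<G>" "j \<in> points \<G>"
  shows "U a (fund \<G> i j) \<otimes>\<^bsub>W\<^esub> V (fund \<H> a b) = V (fund \<H> a b) \<otimes>\<^bsub>W\<^esub> U a (fund \<G> i j)"
proof -
  interpret D: cstar D by (rule cstar_D)
  interpret W: cstar W by (rule cstar_W)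
  note xy = base_fund[OF assms(3,4)] top_fund[OF assms(1,2)]
  let ?x = "wreath_base \<G> \<H> a (fund \<G> i j)" and ?y = "wreath_top \<G> \<H> (fund \<H> a b)"
  have c: "?x \<in> carrier D" "?y \<in> carrier D" using D_closed assms xy by auto
  have "?x \<otimes>\<^bsub>D\<^esub> ?y \<ominus>\<^bsub>D\<^esub> ?y \<otimes>\<^bsub>D\<^esub> ?x \<in> wreath_commutators \<G> \<H>"
    unfolding wreath_commutators_def using assms by blast
  from quotient_map_eq_zero[OF cstar_D this]
  have "wreath_quot \<G> \<H> (?x \<otimes>\<^bsub>D\<^esub> ?y \<ominus>\<^bsub>D\<^esub> ?y \<otimes>\<^bsub>D\<^esub> ?x) = \<zero>\<^bsub>W\<^esub>"
    using c by (simp add: wreath_quot_def free_wreath_eq)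
  then have "wreath_quot \<G> \<H> (?x \<otimes>\<^bsub>D\<^esub> ?y) \<ominus>\<^bsub>W\<^esub> wreath_quot \<G> \<H> (?y \<otimes>\<^bsub>D\<^esub> ?x) = \<zero>\<^bsub>W\<^esub>"
    using star_hom_minus[OF D.star_alg_axioms W.star_alg_axioms cstar_homD(1)[OF quot_hom]] c by simp
  then have "wreath_quot \<G> \<H> (?x \<otimes>\<^bsub>D\<^esub> ?y) = wreath_quot \<G> \<H> (?y \<otimes>\<^bsub>D\<^esub> ?x)"
    using star_homD(1)[OF cstar_homD(1)[OF quot_hom]] c by (subst (asm) W.minus_eq_zero_iff) auto
  then show ?thesis using UV_mult[OF assms(1) xy] by simp
qed

text \<open>The universal properties of copower, coproduct and quotient in succession;
  \<open>comm\<close> says precisely that the map on the coproduct kills the generating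
  commutators.\<close>

lemma universal:
  assumes B: "cstar B" and f: "\<And>a. a \<in> points \<H> \<Longrightarrow> f a \<in> cstar_hom (cfun \<G>) B"
    and g: "g \<in> cstar_hom (cfun \<H>) B"
    and comm: "\<And>a b i j. \<lbrakk>a \<in> points \<H>; b \<in> points \<H>; i \<in> points \<G>; j \<in> points \<G>\<rbrakk> \<Longrightarrow>
      f a (fund \<G> i j) \<otimes>\<^bsub>B\<^esub> g (fund \<H> a b) = g (fund \<H> a b) \<otimes>\<^bsub>B\<^esub> f a (fund \<G> i j)"
  shows "\<exists>\<Phi> \<in> cstar_hom W B.
    (\<forall>a \<in> points \<H>. \<forall>x \<in> carrier (cfun \<G>). \<Phi> (U a x) = f a x) \<and>
    (\<forall>y \<in> carrier (cfun \<H>). \<Phi> (V y) = g y)"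
proof -
  interpret D: cstar D by (rule cstar_D)
  interpret B: cstar B by fact
  let ?P = "cstar_copower (points \<H>) (cfun \<G>)"
  note cP = cstar_copower[OF cstar_base, of "points \<H>"]
  have "\<exists>\<phi> \<in> cstar_hom ?P B. \<forall>a \<in> points \<H>. \<forall>x \<in> carrier (cfun \<G>).
      \<phi> (copower_in (points \<H>) (cfun \<G>) a x) = f a x"
    by (rule copower_universal[OF cstar_base B f])
  then obtain \<phi> where \<phi>: "\<phi> \<in> cstar_hom ?P B"
    "\<forall>a \<in> points \<H>. \<forall>x \<in> carrier (cfun \<G>). \<phi> (copower_in (points \<H>) (cfun \<G>) a x) = f a x"
    by (rule bexE)
  from coprod_universal[OF cP cstar_top B \<phi>(1) g] obtain \<psi> where \<psi>: "\<psi> \<in> cstar_hom D B"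
    "\<And>x. x \<in> carrier ?P \<Longrightarrow> \<psi> (coprod_in ?P (cfun \<H>) (Inl x)) = \<phi> x"
    "\<And>y. y \<in> carrier (cfun \<H>) \<Longrightarrow> \<psi> (coprod_in ?P (cfun \<H>) (Inr y)) = g y"
    unfolding wreath_coprod_def by blast
  have base: "\<psi> (wreath_base \<G> \<H> a x) = f a x" if "a \<in> points \<H>" "x \<in> carrier (cfun \<G>)" for a x
    using \<psi>(2) \<phi>(2) that star_homD(1)[OF cstar_homD(1)[OF copower_in_hom[OF cstar_base that(1)]] that(2)]
    by (simp add: wreath_base_def)
  have top: "\<psi> (wreath_top \<G> \<H> y) = g y" if "y \<in> carrier (cfun \<H>)" for y
    using \<psi>(3)[OF that] by (simp add: wreath_top_def)
  have "\<psi> s = \<zero>\<^bsub>B\<^esub>" if s: "s \<in> wreath_commutators \<G> \<H>" for s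
  proof -
    obtain a b i j where V: "a \<in> points \<H>" "b \<in> points \<H>" "i \<in> points \<G>" "j \<in> points \<G>"
      and s_eq: "s = wreath_base \<G> \<H> a (fund \<G> i j) \<otimes>\<^bsub>D\<^esub> wreath_top \<G> \<H> (fund \<H> a b)
        \<ominus>\<^bsub>D\<^esub> wreath_top \<G> \<H> (fund \<H> a b) \<otimes>\<^bsub>D\<^esub> wreath_base \<G> \<H> a (fund \<G> i j)"
      using s unfolding wreath_commutators_def by blast
    note xy = base_fund[OF V(3,4)] top_fund[OF V(1,2)]
    let ?x = "wreath_base \<G> \<H> a (fund \<G> i j)" and ?y = "wreath_top \<G> \<H> (fund \<H> a b)"
    have c: "?x \<in> carrier D" "?y \<in> carrier D" using D_closed V xy by auto
    note h = star_homD[OF cstar_homD(1)[OF \<psi>(1)]]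
    have "\<psi> s = \<psi> (?x \<otimes>\<^bsub>D\<^esub> ?y) \<ominus>\<^bsub>B\<^esub> \<psi> (?y \<otimes>\<^bsub>D\<^esub> ?x)"
      unfolding s_eq
      using star_hom_minus[OF D.star_alg_axioms B.star_alg_axioms cstar_homD(1)[OF \<psi>(1)]] c by simp
    also have "\<psi> (?x \<otimes>\<^bsub>D\<^esub> ?y) = \<psi> (?y \<otimes>\<^bsub>D\<^esub> ?x)"
      using h(2) c base[OF V(1) xy(1)] top[OF xy(2)] comm[OF V] by simp
    also have "\<psi> (?y \<otimes>\<^bsub>D\<^esub> ?x) \<ominus>\<^bsub>B\<^esub> \<psi> (?y \<otimes>\<^bsub>D\<^esub> ?x) = \<zero>\<^bsub>B\<^esub>"
      using h(1) c by (subst B.minus_eq_zero_iff) auto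
    finally show ?thesis .
  qed
  then have "\<exists>\<Phi> \<in> cstar_hom (cstar_quotient D (wreath_commutators \<G> \<H>)) B.
      \<forall>x \<in> carrier D. \<Phi> (quotient_map D (wreath_commutators \<G> \<H>) x) = \<psi> x"
    by (rule quotient_universal[OF cstar_D B \<psi>(1)])
  then obtain \<Phi> where \<Phi>: "\<Phi> \<in> cstar_hom (cstar_quotient D (wreath_commutators \<G> \<H>)) B"
    "\<forall>x \<in> carrier D. \<Phi> (quotient_map D (wreath_commutators \<G> \<H>) x) = \<psi> x"
    by (rule bexE)
  show ?thesis
  proof (rule bexI[of _ \<Phi>])
    show "\<Phi> \<in> cstar_hom W B" using \<Phi>(1) by (simp add: free_wreath_eq)
  qed (simp add: U_def V_def wreath_quot_def \<Phi>(2) D_closed base top)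
qed

text \<open>Undoes the construction from the outside: a map on the quotient is determined on the
  coproduct, hence on its two factors, and on the copower by the individual copies.\<close>

lemma hom_eqI:
  assumes B: "cstar B" and h: "h \<in> cstar_hom W B" and k: "k \<in> cstar_hom W B"
    and U: "\<And>a x. \<lbrakk>a \<in> points \<H>; x \<in> carrier (cfun \<G>)\<rbrakk> \<Longrightarrow> h (U a x) = k (U a x)"
    and V: "\<And>y. y \<in> carrier (cfun \<H>) \<Longrightarrow> h (V y) = k (V y)"
    and z: "z \<in> carrier W"
  shows "h z = k z"
proof -
  let ?P = "cstar_copower (points \<H>) (cfun \<G>)"
  note cP = cstar_copower[OF cstar_base, of "points \<H>"]
  have hD: "(\<lambda>x. h (wreath_quot \<G> \<H> x)) \<in> cstar_hom D B" and kD: "(\<lambda>x. k (wreath_quot \<G> \<H> x)) \<in> cstar_hom D B"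
    using cstar_hom_comp[OF quot_hom h] cstar_hom_comp[OF quot_hom k] by auto
  note Inl = coprod_in_hom(1)[OF cP cstar_top, folded wreath_coprod_def]
  have P: "h (wreath_quot \<G> \<H> (coprod_in ?P (cfun \<H>) (Inl x))) = k (wreath_quot \<G> \<H> (coprod_in ?P (cfun \<H>) (Inl x)))"
    if "x \<in> carrier ?P" for x
    by (rule copower_hom_eqI[OF cstar_base B cstar_hom_comp[OF Inl hD] cstar_hom_comp[OF Inl kD] _ that])
      (use U in \<open>simp add: U_def wreath_base_def\<close>)
  have "h (wreath_quot \<G> \<H> x) = k (wreath_quot \<G> \<H> x)" if "x \<in> carrier D" for x
    using coprod_hom_eqI[OF cP cstar_top B, folded wreath_coprod_def, OF hD kD P _ that] V
    by (simp add: V_def wreath_top_def)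
  then show ?thesis
    using quotient_hom_eqI[OF cstar_D B, of h "wreath_commutators \<G> \<H>" k z] h k z
    by (simp add: free_wreath_eq wreath_quot_def)
qed

end

lemma Qut_fund_closed:
  "\<lbrakk>i \<in> pverts X; j \<in> pverts X\<rbrakk> \<Longrightarrow> fund (Qut X) i j \<in> carrier (cfun (Qut X))"
  using graph_magic_Qut[of X] cstar.magic_closed[OF cstar_Qut] cstar.graph_magic_def[OF cstar_Qut]
  by metis

lemma wreath_Qut: "wreath (Qut Y) (Qut X)"
  by (rule wreath.intro) (simp_all add: cstar_Qut Qut_fund_closed)

lemma qperm_equalI:
  assumes pts: "points \<G> = points \<H>"
    and h: "h \<in> cstar_hom (cfun \<G>) (cfun \<H>)" and k: "k \<in> cstar_hom (cfun \<H>) (cfun \<G>)"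
    and fund: "\<And>i j. \<lbrakk>i \<in> points \<G>; j \<in> points \<G>\<rbrakk> \<Longrightarrow> h (fund \<G> i j) = fund \<H> i j"
    and kh: "\<And>x. x \<in> carrier (cfun \<G>) \<Longrightarrow> k (h x) = x" and hk: "\<And>y. y \<in> carrier (cfun \<H>) \<Longrightarrow> h (k y) = y"
  shows "qperm_equal \<G> \<H>"
proof -
  note c = star_homD(1)[OF cstar_homD(1)[OF h]] star_homD(1)[OF cstar_homD(1)[OF k]]
  have "bij_betw h (carrier (cfun \<G>)) (carrier (cfun \<H>))"
    by (rule bij_betw_byWitness[of _ k]) (use kh hk c in auto)
  then have "h \<in> star_iso (cfun \<G>) (cfun \<H>)" using cstar_homD(1)[OF h] by (simp add: star_iso_def)
  then show ?thesis using pts fund by (auto simp: qperm_equal_def)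
qed

text \<open>\<open>wreath_graph_magic\<close> induces a map \<open>h\<close> from the left algebra
  to the right one and \<open>lex_factor\<close> a map \<open>k\<close> back. Both composites fix
  the generators, and a contractive homomorphism is determined by its values there.\<close>

lemma qperm_equal_if:
  fixes X :: "'a pair_pre_digraph" and Y :: "'b pair_pre_digraph"
  assumes X: "pair_graph X" and Y: "pair_graph Y" "pverts Y \<noteq> {}"
    and tw: "\<not> Digraph_Component.connected (with_proj Y) \<Longrightarrow> \<nexists>x y. twins X x y"
    and tw': "\<not> Digraph_Component.connected (with_proj (graph_compl Y)) \<Longrightarrow>
      \<nexists>x y. twins (graph_compl X) x y"
  shows "qperm_equal (Qut (graph_lex X Y)) (free_wreath (Qut Y) (Qut X))"
proof -
  let ?Z = "graph_lex X Y"
  interpret wr: wreath "Qut Y" "Qut X" by (rule wreath_Qut)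
  interpret Z: cstar "cfun (Qut ?Z)" by (rule cstar_Qut)
  interpret W: cstar wr.W by (rule wr.cstar_W)
  obtain i0 where i0: "i0 \<in> pverts Y" using Y(2) by blast
  note finX = pair_graphD(5)[OF X] and finY = pair_graphD(5)[OF Y(1)]
  define u where "u a i j = wr.U a (fund (Qut Y) i j)" for a i j
  define v where "v a b = wr.V (fund (Qut X) a b)" for a b
  have v: "W.graph_magic X v"
    unfolding v_def by (rule graph_magic_hom[OF cstar_Qut wr.cstar_W wr.V_hom graph_magic_Qut])
  have u: "W.graph_magic Y (u a)" if "a \<in> pverts X" for a
    unfolding u_def using that
    by (intro graph_magic_hom[OF cstar_Qut wr.cstar_W wr.U_hom graph_magic_Qut]) simp
  have uv: "u a i j \<otimes>\<^bsub>wr.W\<^esub> v a b = v a b \<otimes>\<^bsub>wr.W\<^esub> u a i j"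
    if "a \<in> pverts X" "b \<in> pverts X" "i \<in> pverts Y" "j \<in> pverts Y" for a b i j
    unfolding u_def v_def using that by (intro wr.commute) auto
  have fund_eq: "fund (free_wreath (Qut Y) (Qut X)) (a, i) (b, j) = u a i j \<otimes>\<^bsub>wr.W\<^esub> v a b"
    if "a \<in> pverts X" "b \<in> pverts X" "i \<in> pverts Y" "j \<in> pverts Y" for a b i j
    unfolding u_def v_def using that by (intro wr.fund_wreath) auto
  obtain h where h: "h \<in> cstar_hom (cfun (Qut ?Z)) wr.W"
    "\<forall>s \<in> pverts ?Z. \<forall>t \<in> pverts ?Z.
      h (fund (Qut ?Z) s t) = (case s of (a, i) \<Rightarrow> \<lambda>(b, j). u a i j \<otimes>\<^bsub>wr.W\<^esub> v a b) t"
    by (rule bexE[OF Qut_universal[OF wr.cstar_W W.wreath_graph_magic[OF X Y(1) v u uv]]])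
  define z where "z = fund (Qut ?Z)"
  have hz: "h (z (a, i) (b, j)) = u a i j \<otimes>\<^bsub>wr.W\<^esub> v a b"
    if "a \<in> pverts X" "b \<in> pverts X" "i \<in> pverts Y" "j \<in> pverts Y" for a b i j
    using h(2) that by (simp add: z_def)
  have zc: "z (a, i) (b, j) \<in> carrier (cfun (Qut ?Z))"
    if "a \<in> pverts X" "b \<in> pverts X" "i \<in> pverts Y" "j \<in> pverts Y" for a b i j
    unfolding z_def using that by (intro Qut_fund_closed) auto
  define U where "U a i j = (\<Oplus>\<^bsub>cfun (Qut ?Z)\<^esub>b\<in>pverts X. z (a, i) (b, j))" for a i j
  define V where "V a b = (\<Oplus>\<^bsub>cfun (Qut ?Z)\<^esub>j\<in>pverts Y. z (a, i0) (b, j))" for a b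
  note factor = Z.lex_factor[OF X Y(1) i0 graph_magic_Qut tw tw', folded z_def, folded U_def V_def]
  \<comment> \<open>The universal property of \<open>Qut Y\<close> is used once for each vertex of
    \<open>X\<close>; choice collects the homomorphisms into the family that the copower
    requires.\<close>
  have "\<forall>a \<in> pverts X. \<exists>f. f \<in> cstar_hom (cfun (Qut Y)) (cfun (Qut ?Z)) \<and>
      (\<forall>i\<in>pverts Y. \<forall>j\<in>pverts Y. f (fund (Qut Y) i j) = U a i j)"
    using Qut_universal[OF cstar_Qut factor(2)] unfolding Bex_def by (rule ballI)
  from bchoice[OF this] obtain f where f':
    "\<forall>a \<in> pverts X. f a \<in> cstar_hom (cfun (Qut Y)) (cfun (Qut ?Z)) \<and>
      (\<forall>i\<in>pverts Y. \<forall>j\<in>pverts Y. f a (fund (Qut Y) i j) = U a i j)"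
    by (rule exE)
  then have f: "\<And>a. a \<in> pverts X \<Longrightarrow> f a \<in> cstar_hom (cfun (Qut Y)) (cfun (Qut ?Z))"
    "\<And>a i j. \<lbrakk>a \<in> pverts X; i \<in> pverts Y; j \<in> pverts Y\<rbrakk> \<Longrightarrow> f a (fund (Qut Y) i j) = U a i j"
    by simp_all
  obtain g where g: "g \<in> cstar_hom (cfun (Qut X)) (cfun (Qut ?Z))"
    "\<forall>a \<in> pverts X. \<forall>b \<in> pverts X. g (fund (Qut X) a b) = V a b"
    by (rule bexE[OF Qut_universal[OF cstar_Qut factor(1)]])
  have fg: "f a (fund (Qut Y) i j) \<otimes>\<^bsub>cfun (Qut ?Z)\<^esub> g (fund (Qut X) a b) =
      g (fund (Qut X) a b) \<otimes>\<^bsub>cfun (Qut ?Z)\<^esub> f a (fund (Qut Y) i j)"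
    if "a \<in> points (Qut X)" "b \<in> points (Qut X)" "i \<in> points (Qut Y)" "j \<in> points (Qut Y)" for a b i j
    using that factor(3)[of a b i j] factor(4)[of a b i j] by (simp add: f(2) g(2))
  have "\<exists>k \<in> cstar_hom wr.W (cfun (Qut ?Z)).
      (\<forall>a \<in> points (Qut X). \<forall>x \<in> carrier (cfun (Qut Y)). k (wr.U a x) = f a x) \<and>
      (\<forall>y \<in> carrier (cfun (Qut X)). k (wr.V y) = g y)"
    by (rule wr.universal) (simp_all add: cstar_Qut g(1) f(1) fg)
  then obtain k where k: "k \<in> cstar_hom wr.W (cfun (Qut ?Z))"
    "(\<forall>a \<in> points (Qut X). \<forall>x \<in> carrier (cfun (Qut Y)). k (wr.U a x) = f a x) \<and>
      (\<forall>y \<in> carrier (cfun (Qut X)). k (wr.V y) = g y)"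
    by (rule bexE)
  have ku: "k (u a i j) = U a i j" if "a \<in> pverts X" "i \<in> pverts Y" "j \<in> pverts Y" for a i j
    unfolding u_def
    using k(2)[THEN conjunct1, rule_format, OF _ Qut_fund_closed[OF that(2,3)]] f(2) that by simp
  have kv: "k (v a b) = V a b" if "a \<in> pverts X" "b \<in> pverts X" for a b
    unfolding v_def
    using k(2)[THEN conjunct2, rule_format, OF Qut_fund_closed[OF that]] g(2) that by simp
  have uc: "u a i j \<in> carrier wr.W" if "a \<in> pverts X" "i \<in> pverts Y" "j \<in> pverts Y" for a i j
    using W.magic_closed[OF W.graph_magicD(1)[OF u Y(1)]] that by blast
  have vc: "v a b \<in> carrier wr.W" if "a \<in> pverts X" "b \<in> pverts X" for a b
    using W.magic_closed[OF W.graph_magicD(1)[OF v X]] that by blast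
  note hh = star_homD[OF cstar_homD(1)[OF h(1)]] and kk = star_homD[OF cstar_homD(1)[OF k(1)]]
  \<comment> \<open>Summation over \<open>b\<close> exhausts a row of \<open>v\<close> and leaves
    the factor \<open>u a i j\<close>. In \<open>hV\<close>, summation over \<open>j\<close>
    exhausts the row \<open>i0\<close> of \<open>u a\<close> and leaves
    \<open>v a b\<close>.\<close>
  have hU: "h (U a i j) = u a i j" if aij: "a \<in> pverts X" "i \<in> pverts Y" "j \<in> pverts Y" for a i j
  proof -
    have "h (U a i j) = (\<Oplus>\<^bsub>wr.W\<^esub>b\<in>pverts X. h (z (a, i) (b, j)))"
      unfolding U_def
      by (rule star_hom_finsum[OF Z.star_alg_axioms W.star_alg_axioms cstar_homD(1)[OF h(1)]])
        (use zc that in auto)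
    also have "\<dots> = (\<Oplus>\<^bsub>wr.W\<^esub>b\<in>pverts X. u a i j \<otimes>\<^bsub>wr.W\<^esub> v a b)"
      using hz uc vc that by (intro W.finsum_cong') auto
    also have "\<dots> = u a i j \<otimes>\<^bsub>wr.W\<^esub> (\<Oplus>\<^bsub>wr.W\<^esub>b\<in>pverts X. v a b)"
      using finX uc vc that by (intro W.finsum_rdistr[symmetric]) auto
    also have "(\<Oplus>\<^bsub>wr.W\<^esub>b\<in>pverts X. v a b) = \<one>\<^bsub>wr.W\<^esub>"
      using W.graph_magicD(1)[OF v X] that by (simp add: W.magic_def)
    finally show ?thesis using uc[OF aij] by simp
  qed
  have hV: "h (V a b) = v a b" if ab: "a \<in> pverts X" "b \<in> pverts X" for a b
  proof -
    have "h (V a b) = (\<Oplus>\<^bsub>wr.W\<^esub>j\<in>pverts Y. h (z (a, i0) (b, j)))"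
      unfolding V_def
      by (rule star_hom_finsum[OF Z.star_alg_axioms W.star_alg_axioms cstar_homD(1)[OF h(1)]])
        (use zc that i0 in auto)
    also have "\<dots> = (\<Oplus>\<^bsub>wr.W\<^esub>j\<in>pverts Y. u a i0 j \<otimes>\<^bsub>wr.W\<^esub> v a b)"
      using hz uc vc that i0 by (intro W.finsum_cong') auto
    also have "\<dots> = (\<Oplus>\<^bsub>wr.W\<^esub>j\<in>pverts Y. u a i0 j) \<otimes>\<^bsub>wr.W\<^esub> v a b"
      using finY uc vc that i0 by (intro W.finsum_ldistr[symmetric]) auto
    also have "(\<Oplus>\<^bsub>wr.W\<^esub>j\<in>pverts Y. u a i0 j) = \<one>\<^bsub>wr.W\<^esub>"
      using W.graph_magicD(1)[OF u[OF ab(1)] Y(1)] i0 by (simp add: W.magic_def)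
    finally show ?thesis using vc[OF ab] by simp
  qed
  show ?thesis
  proof (rule qperm_equalI[OF _ h(1) k(1)])
    show "points (Qut ?Z) = points (free_wreath (Qut Y) (Qut X))" by (simp add: free_wreath_eq)
  next
    fix s t assume "s \<in> points (Qut ?Z)" "t \<in> points (Qut ?Z)"
    then show "h (fund (Qut ?Z) s t) = fund (free_wreath (Qut Y) (Qut X)) s t"
      using hz fund_eq by (auto simp: z_def)
  next
    fix x assume x: "x \<in> carrier (cfun (Qut ?Z))"
    show "k (h x) = x"
    proof (rule Qut_hom_eqI[OF cstar_Qut cstar_hom_comp[OF h(1) k(1)] cstar_hom_id _ x])
      fix s t assume "s \<in> pverts ?Z" "t \<in> pverts ?Z"
      then obtain a i b j where st: "s = (a, i)" "t = (b, j)" "a \<in> pverts X" "i \<in> pverts Y"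
        "b \<in> pverts X" "j \<in> pverts Y" by auto
      have "k (h (z s t)) = U a i j \<otimes>\<^bsub>cfun (Qut ?Z)\<^esub> V a b"
        using hz kk(2) uc vc ku kv st by simp
      then show "k (h (fund (Qut ?Z) s t)) = fund (Qut ?Z) s t"
        using factor(3) st by (simp add: z_def)
    qed
  next
    fix y assume y: "y \<in> carrier wr.W"
    have comp: "(\<lambda>x. h (k x)) \<in> cstar_hom wr.W wr.W" by (rule cstar_hom_comp[OF k(1) h(1)])
    show "h (k y) = y"
    proof (rule wr.hom_eqI[OF wr.cstar_W comp cstar_hom_id _ _ y])
      fix a x assume a: "a \<in> points (Qut X)" and x: "x \<in> carrier (cfun (Qut Y))"
      show "h (k (wr.U a x)) = wr.U a x"
        by (rule Qut_hom_eqI[OF wr.cstar_W cstar_hom_comp[OF wr.U_hom[OF a] comp] wr.U_hom[OF a] _ x])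
          (use ku hU a in \<open>simp flip: u_def\<close>)
    next
      fix x assume x: "x \<in> carrier (cfun (Qut X))"
      show "h (k (wr.V x)) = wr.V x"
        by (rule Qut_hom_eqI[OF wr.cstar_W cstar_hom_comp[OF wr.V_hom comp] wr.V_hom _ x])
          (use kv hV in \<open>simp flip: v_def\<close>)
    qed
  qed
qed

subsection \<open>Classical automorphisms\<close>

definition complex_cstar :: "complex cstar_algebra" where
  "complex_cstar = \<lparr> carrier = UNIV, monoid.mult = (*), one = 1, zero = 0, add = (+),
     scal = (*), star = cnj, nrm = cmod \<rparr>"

lemma complex_cstar_simps [simp]:
  "carrier complex_cstar = UNIV" "monoid.mult complex_cstar = (*)" "one complex_cstar = 1"
  "zero complex_cstar = 0" "add complex_cstar = (+)" "scal complex_cstar = (*)"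
  "star complex_cstar = cnj" "nrm complex_cstar = cmod"
  by (simp_all add: complex_cstar_def)

lemma cstar_complex: "cstar complex_cstar"
proof -
  have "ring complex_cstar"
  proof (rule ringI)
    show "abelian_group complex_cstar"
      by (rule abelian_groupI) (auto simp: add_ac intro: exI[of _ "- _"])
    show "Group.monoid complex_cstar"
      by (rule monoidI) auto
  qed (auto simp: algebra_simps)
  then interpret ring complex_cstar .
  interpret star_alg complex_cstar
    by unfold_locales (auto simp: algebra_simps)
  have minus: "x \<ominus>\<^bsub>complex_cstar\<^esub> y = x - y" for x y
  proof -
    have "\<ominus>\<^bsub>complex_cstar\<^esub> y = - y" by (rule minus_equality) auto
    then show ?thesis by (simp add: a_minus_def)
  qed
  show ?thesis
  proof unfold_locales
    show "cstar_seminorm complex_cstar (nrm complex_cstar)"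
      by (auto simp: cstar_seminorm_def norm_mult norm_triangle_ineq power2_eq_square)
  next
    fix s assume "s \<in> cauchy_seqs complex_cstar (nrm complex_cstar)"
    then have "Cauchy s" by (auto simp: cauchy_seqs_def minus Cauchy_def dist_norm)
    then obtain l where "s \<longlonglongrightarrow> l" using Cauchy_convergent convergent_def by blast
    then have "(\<lambda>n. cmod (s n - l)) \<longlonglongrightarrow> 0" by (simp add: LIM_zero_iff tendsto_norm_zero_iff)
    then show "\<exists>x\<in>carrier complex_cstar. (\<lambda>n. nrm complex_cstar (s n \<ominus>\<^bsub>complex_cstar\<^esub> x)) \<longlonglongrightarrow> 0"
      by (auto simp: minus)
  qed auto
qed

lemma finsum_complex_cstar: "finite I \<Longrightarrow> finsum complex_cstar f I = sum f I"
proof -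
  interpret cstar complex_cstar by (rule cstar_complex)
  assume "finite I"
  then show ?thesis by (induction I rule: finite_induct) auto
qed

text \<open>The permutation matrix of \<open>\<sigma>\<close>, with the one of row \<open>x\<close>
  in column \<open>\<sigma> x\<close>. Through \<open>Qut_universal\<close> it turns a classical
  automorphism into a character of the quantum automorphism group.\<close>

lemma graph_magic_automorphism:
  assumes X: "pair_graph X" and \<sigma>: "bij_betw \<sigma> (pverts X) (pverts X)"
    and adj: "\<And>x y. \<lbrakk>x \<in> pverts X; y \<in> pverts X\<rbrakk> \<Longrightarrow> (\<sigma> x, \<sigma> y) \<in> parcs X \<longleftrightarrow> (x, y) \<in> parcs X"
  shows "cstar.graph_magic complex_cstar X (\<lambda>x y. if \<sigma> x = y then 1 else 0)"
proof -
  interpret cstar complex_cstar by (rule cstar_complex)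
  note fin = pair_graphD(5)[OF X]
  have col: "(\<Sum>x\<in>pverts X. if \<sigma> x = y then 1 else 0) = (1::complex)" if y: "y \<in> pverts X" for y
  proof -
    have "y \<in> \<sigma> ` pverts X" using bij_betw_imp_surj_on[OF \<sigma>] y by simp
    then obtain x where x: "x \<in> pverts X" "\<sigma> x = y" by blast
    have "(\<sigma> x' = y) = (x' = x)" if "x' \<in> pverts X" for x'
      using inj_on_eq_iff[OF bij_betw_imp_inj_on[OF \<sigma>] that x(1)] x(2) by simp
    then have "(\<Sum>x'\<in>pverts X. if \<sigma> x' = y then 1 else 0) = (\<Sum>x'\<in>pverts X. if x' = x then 1 else (0::complex))"
      by (intro sum.cong) auto
    then show ?thesis using fin x by simp
  qed
  have \<sigma>V: "\<sigma> x \<in> pverts X" if "x \<in> pverts X" for x using \<sigma> that by (rule bij_betwE[rule_format])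
  show ?thesis
    unfolding graph_magic_def magic_def
  proof (intro conjI ballI impI)
    fix x assume x: "x \<in> pverts X"
    show "(\<Oplus>\<^bsub>complex_cstar\<^esub>y\<in>pverts X. if \<sigma> x = y then 1 else 0) = \<one>\<^bsub>complex_cstar\<^esub>"
      using fin \<sigma>V[OF x] by (simp add: finsum_complex_cstar)
    show "(\<Oplus>\<^bsub>complex_cstar\<^esub>y\<in>pverts X. if \<sigma> y = x then 1 else 0) = \<one>\<^bsub>complex_cstar\<^esub>"
      using fin col[OF x] by (simp add: finsum_complex_cstar)
  next
    fix x y x' y' assume V: "x \<in> pverts X" "y \<in> pverts X" "x' \<in> pverts X" "y' \<in> pverts X"
      and "(x, x') \<in> parcs X \<and> (y, y') \<notin> parcs X \<or> (x, x') \<notin> parcs X \<and> (y, y') \<in> parcs X"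
    then have "\<sigma> x \<noteq> y \<or> \<sigma> x' \<noteq> y'" using adj[OF V(1,3)] by blast
    then show "(if \<sigma> x = y then 1 else 0) \<otimes>\<^bsub>complex_cstar\<^esub> (if \<sigma> x' = y' then 1 else 0)
        = \<zero>\<^bsub>complex_cstar\<^esub>"
      by auto
  qed (simp add: proj_def)
qed

text \<open>In the free wreath product the sum of a row over the fibre of \<open>b\<close> is an
  entry of the top factor and does not depend on the point of the fibre of \<open>a\<close>.
  Injectivity of the isomorphism carries this equation back to \<open>Qut (graph_lex X Y)\<close>,
  where the character of \<open>\<sigma>\<close> can be evaluated.\<close>

lemma automorphism_maps_fibres:
  assumes X: "pair_graph X" and Y: "pair_graph Y"
    and eq: "qperm_equal (Qut (graph_lex X Y)) (free_wreath (Qut Y) (Qut X))"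
    and \<sigma>: "bij_betw \<sigma> (pverts X \<times> pverts Y) (pverts X \<times> pverts Y)"
    and adj: "\<And>s t. \<lbrakk>s \<in> pverts X \<times> pverts Y; t \<in> pverts X \<times> pverts Y\<rbrakk> \<Longrightarrow>
      (\<sigma> s, \<sigma> t) \<in> parcs (graph_lex X Y) \<longleftrightarrow> (s, t) \<in> parcs (graph_lex X Y)"
    and V: "a \<in> pverts X" "i \<in> pverts Y" "i' \<in> pverts Y"
  shows "fst (\<sigma> (a, i)) = fst (\<sigma> (a, i'))"
proof -
  let ?Z = "graph_lex X Y"
  interpret wr: wreath "Qut Y" "Qut X" by (rule wreath_Qut)
  interpret Z: cstar "cfun (Qut ?Z)" by (rule cstar_Qut)
  interpret W: cstar wr.W by (rule wr.cstar_W)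
  interpret C: cstar complex_cstar by (rule cstar_complex)
  note finY = pair_graphD(5)[OF Y]
  obtain h where h: "h \<in> star_iso (cfun (Qut ?Z)) wr.W"
    "\<And>s t. \<lbrakk>s \<in> pverts ?Z; t \<in> pverts ?Z\<rbrakk> \<Longrightarrow> h (fund (Qut ?Z) s t) = fund (free_wreath (Qut Y) (Qut X)) s t"
    using eq unfolding qperm_equal_def points_Qut by blast
  have hom: "h \<in> star_hom (cfun (Qut ?Z)) wr.W" and inj: "inj_on h (carrier (cfun (Qut ?Z)))"
    using h(1) by (auto simp: star_iso_def bij_betw_def)
  have magic: "C.graph_magic ?Z (\<lambda>s t. if \<sigma> s = t then 1 else 0)"
    by (rule graph_magic_automorphism[OF pair_graph_lex[OF X Y]]) (use \<sigma> adj in auto)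
  obtain \<chi> where \<chi>: "\<chi> \<in> cstar_hom (cfun (Qut ?Z)) complex_cstar"
    "\<And>s t. \<lbrakk>s \<in> pverts ?Z; t \<in> pverts ?Z\<rbrakk> \<Longrightarrow> \<chi> (fund (Qut ?Z) s t) = (if \<sigma> s = t then 1 else 0)"
    using Qut_universal[OF cstar_complex magic] by blast
  \<comment> \<open>The fibre that contains the image of \<open>(a, i)\<close>; for this choice the
    character takes the value 1 at \<open>S i\<close>, hence at \<open>S i'\<close>.\<close>
  define b where "b = fst (\<sigma> (a, i))"
  have \<sigma>V: "\<sigma> s \<in> pverts X \<times> pverts Y" if "s \<in> pverts X \<times> pverts Y" for s
    using \<sigma> that by (auto simp: bij_betw_def)
  have b: "b \<in> pverts X" using \<sigma>V[of "(a, i)"] V by (auto simp: b_def)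
  define S where "S i = (\<Oplus>\<^bsub>cfun (Qut ?Z)\<^esub>j\<in>pverts Y. fund (Qut ?Z) (a, i) (b, j))" for i
  have zc: "fund (Qut ?Z) (a, i) (b, j) \<in> carrier (cfun (Qut ?Z))" if "i \<in> pverts Y" "j \<in> pverts Y" for i j
    using that V b by (intro Qut_fund_closed) auto
  have Sc: "S i \<in> carrier (cfun (Qut ?Z))" if "i \<in> pverts Y" for i
    unfolding S_def using zc that by (intro Z.finsum_closed) auto
  have hS: "h (S i) = wr.V (fund (Qut X) a b)" if i: "i \<in> pverts Y" for i
  proof -
    have Uc: "wr.U a (fund (Qut Y) i j) \<in> carrier wr.W" if "j \<in> pverts Y" for j
      using star_homD(1)[OF cstar_homD(1)[OF wr.U_hom] Qut_fund_closed] that i V by simp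
    have Vc: "wr.V (fund (Qut X) a b) \<in> carrier wr.W"
      by (rule star_homD(1)[OF cstar_homD(1)[OF wr.V_hom] Qut_fund_closed[OF V(1) b]])
    have "h (S i) = (\<Oplus>\<^bsub>wr.W\<^esub>j\<in>pverts Y. h (fund (Qut ?Z) (a, i) (b, j)))"
      unfolding S_def
      by (rule star_hom_finsum[OF Z.star_alg_axioms W.star_alg_axioms hom]) (use zc i in auto)
    also have "\<dots> = (\<Oplus>\<^bsub>wr.W\<^esub>j\<in>pverts Y. wr.U a (fund (Qut Y) i j) \<otimes>\<^bsub>wr.W\<^esub> wr.V (fund (Qut X) a b))"
    proof (rule W.finsum_cong')
      fix j assume "j \<in> pverts Y"
      then show "h (fund (Qut ?Z) (a, i) (b, j)) = wr.U a (fund (Qut Y) i j) \<otimes>\<^bsub>wr.W\<^esub> wr.V (fund (Qut X) a b)"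
        using h(2)[of "(a, i)" "(b, j)"] wr.fund_wreath[of a b i j] V b i by simp
    qed (use Uc Vc in auto)
    also have "\<dots> = (\<Oplus>\<^bsub>wr.W\<^esub>j\<in>pverts Y. wr.U a (fund (Qut Y) i j)) \<otimes>\<^bsub>wr.W\<^esub> wr.V (fund (Qut X) a b)"
      using finY Uc Vc by (intro W.finsum_ldistr[symmetric]) auto
    also have "(\<Oplus>\<^bsub>wr.W\<^esub>j\<in>pverts Y. wr.U a (fund (Qut Y) i j)) = \<one>\<^bsub>wr.W\<^esub>"
      using graph_magic_hom[OF cstar_Qut wr.cstar_W wr.U_hom graph_magic_Qut, of a] V i
      by (simp add: W.graph_magic_def W.magic_def)
    finally show ?thesis using Vc by simp
  qed
  have \<chi>S: "\<chi> (S l) = (\<Sum>j\<in>pverts Y. if \<sigma> (a, l) = (b, j) then 1 else 0)" if l: "l \<in> pverts Y" for l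
  proof -
    have "\<chi> (S l) = (\<Oplus>\<^bsub>complex_cstar\<^esub>j\<in>pverts Y. \<chi> (fund (Qut ?Z) (a, l) (b, j)))"
      unfolding S_def
      by (rule star_hom_finsum[OF Z.star_alg_axioms C.star_alg_axioms cstar_homD(1)[OF \<chi>(1)]])
        (use zc l in auto)
    then show ?thesis using \<chi>(2) V b l finY by (simp add: finsum_complex_cstar)
  qed
  have "S i = S i'" using hS Sc V inj by (simp add: inj_on_def)
  then have "(\<Sum>j\<in>pverts Y. if \<sigma> (a, i') = (b, j) then 1 else (0::complex)) =
      (\<Sum>j\<in>pverts Y. if \<sigma> (a, i) = (b, j) then 1 else 0)"
    using \<chi>S[OF V(2)] \<chi>S[OF V(3)] by simp
  also have "\<dots> = (\<Sum>j\<in>pverts Y. if j = snd (\<sigma> (a, i)) then 1 else 0)"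
    by (intro sum.cong) (auto simp: b_def prod_eq_iff)
  also have "\<dots> = 1" using \<sigma>V[of "(a, i)"] V finY by auto
  finally have "\<exists>j\<in>pverts Y. \<sigma> (a, i') = (b, j)"
    by (rule contrapos_pp) simp
  then show ?thesis by (auto simp: b_def)
qed

text \<open>The swap respects adjacency between fibres because that depends only on neighbourhoods
  in \<open>X\<close>, which twins share. Inside a fibre, \<open>C\<close> contains both ends of an
  edge of \<open>Y\<close> or neither, so both are moved together. The points \<open>u\<close> in
  \<open>C\<close> and \<open>v\<close> outside witness that a fibre is torn apart.\<close>

lemma twins_swap:
  assumes X: "pair_graph X" and Y: "pair_graph Y" "pverts Y \<noteq> {}"
    and tw: "twins X x x'" and disc: "\<not> Digraph_Component.connected (with_proj Y)"
  shows "\<exists>\<sigma>. bij_betw \<sigma> (pverts X \<times> pverts Y) (pverts X \<times> pverts Y) \<and>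
    (\<forall>s \<in> pverts X \<times> pverts Y. \<forall>t \<in> pverts X \<times> pverts Y.
      (\<sigma> s, \<sigma> t) \<in> parcs (graph_lex X Y) \<longleftrightarrow> (s, t) \<in> parcs (graph_lex X Y)) \<and>
    (\<exists>i \<in> pverts Y. \<exists>i' \<in> pverts Y. fst (\<sigma> (x, i)) \<noteq> fst (\<sigma> (x, i')))"
proof -
  obtain C u v where C: "C \<subseteq> pverts Y" "u \<in> C" "v \<in> pverts Y - C"
    "\<And>i j. (i, j) \<in> parcs Y \<Longrightarrow> i \<in> C \<longleftrightarrow> j \<in> C"
    using disconnected_split[OF Y disc] by blast
  have x: "x \<in> pverts X" "x' \<in> pverts X" "x \<noteq> x'" using tw by (auto simp: twins_def)
  have nb: "(x, y) \<in> parcs X \<longleftrightarrow> (x', y) \<in> parcs X" for y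
    using tw by (auto simp: twins_def nbrs_def)
  have nb': "(y, x) \<in> parcs X \<longleftrightarrow> (y, x') \<in> parcs X" for y
    using nb pair_graphD(1)[OF X] by blast
  define \<tau> where "\<tau> i a = (if i \<in> C then (if a = x then x' else if a = x' then x else a) else a)" for i a
  define \<sigma> where "\<sigma> s = (\<tau> (snd s) (fst s), snd s)" for s
  have \<tau>: "\<tau> i (\<tau> i a) = a" "\<tau> i a \<in> pverts X \<longleftrightarrow> a \<in> pverts X" for i a
    using x by (auto simp: \<tau>_def)
  have \<tau>nb: "(\<tau> i a, \<tau> j b) \<in> parcs X \<longleftrightarrow> (a, b) \<in> parcs X" for i j a b
  proof -
    have "(\<tau> i a, c) \<in> parcs X \<longleftrightarrow> (a, c) \<in> parcs X" for c using nb[of c] by (simp add: \<tau>_def)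
    moreover have "(c, \<tau> j b) \<in> parcs X \<longleftrightarrow> (c, b) \<in> parcs X" for c using nb'[of c] by (simp add: \<tau>_def)
    ultimately show ?thesis by simp
  qed
  have bij: "bij_betw \<sigma> (pverts X \<times> pverts Y) (pverts X \<times> pverts Y)"
    by (rule bij_betw_byWitness[of _ \<sigma>]) (auto simp: \<sigma>_def \<tau>)
  have aut: "(\<sigma> s, \<sigma> t) \<in> parcs (graph_lex X Y) \<longleftrightarrow> (s, t) \<in> parcs (graph_lex X Y)" for s t
  proof -
    obtain a i b j where st: "s = (a, i)" "t = (b, j)" by (cases s, cases t)
    have "\<tau> i a = \<tau> j b \<longleftrightarrow> a = b" if "(i, j) \<in> parcs Y"
    proof -
      have "\<tau> j b = \<tau> i b" using C(4)[OF that] by (simp add: \<tau>_def)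
      then show ?thesis using \<tau>(1)[of i a] \<tau>(1)[of i b] by metis
    qed
    then show ?thesis by (auto simp: st \<sigma>_def \<tau>nb \<tau>(2))
  qed
  have "fst (\<sigma> (x, u)) \<noteq> fst (\<sigma> (x, v))"
    using C(2,3) x by (simp add: \<sigma>_def \<tau>_def)
  moreover have "u \<in> pverts Y" "v \<in> pverts Y" using C by auto
  ultimately show ?thesis using bij aut by blast
qed

text \<open>An injective map keeps distinct vertices distinct, and on distinct vertices adjacency in
  the complement is the negation of adjacency in \<open>X\<close>; equal vertices are nonadjacent in
  both.\<close>

lemma automorphism_of_compl:
  assumes X: "pair_graph X" and \<sigma>: "bij_betw \<sigma> (pverts X) (pverts X)"
    and adj: "\<And>x y. \<lbrakk>x \<in> pverts X; y \<in> pverts X\<rbrakk> \<Longrightarrow>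
      (\<sigma> x, \<sigma> y) \<in> parcs (graph_compl X) \<longleftrightarrow> (x, y) \<in> parcs (graph_compl X)"
    and V: "x \<in> pverts X" "y \<in> pverts X"
  shows "(\<sigma> x, \<sigma> y) \<in> parcs X \<longleftrightarrow> (x, y) \<in> parcs X"
proof (cases "x = y")
  case True
  then show ?thesis using pair_graphD(2)[OF X] by simp
next
  case False
  then have "\<sigma> x \<noteq> \<sigma> y" using inj_on_eq_iff[OF bij_betw_imp_inj_on[OF \<sigma>] V] by simp
  moreover have "\<sigma> x \<in> pverts X" "\<sigma> y \<in> pverts X" using bij_betwE[OF \<sigma>] V by auto
  ultimately show ?thesis using adj[OF V] V False by simp
qed

lemma no_twins_if_qperm_equal:
  assumes X: "pair_graph X" and Y: "pair_graph Y" "pverts Y \<noteq> {}"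
    and eq: "qperm_equal (Qut (graph_lex X Y)) (free_wreath (Qut Y) (Qut X))"
  shows "\<not> Digraph_Component.connected (with_proj Y) \<Longrightarrow> \<not> twins X x y"
    and "\<not> Digraph_Component.connected (with_proj (graph_compl Y)) \<Longrightarrow> \<not> twins (graph_compl X) x y"
proof -
  note fib = automorphism_maps_fibres[OF X Y(1) eq]
  show "\<not> twins X x y" if disc: "\<not> Digraph_Component.connected (with_proj Y)"
  proof
    assume tw: "twins X x y"
    then have "x \<in> pverts X" by (simp add: twins_def)
    with twins_swap[OF X Y tw disc] fib show False by blast
  qed
  show "\<not> twins (graph_compl X) x y" if disc: "\<not> Digraph_Component.connected (with_proj (graph_compl Y))"
  proof
    assume tw: "twins (graph_compl X) x y"
    then have x: "x \<in> pverts X" by (simp add: twins_def)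
    have ne: "pverts (graph_compl Y) \<noteq> {}" using Y(2) by simp
    \<comment> \<open>The swap is performed in the lexicographic product of the complements, which
      is the complement of \<open>graph_lex X Y\<close>. Read as an automorphism of
      \<open>graph_lex X Y\<close>, it contradicts the given equality directly.\<close>
    obtain \<sigma> i i' where \<sigma>: "bij_betw \<sigma> (pverts X \<times> pverts Y) (pverts X \<times> pverts Y)"
      "\<forall>s \<in> pverts X \<times> pverts Y. \<forall>t \<in> pverts X \<times> pverts Y.
        (\<sigma> s, \<sigma> t) \<in> parcs (graph_compl (graph_lex X Y)) \<longleftrightarrow> (s, t) \<in> parcs (graph_compl (graph_lex X Y))"
      and i: "i \<in> pverts Y" "i' \<in> pverts Y" "fst (\<sigma> (x, i)) \<noteq> fst (\<sigma> (x, i'))"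
      using twins_swap[OF pair_graph_compl[OF X] pair_graph_compl[OF Y(1)] ne tw disc]
      unfolding graph_compl_lex[OF X Y(1)] pverts_graph_compl by blast
    have "(\<sigma> s, \<sigma> t) \<in> parcs (graph_lex X Y) \<longleftrightarrow> (s, t) \<in> parcs (graph_lex X Y)"
      if "s \<in> pverts X \<times> pverts Y" "t \<in> pverts X \<times> pverts Y" for s t
      by (rule automorphism_of_compl[OF pair_graph_lex[OF X Y(1)]])
        (use \<sigma> that in \<open>simp_all only: pverts_graph_lex\<close>)
    from fib[OF \<sigma>(1) this x i(1,2)] i(3) show False by simp
  qed
qed

theorem theorem1p1:
  fixes X :: "'a pair_pre_digraph" and Y :: "'b pair_pre_digraph"
  assumes "pair_graph X" and "pverts X \<noteq> {}"
    and "pair_graph Y" and "pverts Y \<noteq> {}"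
  shows "qperm_equal (Qut (graph_lex X Y)) (free_wreath (Qut Y) (Qut X)) \<longleftrightarrow>
    (\<not> Digraph_Component.connected (with_proj Y) \<longrightarrow> (\<nexists>x y. twins X x y)) \<and>
    (\<not> Digraph_Component.connected (with_proj (graph_compl Y)) \<longrightarrow>
       (\<nexists>x y. twins (graph_compl X) x y))"
  using no_twins_if_qperm_equal[OF assms(1,3,4)] qperm_equal_if[OF assms(1,3,4)] by blast

end
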